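(* The following holds for every $\varepsilon>0$ that is sufficiently small (smaller than some absolute constant). Suppose $\mathbf{A}$ is an algorithm that takes any finite metric space $X$ with a constant-time distance oracle and $\operatorname{diam}(X)\le1$ as input, and $\varepsilon$-approximates the barcode of $H_1(\operatorname{VR}(X)_\bullet)$ of the Vietoris--Rips complex in the (additive) bottleneck distance. Suppose $\mathbf{A}$ takes $\mathcal{O}(|X|^q)$ time for some $q\ge1$. Then the rank of an $\mathbb{F}_2$-matrix $M$ with $m$ non-zero entries can be computed in $\mathcal{O}(m^q)$ time.
   Context: For a metric space $X$ and $t\ge0$, the Vietoris--Rips complex $\operatorname{VR}(X)_t$ is the simplicial complex on $X$ whose $k$-simplices are the subsets $\sigma\subseteq X$ with $|\sigma|=k+1$ and $\operatorname{diam}(\sigma)\le 2t$. These complexes form a filtration in $t$; applying $H_1(-;\mathbb{F}_2)$ gives a $1$-parameter persistence module $H_1(\operatorname{VR}(X)_\bullet)$, which has a barcode. Homology is taken with $\mathbb{F}_2$-coefficients. $\mathbf{A}$ $\varepsilon$-approximates the barcode if for every admissible $X$ it outputs a barcode whose bottleneck distance to the barcode of $H_1(\operatorname{VR}(X)_\bullet)$ is at most $\varepsilon$; by the isometry theorem, the bottleneck distance equals the interleaving distance of the corresponding persistence modules. It is assumed that the non-zero entries of $M$ can be accessed in constant amortized time. *)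

theory Defs
  imports
    "HOL-Analysis.Abstract_Metric_Spaces"
    "HOL-Algebra.Coset"
    "HOL-Library.Z2"
    "HOL-Library.Multiset"
    "HOL-Library.Extended_Real"
    "HOL-Library.Landau_Symbols"
    "Jordan_Normal_Form.DL_Rank"
begin

section \<open>Vietoris--Rips complexes and homology over the two-element field\<close>

text \<open>Same convention as the library's \<open>diameter\<close>, which is tied to the type class of metric
  spaces.\<close>

definition diam :: "('a \<Rightarrow> 'a \<Rightarrow> real) \<Rightarrow> 'a set \<Rightarrow> real" where
  "diam d S = (if S = {} then 0 else SUP (x, y)\<in>S \<times> S. d x y)"

definition VR :: "'a set \<Rightarrow> ('a \<Rightarrow> 'a \<Rightarrow> real) \<Rightarrow> real \<Rightarrow> 'a set set" where
  "VR X d t = {\<sigma>. \<sigma> \<subseteq> X \<and> finite \<sigma> \<and> \<sigma> \<noteq> {} \<and> diam d \<sigma> \<le> 2 * t}"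

text \<open>Vector spaces over the two-element field are represented by their additive groups, written
  multiplicatively as in HOL-Algebra. Scalar multiplication by 0 and 1 is determined by the group
  structure, and every group homomorphism between such spaces is linear.\<close>

definition chain_group :: "'a set set \<Rightarrow> nat \<Rightarrow> ('a set \<Rightarrow> bit) monoid" where
  "chain_group K k =
    \<lparr>carrier = {c. finite {\<sigma>. c \<sigma> \<noteq> 0} \<and> (\<forall>\<sigma>. c \<sigma> \<noteq> 0 \<longrightarrow> \<sigma> \<in> K \<and> card \<sigma> = Suc k)},
     mult = (\<lambda>c c' \<sigma>. c \<sigma> + c' \<sigma>),
     one = (\<lambda>\<sigma>. 0)\<rparr>"

text \<open>The empty set is not a simplex: homology is not reduced.\<close>

definition boundary :: "('a set \<Rightarrow> bit) \<Rightarrow> 'a set \<Rightarrow> bit" where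
  "boundary c \<tau> =
    (if \<tau> = {} then 0 else \<Sum>\<sigma> | c \<sigma> \<noteq> 0 \<and> \<tau> \<subseteq> \<sigma> \<and> card \<sigma> = Suc (card \<tau>). c \<sigma>)"

definition cycles :: "'a set set \<Rightarrow> nat \<Rightarrow> ('a set \<Rightarrow> bit) set" where
  "cycles K k = {c \<in> carrier (chain_group K k). boundary c = (\<lambda>\<tau>. 0)}"

definition boundaries :: "'a set set \<Rightarrow> nat \<Rightarrow> ('a set \<Rightarrow> bit) set" where
  "boundaries K k = boundary ` carrier (chain_group K (Suc k))"

definition homology :: "nat \<Rightarrow> 'a set set \<Rightarrow> ('a set \<Rightarrow> bit) set monoid" where
  "homology k K = (chain_group K k)\<lparr>carrier := cycles K k\<rparr> Mod boundaries K k"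

text \<open>The map into the homology of \<open>L\<close> induced by an inclusion of a subcomplex, \<open>[c] \<mapsto> [c]\<close>:
  all representatives \<open>c\<close> of a class give the same coset in the union.\<close>

definition homology_inclusion ::
    "nat \<Rightarrow> 'a set set \<Rightarrow> ('a set \<Rightarrow> bit) set \<Rightarrow> ('a set \<Rightarrow> bit) set" where
  "homology_inclusion k L z = (\<Union>c\<in>z. boundaries L k #>\<^bsub>chain_group L k\<^esub> c)"


section \<open>Barcodes\<close>

text \<open>A pair \<open>(b, d)\<close> stands for the half-open interval \<open>[b, d)\<close>.\<close>

type_synonym barcode = "(real \<times> ereal) multiset"

definition interval :: "real \<times> ereal \<Rightarrow> real set" where
  "interval p = {t. fst p \<le> t \<and> ereal t < snd p}"

definition is_barcode :: "barcode \<Rightarrow> bool" where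
  "is_barcode B \<longleftrightarrow> (\<forall>(b, d)\<in>#B. ereal b < d)"

text \<open>The direct sum of the interval modules given by a list of bars, in coordinates:
  the \<open>i\<close>-th summand is nonzero at \<open>t\<close> iff \<open>t\<close> lies in the \<open>i\<close>-th bar.\<close>

definition interval_sum :: "(real \<times> ereal) list \<Rightarrow> real \<Rightarrow> (nat \<Rightarrow> bit) monoid" where
  "interval_sum bs t =
    \<lparr>carrier = {v. \<forall>i. v i \<noteq> 0 \<longrightarrow> i < length bs \<and> t \<in> interval (bs ! i)},
     mult = (\<lambda>v w i. v i + w i),
     one = (\<lambda>i. 0)\<rparr>"

definition interval_sum_map ::
    "(real \<times> ereal) list \<Rightarrow> real \<Rightarrow> (nat \<Rightarrow> bit) \<Rightarrow> nat \<Rightarrow> bit" where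
  "interval_sum_map bs t v = (\<lambda>i. if i < length bs \<and> t \<in> interval (bs ! i) then v i else 0)"

text \<open>A persistence module indexed by \<open>[0, \<infinity>)\<close> consists of the spaces \<open>V t\<close> and the structure maps
  \<open>f s t\<close> from \<open>V s\<close> to \<open>V t\<close> for \<open>s \<le> t\<close>.\<close>

definition barcode_of ::
    "(real \<Rightarrow> 'v monoid) \<Rightarrow> (real \<Rightarrow> real \<Rightarrow> 'v \<Rightarrow> 'v) \<Rightarrow> barcode \<Rightarrow> bool" where
  "barcode_of V f B \<longleftrightarrow>
    is_barcode B \<and> (\<forall>(b, d)\<in>#B. 0 \<le> b) \<and>
    (\<exists>bs \<phi>. mset bs = B \<and>
       (\<forall>t\<ge>0. \<phi> t \<in> iso (V t) (interval_sum bs t)) \<and>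
       (\<forall>s\<ge>0. \<forall>t\<ge>s. \<forall>x\<in>carrier (V s).
          \<phi> t (f s t x) = interval_sum_map bs t (\<phi> s x)))"

definition VR_barcode :: "nat \<Rightarrow> 'a set \<Rightarrow> ('a \<Rightarrow> 'a \<Rightarrow> real) \<Rightarrow> barcode \<Rightarrow> bool" where
  "VR_barcode k X d =
    barcode_of (\<lambda>t. homology k (VR X d t)) (\<lambda>s t. homology_inclusion k (VR X d t))"

text \<open>In a \<open>\<delta>\<close>-matching, \<open>P\<close> collects the pairs of matched bars, \<open>U\<close> and \<open>W\<close> the unmatched
  bars.\<close>

definition bottleneck_matching :: "real \<Rightarrow> barcode \<Rightarrow> barcode \<Rightarrow> bool" where
  "bottleneck_matching \<delta> B C \<longleftrightarrow>
    (\<exists>P U W. B = image_mset fst P + U \<and> C = image_mset snd P + W \<and>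
       (\<forall>((b, d), (b', d'))\<in>#P. \<bar>b - b'\<bar> \<le> \<delta> \<and> d \<le> d' + ereal \<delta> \<and> d' \<le> d + ereal \<delta>) \<and>
       (\<forall>(b, d)\<in>#U + W. d \<le> ereal (b + 2 * \<delta>)))"

definition bottleneck_distance :: "barcode \<Rightarrow> barcode \<Rightarrow> ereal" where
  "bottleneck_distance B C = Inf {ereal \<delta> | \<delta>. 0 \<le> \<delta> \<and> bottleneck_matching \<delta> B C}"


section \<open>Real RAM with an oracle\<close>

text \<open>The computation model is the real RAM: memory cells hold real numbers, and arithmetic,
  comparisons, indirect addressing and oracle queries take unit time. There is no rounding
  operation, and constants are rational. The memory is divided into registers and arrays indexed
  by natural numbers; a program mentions only finitely many of them. Structured control flow
  replaces jumps, which changes running times by at most a constant factor.\<close>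

datatype arith_op = Add | Sub | Mul | Div

datatype prog =
    Skip
  | Const nat rat
  | Arith nat arith_op nat nat
  | Load nat nat nat
  | Store nat nat nat
  | Query nat nat nat
  | Seq prog prog
  | IfLess nat nat prog prog
  | WhileLess nat nat prog

type_synonym state = "(nat \<Rightarrow> real) \<times> (nat \<Rightarrow> nat \<Rightarrow> real)"

fun apply_op :: "arith_op \<Rightarrow> real \<Rightarrow> real \<Rightarrow> real" where
  "apply_op Add x y = x + y"
| "apply_op Sub x y = x - y"
| "apply_op Mul x y = x * y"
| "apply_op Div x y = x / y"

text \<open>\<open>exec orc p s t s'\<close>: started in state \<open>s\<close>, the program \<open>p\<close> halts in state \<open>s'\<close> after
  \<open>t\<close> steps. An address or query argument that is not a natural number blocks the execution, so
  that indirect addressing cannot be used for rounding.\<close>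

inductive exec :: "(nat \<Rightarrow> nat \<Rightarrow> real) \<Rightarrow> prog \<Rightarrow> state \<Rightarrow> nat \<Rightarrow> state \<Rightarrow> bool"
  for orc :: "nat \<Rightarrow> nat \<Rightarrow> real" where
  Skip: "exec orc Skip s 1 s"
| Const: "exec orc (Const x q) (r, a) 1 (r(x := of_rat q), a)"
| Arith: "exec orc (Arith x f y z) (r, a) 1 (r(x := apply_op f (r y) (r z)), a)"
| Load: "r y = real i \<Longrightarrow> exec orc (Load x b y) (r, a) 1 (r(x := a b i), a)"
| Store: "r y = real i \<Longrightarrow> exec orc (Store b y x) (r, a) 1 (r, a(b := (a b)(i := r x)))"
| Query: "r y = real i \<Longrightarrow> r z = real j \<Longrightarrow>
    exec orc (Query x y z) (r, a) 1 (r(x := orc i j), a)"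
| Seq: "exec orc p s t s' \<Longrightarrow> exec orc p' s' t' s'' \<Longrightarrow> exec orc (Seq p p') s (t + t') s''"
| IfTrue: "r x < r y \<Longrightarrow> exec orc p (r, a) t s' \<Longrightarrow>
    exec orc (IfLess x y p p') (r, a) (Suc t) s'"
| IfFalse: "\<not> r x < r y \<Longrightarrow> exec orc p' (r, a) t s' \<Longrightarrow>
    exec orc (IfLess x y p p') (r, a) (Suc t) s'"
| WhileFalse: "\<not> r x < r y \<Longrightarrow> exec orc (WhileLess x y p) (r, a) 1 (r, a)"
| WhileTrue: "r x < r y \<Longrightarrow> exec orc p (r, a) t s' \<Longrightarrow> exec orc (WhileLess x y p) s' t' s'' \<Longrightarrow>
    exec orc (WhileLess x y p) (r, a) (Suc (t + t')) s''"

definition input_state :: "nat list \<Rightarrow> state" where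
  "input_state xs = ((\<lambda>i. if i < length xs then real (xs ! i) else 0), (\<lambda>b i. 0))"


section \<open>The two computational problems\<close>

definition distance_oracle :: "nat \<Rightarrow> (nat \<Rightarrow> nat \<Rightarrow> real) \<Rightarrow> nat \<Rightarrow> nat \<Rightarrow> real" where
  "distance_oracle n d i j = (if i < n \<and> j < n then d i j else 0)"

text \<open>Register 0 holds the number of bars, arrays 0 and 1 hold their births and deaths. All bars of
  the first homology of a finite Vietoris--Rips filtration are bounded, so a barcode at finite
  bottleneck distance from it has no unbounded bars, and real deaths suffice.\<close>

definition outputs_barcode :: "state \<Rightarrow> barcode \<Rightarrow> bool" where
  "outputs_barcode s B \<longleftrightarrow> is_barcode B \<and>
    (\<exists>k. fst s 0 = real k \<and> B = mset (map (\<lambda>i. (snd s 0 i, ereal (snd s 1 i))) [0..<k]))"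

text \<open>An algorithm accesses the points of a finite metric space only through an enumeration, hence
  the points are taken to be \<open>0, \<dots>, n - 1\<close>. The running time is bounded in terms of \<open>n\<close>.\<close>

definition approximates_VR_barcode :: "real \<Rightarrow> prog \<Rightarrow> (nat \<Rightarrow> real) \<Rightarrow> bool" where
  "approximates_VR_barcode \<epsilon> p T \<longleftrightarrow>
    (\<forall>n d. Metric_space {..<n} d \<and> diam d {..<n} \<le> 1 \<longrightarrow>
      (\<exists>t s B C. exec (distance_oracle n d) p (input_state [n]) t s \<and> real t \<le> T n \<and>
         outputs_barcode s B \<and> VR_barcode 1 {..<n} d C \<and> bottleneck_distance B C \<le> ereal \<epsilon>))"

definition enumerates_nonzeros :: "(nat \<times> nat) list \<Rightarrow> bit mat \<Rightarrow> bool" where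
  "enumerates_nonzeros es M \<longleftrightarrow> distinct es \<and>
    set es = {(i, j). i < dim_row M \<and> j < dim_col M \<and> M $$ (i, j) \<noteq> 0}"

text \<open>The query \<open>(k, 0)\<close> returns the row and \<open>(k, 1)\<close> the column of the \<open>k\<close>-th nonzero entry.\<close>

definition entry_oracle :: "(nat \<times> nat) list \<Rightarrow> nat \<Rightarrow> nat \<Rightarrow> real" where
  "entry_oracle es k l =
    (if k < length es then real (if l = 0 then fst (es ! k) else snd (es ! k)) else 0)"

text \<open>The nonzero entries come in arbitrary order, and the running time is bounded in terms of their
  number only, not of the dimensions of the matrix.\<close>

definition computes_rank :: "prog \<Rightarrow> (nat \<Rightarrow> real) \<Rightarrow> bool" where
  "computes_rank p T \<longleftrightarrow>
    (\<forall>nr nc M es. M \<in> carrier_mat nr nc \<and> enumerates_nonzeros es M \<longrightarrow>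
      (\<exists>t s. exec (entry_oracle es) p (input_state [length es, nr, nc]) t s \<and>
         real t \<le> T (length es) \<and> fst s 0 = real (vec_space.rank nr M)))"

end

theory Submission
  imports Defs
begin

text \<open>The nonzero entries of a matrix \<open>M\<close> are turned into a graph with \<open>O(m)\<close> vertices such that the first
  homology of its clique complex has dimension \<open>R - rank M\<close>, where \<open>R\<close> is the number of nonempty rows. For
  the metric with distance \<open>1/2\<close> on edges and \<open>1\<close> elsewhere, the Vietoris--Rips complex is discrete
  before \<open>1/4\<close>, the clique complex on \<open>[1/4, 1/2)\<close> and a full simplex afterwards, so the barcode consists
  of \<open>R - rank M\<close> copies of \<open>[1/4, 1/2)\<close>. Any barcode at distance less than \<open>1/16\<close> from it has exactly
  \<open>R - rank M\<close> bars longer than \<open>1/8\<close>.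

  Homology is only ever counted: orthogonal complements in \<open>F\<^sub>2\<^sup>n\<close> turn \<open>|H\<^sub>1|\<close> into the number of
  edge labellings that sum to zero on every triangle, modulo coboundaries. The graph is made such that these are
  the solutions of the linear system with matrix \<open>M\<^sup>T\<close>.\<close>

section \<open>Duality over the two-element field\<close>

text \<open>A triangle relates only three edge labels, while a column may have many entries. A
  column sum is therefore built up entry by entry, with two new vertices per entry. An arbitrary
  graph would also contribute many unwanted cycles; here every vertex is joined to poles and all
  poles to one base, so that each cycle is accounted for by bits attached to single vertices. The
  metric has on the order of \<open>m * m\<close> distances, too many to be written down if
  \<open>q\<close> is close to 1. Instead, each query of the simulated algorithm is answered in
  constant time from an array in which only the O(m) edges have been stored, all other cells being
  zero from the start. The addresses in this array require a bound on the number of vertices before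
  the nonempty rows have been counted. The constant 1/16 is a quarter of the length of the bars. A
  matching below it leaves no true bar unmatched; it moves each end by less than 1/16, so matched
  bars stay longer than 1/8, and it leaves only bars shorter than 1/8 unmatched.\<close>

definition functions_on :: "'a set \<Rightarrow> ('a \<Rightarrow> bit) set" where
  "functions_on S = {f. \<forall>x. f x \<noteq> 0 \<longrightarrow> x \<in> S}"

definition dot :: "'a set \<Rightarrow> ('a \<Rightarrow> bit) \<Rightarrow> ('a \<Rightarrow> bit) \<Rightarrow> bit" where
  "dot S f g = (\<Sum>x\<in>S. f x * g x)"

definition perp :: "'a set \<Rightarrow> ('a \<Rightarrow> bit) set \<Rightarrow> ('a \<Rightarrow> bit) set" where
  "perp S W = {g \<in> functions_on S. \<forall>w\<in>W. dot S w g = 0}"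

definition f2_subspace :: "'a set \<Rightarrow> ('a \<Rightarrow> bit) set \<Rightarrow> bool" where
  "f2_subspace S W \<longleftrightarrow> W \<subseteq> functions_on S \<and> (\<lambda>_. 0) \<in> W \<and> (\<forall>f\<in>W. \<forall>g\<in>W. (\<lambda>x. f x + g x) \<in> W)"

declare add_bit_eq_xor [simp del] mult_bit_eq_and [simp del]

lemma bit_add_self [simp]: "(b::bit) + b = 0"
  by (cases b) (auto simp: one_add_one)

lemma bit_add_eq_0_iff: "(a::bit) + b = 0 \<longleftrightarrow> a = b"
  by (cases a; cases b) auto

lemma bit_add_left_cancel [simp]: "(a::bit) + (a + b) = b"
  by (simp add: add.assoc [symmetric])

lemma functions_on_bij: "bij_betw (\<lambda>T x. if x \<in> T then 1 else (0::bit)) (Pow S) (functions_on S)"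
proof (rule bij_betw_byWitness[where f' = "\<lambda>f. {x. f x \<noteq> 0}"])
qed (auto simp: functions_on_def fun_eq_iff split: if_splits)

lemma functions_onD: "f \<in> functions_on S \<Longrightarrow> x \<notin> S \<Longrightarrow> f x = 0"
  by (auto simp: functions_on_def)

lemma card_functions_on: "finite S \<Longrightarrow> card (functions_on S) = 2 ^ card S"
  using bij_betw_same_card[OF functions_on_bij[of S]] by (simp add: card_Pow)

lemma finite_functions_on: "finite S \<Longrightarrow> finite (functions_on S)"
  using bij_betw_finite[OF functions_on_bij[of S]] by simp

lemma f2_subspace_functions_on: "f2_subspace S (functions_on S)"
  unfolding f2_subspace_def functions_on_def
  by auto (metis add.right_neutral bit_not_one_iff)

lemma f2_subspace_finite: "finite S \<Longrightarrow> f2_subspace S W \<Longrightarrow> finite W"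
  unfolding f2_subspace_def by (meson finite_functions_on finite_subset)

lemma dot_commute: "dot S f g = dot S g f"
  by (simp add: dot_def mult.commute)

lemma dot_add: "dot S (\<lambda>x. f x + g x) h = dot S f h + dot S g h"
  by (simp add: dot_def distrib_right sum.distrib)

definition chi :: "bit \<Rightarrow> int" where "chi b = (if b = 0 then 1 else - 1)"

lemma chi_add: "chi (a + b) = chi a * chi b"
  by (cases a; cases b) (auto simp: chi_def)

text \<open>Orthogonality of characters: if \<open>L w0\<close> is nonzero for some
  \<open>w0\<close> in \<open>W\<close>, translation by \<open>w0\<close> permutes \<open>W\<close>
  and flips every sign, so the sum equals its own negative.\<close>

lemma sum_chi:
  assumes W: "f2_subspace S W" "finite S"
    and L: "\<And>f g. L (\<lambda>x. f x + g x) = L f + L g"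
  shows "(\<Sum>w\<in>W. chi (L w)) = (if \<forall>w\<in>W. L w = 0 then int (card W) else 0)"
proof (cases "\<forall>w\<in>W. L w = 0")
  case True
  then show ?thesis by (simp add: chi_def)
next
  case False
  then obtain w0 where w0: "w0 \<in> W" "L w0 \<noteq> 0" by auto
  have "bij_betw (\<lambda>f x. w0 x + f x) W W"
    by (rule bij_betw_byWitness[where f' = "\<lambda>f x. w0 x + f x"])
      (use W w0 in \<open>auto simp: f2_subspace_def\<close>)
  then have "(\<Sum>w\<in>W. chi (L w)) = (\<Sum>w\<in>W. chi (L (\<lambda>x. w0 x + w x)))"
    by (rule sum.reindex_bij_betw [symmetric])
  also have "\<dots> = (\<Sum>w\<in>W. - chi (L w))"
    using w0 by (simp add: L chi_add) (simp add: chi_def sum_negf)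
  finally have "(\<Sum>w\<in>W. chi (L w)) = 0" by (simp add: sum_negf)
  then show ?thesis unfolding if_not_P[OF False] .
qed

text \<open>Counting the sum of the signs of all pairings in both orders.\<close>

lemma card_perp:
  assumes "f2_subspace S W" "finite S"
  shows "card W * card (perp S W) = 2 ^ card S"
proof -
  let ?F = "functions_on S"
  have fin: "finite W" "finite ?F"
    using assms f2_subspace_finite finite_functions_on by blast+
  have unit: "dot S w (\<lambda>y. if y = x then 1 else 0) = w x" if "x \<in> S" for w x
    using that assms(2) by (simp add: dot_def if_distrib cong: if_cong)
  \<comment> \<open>Nondegeneracy of the pairing, tested on the unit functions of the previous
    step.\<close>
  have zero: "(\<forall>g\<in>?F. dot S w g = 0) \<longleftrightarrow> w = (\<lambda>_. 0)" if "w \<in> W" for w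
  proof
    assume *: "\<forall>g\<in>?F. dot S w g = 0"
    have "w x = 0" for x
    proof (cases "x \<in> S")
      case True
      then have "(\<lambda>y. if y = x then 1 else (0::bit)) \<in> ?F" by (simp add: functions_on_def)
      with * have "dot S w (\<lambda>y. if y = x then 1 else 0) = 0" by (rule bspec)
      then show ?thesis using unit[OF True] by simp
    next
      case False
      have "w \<in> functions_on S" using that assms(1) unfolding f2_subspace_def by (meson subsetD)
      then show ?thesis using False by (rule functions_onD)
    qed
    then show "w = (\<lambda>_. 0)" by auto
  qed (simp add: dot_def)
  have "(\<Sum>w\<in>W. \<Sum>g\<in>?F. chi (dot S w g)) = (\<Sum>w\<in>W. if w = (\<lambda>_. 0) then int (card ?F) else 0)"
  proof (rule sum.cong[OF refl])
    fix w assume "w \<in> W"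
    have "(\<Sum>g\<in>?F. chi (dot S w g)) = (if \<forall>g\<in>?F. dot S w g = 0 then int (card ?F) else 0)"
      by (rule sum_chi[OF f2_subspace_functions_on assms(2)])
        (unfold dot_commute[of S w], rule dot_add)
    then show "(\<Sum>g\<in>?F. chi (dot S w g)) = (if w = (\<lambda>_. 0) then int (card ?F) else 0)"
      using zero[OF \<open>w \<in> W\<close>] by simp
  qed
  also have "\<dots> = int (card ?F)"
    using fin assms by (simp add: f2_subspace_def)
  finally have 1: "(\<Sum>w\<in>W. \<Sum>g\<in>?F. chi (dot S w g)) = int (2 ^ card S)"
    using card_functions_on assms by simp
  have "(\<Sum>g\<in>?F. \<Sum>w\<in>W. chi (dot S w g)) = (\<Sum>g\<in>?F. if g \<in> perp S W then int (card W) else 0)"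
  proof (rule sum.cong[OF refl])
    fix g assume "g \<in> ?F"
    have "(\<Sum>w\<in>W. chi (dot S w g)) = (if \<forall>w\<in>W. dot S w g = 0 then int (card W) else 0)"
      by (rule sum_chi[OF assms]) (rule dot_add)
    then show "(\<Sum>w\<in>W. chi (dot S w g)) = (if g \<in> perp S W then int (card W) else 0)"
      using \<open>g \<in> ?F\<close> by (simp add: perp_def)
  qed
  also have "\<dots> = (\<Sum>g\<in>perp S W. int (card W))"
    using fin(2) by (subst sum.inter_restrict [symmetric]) (simp_all add: perp_def Int_def)
  also have "\<dots> = int (card W * card (perp S W))"
    by simp
  finally have "int (card W * card (perp S W)) = int (2 ^ card S)"
    using 1 by (subst (asm) sum.swap) simp
  then show ?thesis by (simp only: of_nat_eq_iff)
qed

section \<open>Counting first homology\<close>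

declare One_nat_def [simp del]

definition edges_of :: "'a set set \<Rightarrow> 'a set set" where
  "edges_of K = {\<sigma> \<in> K. card \<sigma> = 2}"

definition coboundary :: "'a set set \<Rightarrow> ('a \<Rightarrow> bit) \<Rightarrow> 'a set \<Rightarrow> bit" where
  "coboundary K g \<sigma> = (if \<sigma> \<in> edges_of K then \<Sum>v\<in>\<sigma>. g v else 0)"

definition cocycles :: "'a set set \<Rightarrow> ('a set \<Rightarrow> bit) set" where
  "cocycles K = {f \<in> functions_on (edges_of K).
     \<forall>\<tau>\<in>K. card \<tau> = 3 \<longrightarrow> (\<Sum>\<sigma> | \<sigma> \<subseteq> \<tau> \<and> card \<sigma> = 2. f \<sigma>) = 0}"

lemma two_subsets_of_triple:
  assumes "a \<noteq> b" "a \<noteq> c" "b \<noteq> c"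
  shows "{\<sigma>. \<sigma> \<subseteq> {a, b, c} \<and> card \<sigma> = 2} = {{a, b}, {a, c}, {b, c}}"
  using assms by (fastforce simp: card_2_iff)

lemma sum_two_subsets:
  assumes "a \<noteq> b" "a \<noteq> c" "b \<noteq> c"
  shows "(\<Sum>\<sigma> | \<sigma> \<subseteq> {a, b, c} \<and> card \<sigma> = 2. (f \<sigma> :: bit)) = f {a, b} + f {a, c} + f {b, c}"
proof -
  have "{a, b} \<noteq> {a, c}" "{a, b} \<noteq> {b, c}" "{a, c} \<noteq> {b, c}"
    using assms by (auto simp: doubleton_eq_iff)
  then show ?thesis by (simp add: two_subsets_of_triple[OF assms] add.assoc)
qed

locale finite_complex =
  fixes V :: "'a set" and K :: "'a set set"
  assumes finite_V: "finite V"
    and simplex: "\<sigma> \<in> K \<Longrightarrow> \<sigma> \<subseteq> V"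
    and face: "\<sigma> \<in> K \<Longrightarrow> \<tau> \<subseteq> \<sigma> \<Longrightarrow> \<tau> \<noteq> {} \<Longrightarrow> \<tau> \<in> K"
begin

lemma finite_K: "finite K"
  using finite_V simplex by (meson PowI finite_Pow_iff finite_subset subsetI)

lemma carrier_chain_group: "carrier (chain_group K k) = functions_on {\<sigma> \<in> K. card \<sigma> = Suc k}"
proof -
  have "finite {\<sigma>. c \<sigma> \<noteq> 0}" if "\<forall>\<sigma>. c \<sigma> \<noteq> 0 \<longrightarrow> \<sigma> \<in> K \<and> card \<sigma> = Suc k" for c :: "'a set \<Rightarrow> bit"
    using that finite_K by (auto intro: finite_subset[of _ K])
  then show ?thesis by (auto simp: chain_group_def functions_on_def)
qed

lemma carrier_chain_1: "carrier (chain_group K 1) = functions_on (edges_of K)"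
  unfolding carrier_chain_group edges_of_def by (simp add: numeral_2_eq_2)

lemma carrier_chain_2: "carrier (chain_group K (Suc 1)) = functions_on {\<sigma> \<in> K. card \<sigma> = 3}"
  unfolding carrier_chain_group by (simp add: numeral_3_eq_3)

lemma finite_edges: "finite (edges_of K)"
  using finite_K by (simp add: edges_of_def)

text \<open>Summing over a fixed finite \<open>S\<close> instead of the support of the chain makes
  additivity visible and lets sums be exchanged.\<close>

lemma boundary_eq:
  assumes "c \<in> functions_on S" "finite S" "\<tau> \<noteq> {}"
  shows "boundary c \<tau> = (\<Sum>\<sigma>\<in>S. if \<tau> \<subseteq> \<sigma> \<and> card \<sigma> = Suc (card \<tau>) then c \<sigma> else 0)"
proof -
  have "boundary c \<tau> = (\<Sum>\<sigma> | \<sigma> \<in> S \<and> (\<tau> \<subseteq> \<sigma> \<and> card \<sigma> = Suc (card \<tau>)). c \<sigma>)"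
    unfolding boundary_def if_not_P[OF assms(3)]
    by (rule sum.mono_neutral_left) (use assms in \<open>auto simp: functions_on_def\<close>)
  then show ?thesis using assms(2) by (simp add: sum.inter_filter)
qed

text \<open>Adjointness of boundary and coboundary: both sides run over the incidences of a vertex
  with an edge, weighted by \<open>g v * c \<sigma>\<close>.\<close>

lemma dot_coboundary:
  assumes "c \<in> functions_on (edges_of K)"
  shows "dot (edges_of K) (coboundary K g) c = (\<Sum>v\<in>V. g v * boundary c {v})"
proof -
  let ?E = "edges_of K"
  have "dot ?E (coboundary K g) c = (\<Sum>\<sigma>\<in>?E. \<Sum>v\<in>V. if v \<in> \<sigma> then g v * c \<sigma> else 0)"
    unfolding dot_def
  proof (rule sum.cong[OF refl])
    fix \<sigma> assume \<sigma>: "\<sigma> \<in> ?E"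
    then have "\<sigma> \<subseteq> V" using simplex by (auto simp: edges_of_def)
    then have "(\<Sum>v\<in>V. if v \<in> \<sigma> then g v * c \<sigma> else 0) = (\<Sum>v\<in>\<sigma>. g v * c \<sigma>)"
      using finite_V by (simp add: sum.inter_restrict [symmetric] Int_absorb1)
    then show "coboundary K g \<sigma> * c \<sigma> = (\<Sum>v\<in>V. if v \<in> \<sigma> then g v * c \<sigma> else 0)"
      using \<sigma> by (simp add: coboundary_def sum_distrib_right)
  qed
  also have "\<dots> = (\<Sum>v\<in>V. \<Sum>\<sigma>\<in>?E. if v \<in> \<sigma> then g v * c \<sigma> else 0)"
    by (rule sum.swap)
  also have "\<dots> = (\<Sum>v\<in>V. g v * boundary c {v})"
  proof (rule sum.cong[OF refl])
    fix v
    have "boundary c {v} = (\<Sum>\<sigma>\<in>?E. if v \<in> \<sigma> then c \<sigma> else 0)"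
      by (subst boundary_eq[OF assms finite_edges]) (auto simp: edges_of_def intro!: sum.cong)
    then show "(\<Sum>\<sigma>\<in>?E. if v \<in> \<sigma> then g v * c \<sigma> else 0) = g v * boundary c {v}"
      by (auto simp: sum_distrib_left intro!: sum.cong)
  qed
  finally show ?thesis .
qed

text \<open>The boundary of an edge chain is supported on one-element sets: a set with one element
  less than an edge is a singleton, and edges stay inside \<open>V\<close>.\<close>

lemma boundary_1_eq_0_iff:
  assumes "c \<in> functions_on (edges_of K)"
  shows "boundary c = (\<lambda>_. 0) \<longleftrightarrow> (\<forall>v\<in>V. boundary c {v} = 0)"
proof
  assume *: "\<forall>v\<in>V. boundary c {v} = 0"
  have "boundary c \<tau> = 0" for \<tau>
  proof (cases "\<tau> = {}")
    case True
    then show ?thesis by (simp add: boundary_def)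
  next
    case False
    show ?thesis
    proof (rule ccontr)
      assume "boundary c \<tau> \<noteq> 0"
      then obtain \<sigma> where \<sigma>: "\<sigma> \<in> edges_of K" "\<tau> \<subseteq> \<sigma>" "card \<sigma> = Suc (card \<tau>)"
        unfolding boundary_eq[OF assms finite_edges False]
        by (elim sum.not_neutral_contains_not_neutral) (auto split: if_splits)
      then have "card \<tau> = 1" "\<sigma> \<subseteq> V" using simplex by (auto simp: edges_of_def)
      then obtain v where "\<tau> = {v}" by (auto elim: card_1_singletonE)
      then have "\<tau> = {v}" "v \<in> V" using \<sigma> \<open>\<sigma> \<subseteq> V\<close> by auto
      then show False using * \<open>boundary c \<tau> \<noteq> 0\<close> by simp
    qed
  qed
  then show "boundary c = (\<lambda>_. 0)" by auto
qed simp

text \<open>By adjointness, orthogonality to all coboundaries means that the boundary pairs to zero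
  with every \<open>g\<close>; the indicator of a vertex extracts a single coefficient.\<close>

lemma cycles_eq_perp: "cycles K 1 = perp (edges_of K) (coboundary K ` functions_on V)"
proof -
  have "boundary c = (\<lambda>_. 0) \<longleftrightarrow> (\<forall>g\<in>functions_on V. dot (edges_of K) (coboundary K g) c = 0)"
    if c: "c \<in> functions_on (edges_of K)" for c
  proof
    assume *: "\<forall>g\<in>functions_on V. dot (edges_of K) (coboundary K g) c = 0"
    have "boundary c {v} = 0" if "v \<in> V" for v
    proof -
      have "(\<lambda>u. if u = v then 1 else (0::bit)) \<in> functions_on V"
        using that by (simp add: functions_on_def)
      then have "(\<Sum>u\<in>V. (if u = v then 1 else 0) * boundary c {u}) = 0"
        using * dot_coboundary[OF c] by metis
      moreover have "(\<Sum>u\<in>V. (if u = v then 1 else 0) * boundary c {u}) =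
          (\<Sum>u\<in>V. if u = v then boundary c {u} else 0)"
        by (rule sum.cong) auto
      ultimately show ?thesis using that finite_V by simp
    qed
    then show "boundary c = (\<lambda>_. 0)" using boundary_1_eq_0_iff[OF c] by blast
  next
    assume "boundary c = (\<lambda>_. 0)"
    then show "\<forall>g\<in>functions_on V. dot (edges_of K) (coboundary K g) c = 0"
      by (simp add: dot_coboundary[OF c])
  qed
  then show ?thesis
    unfolding cycles_def perp_def carrier_chain_1 by auto
qed

lemma boundary_2_in:
  assumes "c \<in> functions_on {\<sigma> \<in> K. card \<sigma> = 3}"
  shows "boundary c \<in> functions_on (edges_of K)"
proof -
  have fin: "finite {\<sigma> \<in> K. card \<sigma> = 3}" using finite_K by simp
  have "\<tau> \<in> edges_of K" if "boundary c \<tau> \<noteq> 0" for \<tau>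
  proof -
    have ne: "\<tau> \<noteq> {}" using that by (auto simp: boundary_def)
    note nz = that[unfolded boundary_eq[OF assms fin ne]]
    obtain \<sigma> where "\<sigma> \<in> K" "card \<sigma> = 3" "\<tau> \<subseteq> \<sigma>" "card \<sigma> = Suc (card \<tau>)"
      by (rule sum.not_neutral_contains_not_neutral[OF nz]) (auto split: if_splits)
    then show ?thesis using face ne by (auto simp: edges_of_def)
  qed
  then show ?thesis unfolding functions_on_def by blast
qed

text \<open>Adjointness one degree higher. Closure under faces ensures that all three sides of a
  triangle occur among the edges.\<close>

lemma dot_boundary_2:
  assumes "c \<in> functions_on {\<sigma> \<in> K. card \<sigma> = 3}"
  shows "dot (edges_of K) (boundary c) f =
    (\<Sum>\<tau> | \<tau> \<in> K \<and> card \<tau> = 3. c \<tau> * (\<Sum>\<sigma> | \<sigma> \<subseteq> \<tau> \<and> card \<sigma> = 2. f \<sigma>))"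
proof -
  let ?T = "{\<tau> \<in> K. card \<tau> = 3}"
  have fin: "finite ?T" using finite_K by simp
  have "dot (edges_of K) (boundary c) f =
      (\<Sum>\<sigma>\<in>edges_of K. \<Sum>\<tau>\<in>?T. if \<sigma> \<subseteq> \<tau> then c \<tau> * f \<sigma> else 0)"
    unfolding dot_def
  proof (rule sum.cong[OF refl])
    fix \<sigma> assume \<sigma>: "\<sigma> \<in> edges_of K"
    then have "boundary c \<sigma> = (\<Sum>\<tau>\<in>?T. if \<sigma> \<subseteq> \<tau> then c \<tau> else 0)"
      by (subst boundary_eq[OF assms fin]) (auto simp: edges_of_def intro!: sum.cong)
    then show "boundary c \<sigma> * f \<sigma> = (\<Sum>\<tau>\<in>?T. if \<sigma> \<subseteq> \<tau> then c \<tau> * f \<sigma> else 0)"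
      by (auto simp: sum_distrib_right intro!: sum.cong)
  qed
  also have "\<dots> = (\<Sum>\<tau>\<in>?T. \<Sum>\<sigma>\<in>edges_of K. if \<sigma> \<subseteq> \<tau> then c \<tau> * f \<sigma> else 0)"
    by (rule sum.swap)
  also have "\<dots> = (\<Sum>\<tau>\<in>?T. c \<tau> * (\<Sum>\<sigma> | \<sigma> \<subseteq> \<tau> \<and> card \<sigma> = 2. f \<sigma>))"
  proof (rule sum.cong[OF refl])
    fix \<tau> assume "\<tau> \<in> ?T"
    then have "{\<sigma> \<in> edges_of K. \<sigma> \<subseteq> \<tau>} = {\<sigma>. \<sigma> \<subseteq> \<tau> \<and> card \<sigma> = 2}"
      using face by (auto simp: edges_of_def) (metis card.empty zero_neq_numeral)
    then show "(\<Sum>\<sigma>\<in>edges_of K. if \<sigma> \<subseteq> \<tau> then c \<tau> * f \<sigma> else 0) =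
        c \<tau> * (\<Sum>\<sigma> | \<sigma> \<subseteq> \<tau> \<and> card \<sigma> = 2. f \<sigma>)"
      using finite_edges by (simp add: sum.inter_filter [symmetric] sum_distrib_left)
  qed
  finally show ?thesis .
qed

lemma perp_boundaries: "perp (edges_of K) (boundaries K 1) = cocycles K"
proof -
  let ?T = "{\<tau> \<in> K. card \<tau> = 3}"
  have fin: "finite ?T" using finite_K by simp
  have "(\<forall>c\<in>functions_on ?T. dot (edges_of K) (boundary c) f = 0) \<longleftrightarrow>
      (\<forall>\<tau>\<in>K. card \<tau> = 3 \<longrightarrow> (\<Sum>\<sigma> | \<sigma> \<subseteq> \<tau> \<and> card \<sigma> = 2. f \<sigma>) = 0)" for f
  proof
    assume *: "\<forall>c\<in>functions_on ?T. dot (edges_of K) (boundary c) f = 0"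
    show "\<forall>\<tau>\<in>K. card \<tau> = 3 \<longrightarrow> (\<Sum>\<sigma> | \<sigma> \<subseteq> \<tau> \<and> card \<sigma> = 2. f \<sigma>) = 0"
    proof (intro ballI impI)
      fix \<tau> assume \<tau>: "\<tau> \<in> K" "card \<tau> = 3"
      let ?c = "\<lambda>\<sigma>. if \<sigma> = \<tau> then 1 else (0::bit)"
      have c: "?c \<in> functions_on ?T" using \<tau> by (simp add: functions_on_def)
      then have "(\<Sum>\<rho>\<in>?T. ?c \<rho> * (\<Sum>\<sigma> | \<sigma> \<subseteq> \<rho> \<and> card \<sigma> = 2. f \<sigma>)) = 0"
        using * dot_boundary_2[OF c, of f] by metis
      moreover have "(\<Sum>\<rho>\<in>?T. ?c \<rho> * (\<Sum>\<sigma> | \<sigma> \<subseteq> \<rho> \<and> card \<sigma> = 2. f \<sigma>)) =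
          (\<Sum>\<rho>\<in>?T. if \<rho> = \<tau> then (\<Sum>\<sigma> | \<sigma> \<subseteq> \<rho> \<and> card \<sigma> = 2. f \<sigma>) else 0)"
        by (rule sum.cong) auto
      ultimately show "(\<Sum>\<sigma> | \<sigma> \<subseteq> \<tau> \<and> card \<sigma> = 2. f \<sigma>) = 0"
        using \<tau> fin by simp
    qed
  next
    assume "\<forall>\<tau>\<in>K. card \<tau> = 3 \<longrightarrow> (\<Sum>\<sigma> | \<sigma> \<subseteq> \<tau> \<and> card \<sigma> = 2. f \<sigma>) = 0"
    then show "\<forall>c\<in>functions_on ?T. dot (edges_of K) (boundary c) f = 0"
      by (simp add: dot_boundary_2)
  qed
  then show ?thesis
    unfolding cocycles_def perp_def boundaries_def carrier_chain_2 by auto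
qed

lemma subspace_coboundaries: "f2_subspace (edges_of K) (coboundary K ` functions_on V)"
proof -
  have "coboundary K (\<lambda>_. 0) = (\<lambda>_. 0)"
    by (auto simp: coboundary_def)
  moreover have "coboundary K (\<lambda>v. g v + h v) = (\<lambda>\<sigma>. coboundary K g \<sigma> + coboundary K h \<sigma>)" for g h
    by (auto simp: coboundary_def sum.distrib)
  ultimately have "(\<lambda>\<sigma>. coboundary K g \<sigma> + coboundary K h \<sigma>) \<in> coboundary K ` functions_on V"
    if "g \<in> functions_on V" "h \<in> functions_on V" for g h
    using f2_subspace_functions_on[of V] that unfolding f2_subspace_def by (metis imageI)
  moreover have "coboundary K g \<in> functions_on (edges_of K)" for g
    by (auto simp: functions_on_def coboundary_def split: if_splits)
  moreover have "(\<lambda>_. 0) \<in> coboundary K ` functions_on V"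
    by (rule image_eqI[where x = "\<lambda>_. 0"]) (auto simp: functions_on_def coboundary_def)
  ultimately show ?thesis unfolding f2_subspace_def by blast
qed

lemma boundary_add:
  assumes "c \<in> functions_on S" "d \<in> functions_on S" "finite S"
  shows "boundary (\<lambda>\<sigma>. c \<sigma> + d \<sigma>) = (\<lambda>\<tau>. boundary c \<tau> + boundary d \<tau>)"
proof
  fix \<tau>
  have cd: "(\<lambda>\<sigma>. c \<sigma> + d \<sigma>) \<in> functions_on S"
    using f2_subspace_functions_on[of S] assms by (simp add: f2_subspace_def)
  show "boundary (\<lambda>\<sigma>. c \<sigma> + d \<sigma>) \<tau> = boundary c \<tau> + boundary d \<tau>"
  proof (cases "\<tau> = {}")
    case False
    show ?thesis
      unfolding boundary_eq[OF cd assms(3) False] boundary_eq[OF assms(1,3) False]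
        boundary_eq[OF assms(2,3) False] sum.distrib [symmetric]
      by (rule sum.cong) auto
  qed (simp add: boundary_def)
qed

lemma subspace_boundaries: "f2_subspace (edges_of K) (boundaries K 1)"
  unfolding f2_subspace_def boundaries_def carrier_chain_2
proof (intro conjI ballI)
  let ?T = "{\<tau> \<in> K. card \<tau> = 3}"
  have fin: "finite ?T" using finite_K by simp
  have T: "f2_subspace ?T (functions_on ?T)" by (rule f2_subspace_functions_on)
  show "boundary ` functions_on ?T \<subseteq> functions_on (edges_of K)" using boundary_2_in by auto
  show "(\<lambda>_. 0) \<in> boundary ` functions_on ?T"
  proof
    show "(\<lambda>_. 0) = boundary (\<lambda>_. 0)" by (auto simp: boundary_def)
    show "(\<lambda>_. 0) \<in> functions_on ?T" using T by (simp add: f2_subspace_def)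
  qed
  fix f g assume "f \<in> boundary ` functions_on ?T" "g \<in> boundary ` functions_on ?T"
  then obtain c d where cd: "c \<in> functions_on ?T" "d \<in> functions_on ?T"
    "f = boundary c" "g = boundary d" by auto
  then have "(\<lambda>\<sigma>. c \<sigma> + d \<sigma>) \<in> functions_on ?T" using T by (simp add: f2_subspace_def)
  then show "(\<lambda>x. f x + g x) \<in> boundary ` functions_on ?T"
    unfolding cd(3,4) boundary_add[OF cd(1,2) fin, symmetric] by (rule imageI)
qed

text \<open>Each vertex of a triangle lies on two of its sides, so its value cancels.\<close>

lemma coboundary_in_cocycles: "coboundary K g \<in> cocycles K"
proof -
  have "(\<Sum>\<sigma> | \<sigma> \<subseteq> \<tau> \<and> card \<sigma> = 2. coboundary K g \<sigma>) = 0" if \<tau>: "\<tau> \<in> K" "card \<tau> = 3" for \<tau>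
  proof -
    obtain a b c where abc: "\<tau> = {a, b, c}" "a \<noteq> b" "a \<noteq> c" "b \<noteq> c"
      using \<tau>(2) by (auto simp: card_3_iff)
    have "{a, b} \<in> edges_of K" "{a, c} \<in> edges_of K" "{b, c} \<in> edges_of K"
      using \<tau> face[OF \<tau>(1)] abc by (auto simp: edges_of_def)
    then have "coboundary K g {a, b} = g a + g b" "coboundary K g {a, c} = g a + g c"
      "coboundary K g {b, c} = g b + g c"
      using abc by (simp_all add: coboundary_def)
    then show ?thesis
      unfolding abc(1) sum_two_subsets[OF abc(2-4)] by (simp add: ac_simps)
  qed
  then show ?thesis
    by (auto simp: cocycles_def functions_on_def coboundary_def split: if_splits)
qed

text \<open>That a boundary has no boundary is obtained by duality from the fact that coboundaries
  are cocycles.\<close>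

lemma boundaries_subset_cycles: "boundaries K 1 \<subseteq> cycles K 1"
proof
  fix b assume b: "b \<in> boundaries K 1"
  have "dot (edges_of K) b (coboundary K g) = 0" for g
    using coboundary_in_cocycles[of g] b
    unfolding perp_boundaries [symmetric] by (simp add: perp_def)
  then have "dot (edges_of K) (coboundary K g) b = 0" for g
    by (subst dot_commute)
  moreover have "b \<in> functions_on (edges_of K)"
    using b subspace_boundaries unfolding f2_subspace_def by blast
  ultimately show "b \<in> cycles K 1"
    unfolding cycles_eq_perp perp_def by blast
qed

lemma subspace_perp: "f2_subspace S (perp S W)"
proof -
  have "dot S w (\<lambda>_. 0) = 0" for w by (simp add: dot_def)
  moreover have "dot S w (\<lambda>x. f x + g x) = dot S w f + dot S w g" for w f g
    unfolding dot_commute[of S w] by (rule dot_add)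
  ultimately show ?thesis
    using f2_subspace_functions_on[of S] unfolding f2_subspace_def perp_def by simp
qed

lemma mult_chain_group: "c \<otimes>\<^bsub>chain_group K k\<^esub> d = (\<lambda>\<sigma>. c \<sigma> + d \<sigma>)"
  by (simp add: chain_group_def)

lemma one_chain_group: "\<one>\<^bsub>chain_group K k\<^esub> = (\<lambda>_. 0)"
  by (simp add: chain_group_def)

lemma group_chain_group: "group (chain_group K 1)"
proof (rule groupI, goal_cases)
  case (5 x)
  then have "x \<otimes>\<^bsub>chain_group K 1\<^esub> x = \<one>\<^bsub>chain_group K 1\<^esub>" by (simp add: chain_group_def)
  then show ?case using 5 by blast
qed (use f2_subspace_functions_on[of "edges_of K"] in
    \<open>simp_all add: carrier_chain_1 f2_subspace_def mult_chain_group one_chain_group add.assoc\<close>)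

lemma subgroup_chain_group:
  assumes "f2_subspace (edges_of K) W"
  shows "subgroup W (chain_group K 1)"
proof -
  interpret group "chain_group K 1" by (rule group_chain_group)
  have "inv\<^bsub>chain_group K 1\<^esub> x = x" if "x \<in> carrier (chain_group K 1)" for x
    by (rule inv_equality) (use that in \<open>simp_all add: mult_chain_group one_chain_group\<close>)
  then show ?thesis
    using assms unfolding f2_subspace_def carrier_chain_1 [symmetric]
    by (intro subgroupI) (auto simp: mult_chain_group)
qed

lemma card_homology_boundaries:
  "card (carrier (homology 1 K)) * card (boundaries K 1) = card (cycles K 1)"
proof -
  let ?G = "chain_group K 1" and ?Z = "cycles K 1" and ?B = "boundaries K 1"
  interpret G: group ?G by (rule group_chain_group)
  have Z: "subgroup ?Z ?G"
    unfolding cycles_eq_perp by (rule subgroup_chain_group[OF subspace_perp])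
  have B: "subgroup ?B ?G"
    by (rule subgroup_chain_group[OF subspace_boundaries])
  interpret Z: group "?G\<lparr>carrier := ?Z\<rparr>"
    using Z by (rule G.subgroup_imp_group)
  have "subgroup ?B (?G\<lparr>carrier := ?Z\<rparr>)"
    by (rule G.subgroup_incl[OF B Z boundaries_subset_cycles])
  from Z.lagrange[OF this] show ?thesis
    by (simp add: homology_def FactGroup_def Coset.order_def)
qed

text \<open>Homology and cohomology have the same size: by \<open>card_perp\<close>, the number of
  cycles is \<open>2 ^ card (edges_of K)\<close> divided by the number of coboundaries, and the
  number of boundaries is the same power divided by the number of cocycles. The hypothesis is a
  product so that no division occurs.\<close>

lemma card_homology:
  assumes "card (cocycles K) = card (coboundary K ` functions_on V) * N"
  shows "card (carrier (homology 1 K)) = N"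
proof -
  let ?I = "coboundary K ` functions_on V"
  have "card ?I * card (cycles K 1) = 2 ^ card (edges_of K)"
    unfolding cycles_eq_perp by (rule card_perp[OF subspace_coboundaries finite_edges])
  moreover have *: "card (boundaries K 1) * card (cocycles K) = 2 ^ card (edges_of K)"
    using card_perp[OF subspace_boundaries finite_edges] by (simp add: perp_boundaries)
  ultimately have "card ?I * card (cycles K 1) = card ?I * (card (boundaries K 1) * N)"
    using assms by (simp add: ac_simps)
  moreover have "card ?I > 0"
    using assms * by (intro gr0I) simp
  ultimately have "card (cycles K 1) = card (boundaries K 1) * N"
    by simp
  then have "card (carrier (homology 1 K)) * card (boundaries K 1) = N * card (boundaries K 1)"
    unfolding card_homology_boundaries by (simp only: mult.commute)
  moreover have "card (boundaries K 1) \<noteq> 0"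
    using * by (intro notI) simp
  ultimately show ?thesis by (metis mult_right_cancel)
qed

end

section \<open>Clique complexes of graphs with poles\<close>

definition clique_complex :: "'a set \<Rightarrow> ('a \<Rightarrow> 'a \<Rightarrow> bool) \<Rightarrow> 'a set set" where
  "clique_complex V adj = {\<sigma>. \<sigma> \<subseteq> V \<and> finite \<sigma> \<and> \<sigma> \<noteq> {} \<and> (\<forall>x\<in>\<sigma>. \<forall>y\<in>\<sigma>. x \<noteq> y \<longrightarrow> adj x y)}"

lemma finite_complex_clique_complex:
  "finite V \<Longrightarrow> finite_complex V (clique_complex V adj)"
  by unfold_locales (auto simp: clique_complex_def intro: finite_subset)

lemma pair_in_edges_iff:
  assumes "\<And>x y. adj x y \<longleftrightarrow> adj y x"
  shows "{x, y} \<in> edges_of (clique_complex V adj) \<longleftrightarrow> x \<noteq> y \<and> x \<in> V \<and> y \<in> V \<and> adj x y"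
  using assms by (auto simp: edges_of_def clique_complex_def card_insert_if)

text \<open>Every triangle has one vertex in \<open>P\<close> (a pole), one in \<open>T\<close> and one in neither. Subtracting a coboundary
  makes a cocycle vanish on the edges \<open>{b0, l}\<close> and \<open>{y, p0 y}\<close>; what remains is determined by its values on
  the edges to the poles, that is, by an element of \<open>Lam\<close>.\<close>

locale pole_graph =
  fixes V P T :: "'a set" and PE NE :: "('a \<times> 'a) set" and b0 :: 'a and p0 :: "'a \<Rightarrow> 'a"
  assumes finite_V: "finite V" and P_V: "P \<subseteq> V" and T_V: "T \<subseteq> V - P" and b0: "b0 \<in> V - P"
    and PE: "PE \<subseteq> (V - P) \<times> P" and NE: "NE \<subseteq> T \<times> (V - P - T)"
    and p0: "y \<in> V - P \<Longrightarrow> (y, p0 y) \<in> PE"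
    and base: "l \<in> P \<Longrightarrow> (b0, l) \<in> PE"
    and common: "(t, d) \<in> NE \<Longrightarrow> \<exists>l. (t, l) \<in> PE \<and> (d, l) \<in> PE"
begin

definition adj :: "'a \<Rightarrow> 'a \<Rightarrow> bool" where
  "adj x y \<longleftrightarrow> (x, y) \<in> PE \<union> NE \<or> (y, x) \<in> PE \<union> NE"

abbreviation K :: "'a set set" where "K \<equiv> clique_complex V adj"

text \<open>A triangle \<open>{t, d, l}\<close> forces the label \<open>f (t, l) + f (d, l)\<close>
  on its side \<open>{t, d}\<close>; the last condition says that all common poles force the same
  label. The conditions at \<open>b0\<close> and \<open>p0 y\<close> are the normalization.\<close>

definition Lam :: "('a \<times> 'a \<Rightarrow> bit) set" where
  "Lam = {f \<in> functions_on PE. (\<forall>l. f (b0, l) = 0) \<and> (\<forall>y\<in>V - P. f (y, p0 y) = 0) \<and>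
     (\<forall>t d l l'. (t, d) \<in> NE \<and> (t, l) \<in> PE \<and> (d, l) \<in> PE \<and> (t, l') \<in> PE \<and> (d, l') \<in> PE \<longrightarrow>
        f (t, l) + f (d, l) = f (t, l') + f (d, l'))}"

text \<open>Potentials up to an additive constant: the graph is connected, so fixing the value at
  \<open>b0\<close> makes the coboundary map injective.\<close>

definition gauges :: "('a \<Rightarrow> bit) set" where
  "gauges = {g \<in> functions_on V. g b0 = 0}"

text \<open>On an edge without a pole, \<open>SOME\<close> picks a common pole; for elements of
  \<open>Lam\<close> the choice does not affect the value.\<close>

definition of_Lam :: "('a \<times> 'a \<Rightarrow> bit) \<Rightarrow> 'a set \<Rightarrow> bit" where
  "of_Lam f \<sigma> =
    (if \<sigma> \<inter> P \<noteq> {} then f (the_elem (\<sigma> - P), the_elem (\<sigma> \<inter> P))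
     else \<Sum>y\<in>\<sigma>. f (y, SOME l. \<forall>z\<in>\<sigma>. (z, l) \<in> PE))"

definition to_cocycle :: "('a \<Rightarrow> bit) \<times> ('a \<times> 'a \<Rightarrow> bit) \<Rightarrow> 'a set \<Rightarrow> bit" where
  "to_cocycle = (\<lambda>(g, f) \<sigma>. if \<sigma> \<in> edges_of K then (\<Sum>v\<in>\<sigma>. g v) + of_Lam f \<sigma> else 0)"

text \<open>Integrates a cochain along the spanning tree in which each pole hangs from
  \<open>b0\<close> and each further vertex \<open>v\<close> from the pole \<open>p0 v\<close>. At
  \<open>b0\<close> itself the two terms cancel.\<close>

definition gauge_of :: "('a set \<Rightarrow> bit) \<Rightarrow> 'a \<Rightarrow> bit" where
  "gauge_of c v = (if v \<in> P then c {b0, v} else if v \<in> V then c {v, p0 v} + c {b0, p0 v} else 0)"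

definition of_cocycle :: "('a set \<Rightarrow> bit) \<Rightarrow> ('a \<Rightarrow> bit) \<times> ('a \<times> 'a \<Rightarrow> bit)" where
  "of_cocycle c = (gauge_of c,
     \<lambda>(y, l). if (y, l) \<in> PE then c {y, l} + gauge_of c y + gauge_of c l else 0)"

lemma adj_sym: "adj x y \<longleftrightarrow> adj y x"
  by (auto simp: adj_def)

lemma PE_D: "(y, l) \<in> PE \<Longrightarrow> y \<in> V \<and> y \<notin> P \<and> l \<in> P \<and> l \<in> V \<and> y \<noteq> l"
  using PE P_V by auto

lemma NE_D: "(t, d) \<in> NE \<Longrightarrow> t \<in> T \<and> d \<notin> T \<and> t \<in> V \<and> d \<in> V \<and> t \<notin> P \<and> d \<notin> P \<and> t \<noteq> d"
  using NE T_V by auto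

lemma PE_edge: "(y, l) \<in> PE \<Longrightarrow> {y, l} \<in> edges_of K"
  using PE_D by (auto simp: pair_in_edges_iff[OF adj_sym] adj_def)

lemma NE_edge: "(t, d) \<in> NE \<Longrightarrow> {t, d} \<in> edges_of K"
  using NE_D by (auto simp: pair_in_edges_iff[OF adj_sym] adj_def)

lemma edge_cases:
  assumes "\<sigma> \<in> edges_of K"
  obtains (pole) y l where "(y, l) \<in> PE" "\<sigma> = {y, l}" | (nonpole) t d where "(t, d) \<in> NE" "\<sigma> = {t, d}"
proof -
  obtain x y where xy: "\<sigma> = {x, y}" using assms by (auto simp: edges_of_def card_2_iff)
  then have "adj x y" using assms by (simp add: pair_in_edges_iff[OF adj_sym])
  then show ?thesis
    using xy that unfolding adj_def by (metis Un_iff insert_commute)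
qed

text \<open>Poles, members of \<open>T\<close> and the remaining vertices form three classes without
  inner edges, so a triangle has one vertex in each.\<close>

lemma triangle:
  assumes "\<tau> \<in> K" "card \<tau> = 3"
  obtains t d l where "\<tau> = {t, d, l}" "(t, d) \<in> NE" "(t, l) \<in> PE" "(d, l) \<in> PE"
    "t \<noteq> d" "t \<noteq> l" "d \<noteq> l"
proof -
  have adj: "adj x y" if "x \<in> \<tau>" "y \<in> \<tau>" "x \<noteq> y" for x y
    using that assms by (auto simp: clique_complex_def)
  obtain a b c where abc: "\<tau> = {a, b, c}" "a \<noteq> b" "a \<noteq> c" "b \<noteq> c"
    using assms by (auto simp: card_3_iff)
  have cl: "(x \<in> P \<longrightarrow> y \<notin> P) \<and> (x \<in> T \<longrightarrow> y \<notin> T) \<and> (x \<in> P \<or> y \<in> P \<or> x \<in> T \<or> y \<in> T)" if "adj x y" for x y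
    using that PE_D NE_D T_V unfolding adj_def by blast
  have "adj a b" "adj a c" "adj b c" using adj abc by auto
  then have "\<exists>t\<in>\<tau>. \<exists>d\<in>\<tau>. \<exists>l\<in>\<tau>. t \<in> T \<and> d \<notin> T \<and> d \<notin> P \<and> l \<in> P"
    using cl[of a b] cl[of a c] cl[of b c] T_V unfolding abc(1) by blast
  then obtain t d l where tdl: "t \<in> \<tau>" "d \<in> \<tau>" "l \<in> \<tau>" "t \<in> T" "d \<notin> T" "d \<notin> P" "l \<in> P"
    by blast
  then have ne: "t \<noteq> d" "t \<noteq> l" "d \<noteq> l" using T_V by auto
  then have "\<tau> = {t, d, l}" using tdl abc by auto
  moreover have "(t, d) \<in> NE"
    using adj[OF tdl(1,2) ne(1)] tdl T_V PE_D[of t d] PE_D[of d t] NE_D[of t d] NE_D[of d t] unfolding adj_def by blast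
  moreover have "(t, l) \<in> PE"
    using adj[OF tdl(1,3) ne(2)] tdl T_V PE_D[of t l] PE_D[of l t] NE_D[of t l] NE_D[of l t] unfolding adj_def by blast
  moreover have "(d, l) \<in> PE"
    using adj[OF tdl(2,3) ne(3)] tdl T_V PE_D[of d l] PE_D[of l d] NE_D[of d l] NE_D[of l d] unfolding adj_def by blast
  ultimately show ?thesis using that ne by blast
qed

lemma of_Lam_PE: assumes "(y, l) \<in> PE" shows "of_Lam f {y, l} = f (y, l)"
proof -
  have "{y, l} \<inter> P = {l}" "{y, l} - P = {y}" using PE_D[OF assms] by auto
  then show ?thesis by (simp add: of_Lam_def)
qed

lemma of_Lam_NE:
  assumes "f \<in> Lam" "(t, d) \<in> NE" "(t, l) \<in> PE" "(d, l) \<in> PE"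
  shows "of_Lam f {t, d} = f (t, l) + f (d, l)"
proof -
  let ?l = "SOME l. \<forall>z\<in>{t, d}. (z, l) \<in> PE"
  have "\<forall>z\<in>{t, d}. (z, ?l) \<in> PE"
    by (rule someI[where x = l]) (use assms in auto)
  then have "(t, ?l) \<in> PE" "(d, ?l) \<in> PE" by auto
  then have "f (t, ?l) + f (d, ?l) = f (t, l) + f (d, l)"
    using assms unfolding Lam_def by blast
  moreover have "{t, d} \<inter> P = {}" "t \<noteq> d" using NE_D[OF assms(2)] by auto
  ultimately show ?thesis unfolding of_Lam_def by simp
qed

lemma to_cocycle_PE:
  assumes "(y, l) \<in> PE"
  shows "to_cocycle (g, f) {y, l} = g y + g l + f (y, l)"
  using PE_edge[OF assms] PE_D[OF assms] by (simp add: to_cocycle_def of_Lam_PE[OF assms])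

lemma to_cocycle_NE:
  assumes "f \<in> Lam" "(t, d) \<in> NE" "(t, l) \<in> PE" "(d, l) \<in> PE"
  shows "to_cocycle (g, f) {t, d} = g t + g d + (f (t, l) + f (d, l))"
  using NE_edge[OF assms(2)] NE_D[OF assms(2)] by (simp add: to_cocycle_def of_Lam_NE[OF assms])

lemma to_cocycle_in:
  assumes "f \<in> Lam" shows "to_cocycle (g, f) \<in> cocycles K"
proof -
  have "(\<Sum>\<sigma> | \<sigma> \<subseteq> \<tau> \<and> card \<sigma> = 2. to_cocycle (g, f) \<sigma>) = 0" if "\<tau> \<in> K" "card \<tau> = 3" for \<tau>
    using that
  proof (rule triangle)
    fix t d l assume tdl: "\<tau> = {t, d, l}" "(t, d) \<in> NE" "(t, l) \<in> PE" "(d, l) \<in> PE"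
      "t \<noteq> d" "t \<noteq> l" "d \<noteq> l"
    show ?thesis
      unfolding tdl(1) sum_two_subsets[OF tdl(5-7)] to_cocycle_NE[OF assms tdl(2-4)]
        to_cocycle_PE[OF tdl(3)] to_cocycle_PE[OF tdl(4)]
      by (simp add: ac_simps)
  qed
  then show ?thesis
    by (auto simp: cocycles_def functions_on_def to_cocycle_def split: if_splits)
qed

lemma cocycle_triangle:
  assumes "c \<in> cocycles K" "(t, d) \<in> NE" "(t, l) \<in> PE" "(d, l) \<in> PE"
  shows "c {t, d} = c {t, l} + c {d, l}"
proof -
  have ne: "t \<noteq> d" "t \<noteq> l" "d \<noteq> l" using NE_D[OF assms(2)] PE_D[OF assms(3)] PE_D[OF assms(4)] by auto
  have "{t, d, l} \<in> K" "card {t, d, l} = 3"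
    using ne NE_D[OF assms(2)] PE_D[OF assms(3)] assms by (auto simp: clique_complex_def adj_def)
  then have "(\<Sum>\<sigma> | \<sigma> \<subseteq> {t, d, l} \<and> card \<sigma> = 2. c \<sigma>) = 0"
    using assms(1) unfolding cocycles_def by blast
  then show ?thesis
    unfolding sum_two_subsets[OF ne] by (simp add: add.assoc bit_add_eq_0_iff)
qed

lemma gauge_of_b0: "gauge_of c b0 = 0"
  using b0 by (simp add: gauge_of_def)

lemma of_cocycle_in:
  assumes "c \<in> cocycles K" shows "of_cocycle c \<in> gauges \<times> Lam"
proof -
  have "gauge_of c \<in> gauges"
    using P_V gauge_of_b0[of c]
    by (auto simp: gauges_def functions_on_def) (auto simp: gauge_of_def split: if_splits)
  moreover have "(\<lambda>(y, l). if (y, l) \<in> PE then c {y, l} + gauge_of c y + gauge_of c l else 0) \<in> Lam"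
    (is "?f \<in> Lam")
    unfolding Lam_def mem_Collect_eq
  proof (intro conjI ballI allI impI)
    show "?f \<in> functions_on PE" by (auto simp: functions_on_def)
    show "?f (b0, l) = 0" for l
      using PE_D[of b0 l] by (auto simp: gauge_of_b0) (auto simp: gauge_of_def)
    show "?f (y, p0 y) = 0" if "y \<in> V - P" for y
      using that PE_D[OF p0[OF that]] by (auto simp: gauge_of_def ac_simps)
    fix t d l l'
    assume *: "(t, d) \<in> NE \<and> (t, l) \<in> PE \<and> (d, l) \<in> PE \<and> (t, l') \<in> PE \<and> (d, l') \<in> PE"
    then have "c {t, l} + c {d, l} = c {t, l'} + c {d, l'}"
      using cocycle_triangle[OF assms] by metis
    then have "gauge_of c t + gauge_of c d + (c {t, l} + c {d, l}) =
        gauge_of c t + gauge_of c d + (c {t, l'} + c {d, l'})" by simp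
    then show "?f (t, l) + ?f (d, l) = ?f (t, l') + ?f (d, l')"
      using * by (simp add: ac_simps)
  qed
  ultimately show ?thesis by (simp add: of_cocycle_def)
qed

lemma of_to_cocycle:
  assumes "g \<in> gauges" "f \<in> Lam"
  shows "of_cocycle (to_cocycle (g, f)) = (g, f)"
proof -
  have b: "to_cocycle (g, f) {b0, l} = g l" if "l \<in> P" for l
    using that assms base[OF that] by (simp add: to_cocycle_PE gauges_def Lam_def)
  have y: "to_cocycle (g, f) {y, p0 y} = g y + g (p0 y)" if "y \<in> V - P" for y
    unfolding to_cocycle_PE[OF p0[OF that]] using assms that by (simp add: Lam_def)
  have g: "gauge_of (to_cocycle (g, f)) = g"
  proof
    fix v
    show "gauge_of (to_cocycle (g, f)) v = g v"
    proof (cases "v \<in> V - P")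
      case True
      then have "p0 v \<in> P" using p0 PE_D by blast
      then show ?thesis using True y[OF True] b by (simp add: gauge_of_def ac_simps)
    next
      case False
      then show ?thesis using b P_V assms(1) by (auto simp: gauge_of_def gauges_def functions_onD)
    qed
  qed
  have "(\<lambda>(y, l). if (y, l) \<in> PE then to_cocycle (g, f) {y, l} + g y + g l else 0) = f"
  proof
    fix p :: "'a \<times> 'a"
    obtain y l where p: "p = (y, l)" by force
    show "(\<lambda>(y, l). if (y, l) \<in> PE then to_cocycle (g, f) {y, l} + g y + g l else 0) p = f p"
      using assms(2) unfolding p
      by (auto simp: to_cocycle_PE Lam_def functions_onD ac_simps)
  qed
  then show ?thesis unfolding of_cocycle_def g by simp
qed

lemma to_of_cocycle:
  assumes "c \<in> cocycles K"
  shows "to_cocycle (of_cocycle c) = c"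
proof
  fix \<sigma>
  let ?g = "gauge_of c"
  define f where "f = snd (of_cocycle c)"
  have oc: "of_cocycle c = (?g, f)" by (simp add: of_cocycle_def f_def)
  have f: "f \<in> Lam" using of_cocycle_in[OF assms] by (auto simp: oc)
  have f_eq: "f (y, l) = c {y, l} + ?g y + ?g l" if "(y, l) \<in> PE" for y l
    using that by (simp add: of_cocycle_def f_def)
  show "to_cocycle (of_cocycle c) \<sigma> = c \<sigma>"
  proof (cases "\<sigma> \<in> edges_of K")
    case True
    then show ?thesis
    proof (cases rule: edge_cases)
      case (pole y l)
      then show ?thesis unfolding oc pole(2) to_cocycle_PE[OF pole(1)] f_eq[OF pole(1)]
        by (simp add: ac_simps)
    next
      case (nonpole t d)
      obtain l where l: "(t, l) \<in> PE" "(d, l) \<in> PE" using common nonpole(1) by blast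
      show ?thesis
        unfolding oc nonpole(2) to_cocycle_NE[OF f nonpole(1) l] f_eq[OF l(1)] f_eq[OF l(2)]
          cocycle_triangle[OF assms nonpole(1) l]
        by (simp add: ac_simps)
    qed
  next
    case False
    then show ?thesis unfolding oc using assms
      functions_onD[OF _ False, of c] by (simp add: to_cocycle_def cocycles_def)
  qed
qed

lemma card_cocycles: "card (cocycles K) = card gauges * card Lam"
proof -
  have "bij_betw to_cocycle (gauges \<times> Lam) (cocycles K)"
    by (rule bij_betw_byWitness[where f' = of_cocycle])
      (use of_to_cocycle to_of_cocycle to_cocycle_in of_cocycle_in in blast)+
  then show ?thesis using bij_betw_same_card by (metis card_cartesian_product)
qed

text \<open>Injectivity on gauges follows along the spanning tree from \<open>b0\<close>; every
  potential becomes a gauge after adding the constant \<open>g b0\<close>, which cancels on each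
  edge.\<close>

lemma card_coboundaries: "card (coboundary K ` functions_on V) = card gauges"
proof -
  have edge: "coboundary K g {y, l} = g y + g l" if "(y, l) \<in> PE" for g y l
    using PE_edge[OF that] PE_D[OF that] by (simp add: coboundary_def)
  have "inj_on (coboundary K) gauges"
  proof (rule inj_onI)
    fix g h assume gh: "g \<in> gauges" "h \<in> gauges" "coboundary K g = coboundary K h"
    then have eq: "g y + g l = h y + h l" if "(y, l) \<in> PE" for y l
      using edge[OF that] by metis
    have l: "g l = h l" if "l \<in> P" for l
      using eq[OF base[OF that]] gh by (simp add: gauges_def)
    show "g = h"
    proof
      fix v
      show "g v = h v"
      proof (cases "v \<in> V - P")
        case True
        then have "p0 v \<in> P" using p0 PE_D by blast
        then show ?thesis using eq[OF p0[OF True]] l by simp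
      next
        case False
        then show ?thesis using l P_V gh(1,2) by (auto simp: gauges_def functions_onD)
      qed
    qed
  qed
  moreover have "coboundary K ` functions_on V = coboundary K ` gauges"
  proof
    show "coboundary K ` functions_on V \<subseteq> coboundary K ` gauges"
    proof
      fix c assume "c \<in> coboundary K ` functions_on V"
      then obtain g where g: "g \<in> functions_on V" "c = coboundary K g" by auto
      let ?h = "\<lambda>v. if v \<in> V then g v + g b0 else 0"
      have "coboundary K ?h = coboundary K g"
      proof
        fix \<sigma>
        show "coboundary K ?h \<sigma> = coboundary K g \<sigma>"
        proof (cases "\<sigma> \<in> edges_of K")
          case True
          then obtain a b where ab: "\<sigma> = {a, b}" "a \<noteq> b" "a \<in> V" "b \<in> V"
            by (auto simp: edges_of_def card_2_iff clique_complex_def)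
          then show ?thesis using True by (simp add: coboundary_def ac_simps)
        qed (simp add: coboundary_def)
      qed
      then have "c = coboundary K ?h" using g(2) by simp
      moreover have "?h \<in> gauges" using b0 by (auto simp: gauges_def functions_on_def)
      ultimately show "c \<in> coboundary K ` gauges" by (rule image_eqI)
    qed
  qed (auto simp: gauges_def)
  ultimately show ?thesis by (simp add: card_image)
qed

theorem card_homology_clique_complex: "card (carrier (homology 1 K)) = card Lam"
  by (rule finite_complex.card_homology[OF finite_complex_clique_complex[OF finite_V]])
    (simp add: card_cocycles card_coboundaries)

end

text \<open>The complex is a cone: the triangles with apex \<open>v0\<close> show that a cocycle
  \<open>f\<close> is the coboundary of \<open>v \<mapsto> f {v0, v}\<close>.\<close>

lemma card_homology_complete:
  assumes "finite V" "v0 \<in> V" "\<And>x y. x \<in> V \<Longrightarrow> y \<in> V \<Longrightarrow> adj x y"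
  shows "card (carrier (homology 1 (clique_complex V adj))) = 1"
proof -
  let ?K = "clique_complex V adj"
  interpret finite_complex V ?K by (rule finite_complex_clique_complex[OF assms(1)])
  have simp: "\<sigma> \<in> ?K \<longleftrightarrow> \<sigma> \<subseteq> V \<and> \<sigma> \<noteq> {}" for \<sigma>
    using assms by (auto simp: clique_complex_def intro: finite_subset)
  have "cocycles ?K \<subseteq> coboundary ?K ` functions_on V"
  proof
    fix f assume f: "f \<in> cocycles ?K"
    let ?g = "\<lambda>v. if v \<in> V \<and> v \<noteq> v0 then f {v0, v} else 0"
    have "f \<sigma> = coboundary ?K ?g \<sigma>" for \<sigma>
    proof (cases "\<sigma> \<in> edges_of ?K")
      case True
      then obtain a b where ab: "\<sigma> = {a, b}" "a \<noteq> b" "a \<in> V" "b \<in> V"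
        by (auto simp: edges_of_def card_2_iff clique_complex_def)
      have "f {a, b} = f {v0, a} + f {v0, b}" if "a \<noteq> v0" "b \<noteq> v0"
      proof -
        have "{v0, a, b} \<in> ?K" "card {v0, a, b} = 3" using that ab assms by (auto simp: simp)
        then have "(\<Sum>\<sigma> | \<sigma> \<subseteq> {v0, a, b} \<and> card \<sigma> = 2. f \<sigma>) = 0"
          using f unfolding cocycles_def by blast
        then show ?thesis
          using that ab(2) sum_two_subsets[of v0 a b f] by (simp add: bit_add_eq_0_iff)
      qed
      then show ?thesis using True ab by (auto simp: coboundary_def insert_commute)
    next
      case False
      then show ?thesis using f functions_onD[OF _ False, of f] by (simp add: coboundary_def cocycles_def)
    qed
    then have "f = coboundary ?K ?g" by blast
    moreover have "?g \<in> functions_on V" by (auto simp: functions_on_def)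
    ultimately show "f \<in> coboundary ?K ` functions_on V" by blast
  qed
  then have "cocycles ?K = coboundary ?K ` functions_on V"
    using coboundary_in_cocycles by blast
  then show ?thesis by (intro card_homology) simp
qed

lemma card_homology_discrete:
  assumes "finite V" "\<And>x y. x \<in> V \<Longrightarrow> y \<in> V \<Longrightarrow> x \<noteq> y \<Longrightarrow> \<not> adj x y"
  shows "card (carrier (homology 1 (clique_complex V adj))) = 1"
proof -
  let ?K = "clique_complex V adj"
  interpret finite_complex V ?K by (rule finite_complex_clique_complex[OF assms(1)])
  have "edges_of ?K = {}"
    using assms by (auto simp: edges_of_def clique_complex_def card_2_iff)
  then have "coboundary ?K g = f" if "f \<in> cocycles ?K" for f g
    using that by (auto simp: cocycles_def functions_on_def coboundary_def)
  moreover have "(\<lambda>_. 0) \<in> functions_on V" by (simp add: functions_on_def)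
  ultimately have "cocycles ?K \<subseteq> coboundary ?K ` functions_on V" by (metis image_eqI subsetI)
  then have "cocycles ?K = coboundary ?K ` functions_on V" using coboundary_in_cocycles by auto
  then show ?thesis by (intro card_homology) simp
qed

section \<open>Barcodes of graph metrics\<close>

lemma card_interval_sum:
  "card (carrier (interval_sum bs t)) = 2 ^ card {i. i < length bs \<and> t \<in> interval (bs ! i)}"
proof -
  have "carrier (interval_sum bs t) = functions_on {i. i < length bs \<and> t \<in> interval (bs ! i)}"
    by (auto simp: interval_sum_def functions_on_def)
  then show ?thesis by (simp add: card_functions_on)
qed

text \<open>The size of \<open>V t\<close> determines how many bars are alive at \<open>t\<close>,
  and naturality with identity maps keeps the set of their indices constant on
  \<open>[a, b)\<close>. As no bar lives elsewhere, every bar fills this interval exactly.\<close>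

lemma barcode_of_constant:
  assumes B: "barcode_of V f B" and ab: "0 \<le> a" "a < b"
    and trivial: "\<And>t. 0 \<le> t \<Longrightarrow> t < a \<or> b \<le> t \<Longrightarrow> card (carrier (V t)) = 1"
    and const: "\<And>t. a \<le> t \<Longrightarrow> t < b \<Longrightarrow> V t = W"
    and id: "\<And>s t x. a \<le> s \<Longrightarrow> s \<le> t \<Longrightarrow> t < b \<Longrightarrow> x \<in> carrier W \<Longrightarrow> f s t x = x"
    and card: "card (carrier W) = 2 ^ k"
  shows "B = replicate_mset k (a, ereal b)"
proof -
  obtain bs \<phi> where bs: "mset bs = B"
    and iso: "\<And>t. 0 \<le> t \<Longrightarrow> \<phi> t \<in> iso (V t) (interval_sum bs t)"
    and nat: "\<And>s t x. 0 \<le> s \<Longrightarrow> s \<le> t \<Longrightarrow> x \<in> carrier (V s) \<Longrightarrow>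
      \<phi> t (f s t x) = interval_sum_map bs t (\<phi> s x)"
    using B unfolding barcode_of_def by blast
  have proper: "0 \<le> fst p \<and> ereal (fst p) < snd p" if "p \<in># B" for p
    using B that unfolding barcode_of_def is_barcode_def by (cases p) auto
  define I where "I = (\<lambda>t. {i. i < length bs \<and> t \<in> interval (bs ! i)})"
  have cardI: "card (carrier (V t)) = 2 ^ card (I t)" if "0 \<le> t" for t
    using iso[OF that] card_interval_sum[of bs t]
    unfolding iso_def I_def by (auto dest: bij_betw_same_card)
  have finI: "finite (I t)" for t by (simp add: I_def)
  have empty: "I t = {}" if "0 \<le> t" "t < a \<or> b \<le> t" for t
  proof -
    have "(2::nat) ^ card (I t) = 1"
      using cardI[OF that(1)] trivial[OF that] by simp
    then have "card (I t) = 0" by simp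
    then show ?thesis using finI[of t] by simp
  qed
  have same: "I s = I t" if st: "a \<le> s" "s \<le> t" "t < b" for s t
  proof -
    have s0: "0 \<le> s" "0 \<le> t" "s < b" "a \<le> t" using st ab by auto
    \<comment> \<open>The unit vector of a bar \<open>i\<close> alive at \<open>t\<close> comes from
      an element that is already present at \<open>s\<close>, because the structure map is the
      identity; if its coordinate \<open>i\<close> were zero at \<open>s\<close>, it would be zero
      at \<open>t\<close>. Equal cardinalities then give equality.\<close>
    have "I t \<subseteq> I s"
    proof
      fix i assume i: "i \<in> I t"
      let ?e = "\<lambda>j. if j = i then 1 else (0::bit)"
      have "?e \<in> carrier (interval_sum bs t)" using i by (auto simp: interval_sum_def I_def)
      then have "?e \<in> \<phi> t ` carrier (V t)"
        using iso[OF s0(2)] by (simp add: iso_def bij_betw_def)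
      then obtain y where y: "?e = \<phi> t y" "y \<in> carrier (V t)" by (rule imageE)
      then have yW: "y \<in> carrier W" "y \<in> carrier (V s)" using const st s0 by auto
      have "interval_sum_map bs t (\<phi> s y) = ?e"
        using nat[OF s0(1) st(2) yW(2)] id[OF st yW(1)] y(1) by simp
      then have "interval_sum_map bs t (\<phi> s y) i = 1" by simp
      then have "\<phi> s y i \<noteq> 0" by (auto simp: interval_sum_map_def split: if_splits)
      moreover have "\<phi> s y \<in> carrier (interval_sum bs s)"
        using iso[OF s0(1)] yW(2) unfolding iso_def bij_betw_def by blast
      ultimately show "i \<in> I s" by (auto simp: interval_sum_def I_def)
    qed
    moreover have "card (I t) = card (I s)"
      using cardI[OF s0(1)] cardI[OF s0(2)] const[OF st(1) s0(3)] const[OF s0(4) st(3)] by simp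
    ultimately show ?thesis using card_subset_eq[OF finI[of s]] by metis
  qed
  have bar: "bs ! i = (a, ereal b) \<and> i \<in> I a" if i: "i < length bs" for i
  proof -
    obtain x d where xd: "bs ! i = (x, d)" by force
    then have "(x, d) \<in># B" using nth_mem[OF i] bs by auto
    then have p: "0 \<le> x" "ereal x < d" using proper[of "(x, d)"] by auto
    \<comment> \<open>A bar is alive at its own birth, so the birth lies in \<open>[a, b)\<close>;
      by constancy it is also alive at \<open>a\<close>, so it is born there.\<close>
    then have ix: "i \<in> I x" using i xd by (simp add: I_def interval_def)
    then have x: "a \<le> x" "x < b" using empty[OF p(1)] by (auto simp: not_less [symmetric])
    then have ia: "i \<in> I a" using same[of a x] ix by simp
    then have "x = a" using x xd by (simp add: I_def interval_def)
    moreover have "d \<le> ereal b"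
    proof (rule ccontr)
      assume "\<not> d \<le> ereal b"
      then have "i \<in> I b" using i xd x by (simp add: I_def interval_def)
      then show False using empty[of b] ab by simp
    qed
    moreover have "ereal b \<le> d"
    proof (rule ccontr)
      assume "\<not> ereal b \<le> d"
      then obtain d' where d': "d = ereal d'" "x < d'" "d' < b"
        using p by (cases d) auto
      then have "i \<in> I d'" using same[of a d'] x ia by auto
      then show False using xd d' by (simp add: I_def interval_def)
    qed
    ultimately show ?thesis using xd ia by auto
  qed
  then have "I a = {..<length bs}" by (auto simp: I_def)
  then have "length bs = k"
    using cardI[of a] ab const[of a] card by simp
  moreover have "set_mset B \<subseteq> {(a, ereal b)}"
    using bar bs by (auto simp: in_set_conv_nth)
  then have "B = replicate_mset (size B) (a, ereal b)"
    by (rule set_mset_subset_singletonD)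
  ultimately show ?thesis using bs by auto
qed

text \<open>A diameter bound is a condition on pairs of points, so Vietoris-Rips complexes are flag
  complexes.\<close>

lemma VR_eq_clique_complex:
  assumes "finite V" "\<And>x. d x x = 0" "0 \<le> t"
  shows "VR V d t = clique_complex V (\<lambda>x y. d x y \<le> 2 * t)"
proof -
  have "diam d \<sigma> \<le> 2 * t \<longleftrightarrow> (\<forall>x\<in>\<sigma>. \<forall>y\<in>\<sigma>. x \<noteq> y \<longrightarrow> d x y \<le> 2 * t)"
    if "finite \<sigma>" "\<sigma> \<noteq> {}" for \<sigma>
  proof -
    have "diam d \<sigma> \<le> 2 * t \<longleftrightarrow> (\<forall>p\<in>\<sigma> \<times> \<sigma>. (case p of (x, y) \<Rightarrow> d x y) \<le> 2 * t)"
      using that unfolding diam_def by (simp add: cSUP_le_iff)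
    also have "\<dots> \<longleftrightarrow> (\<forall>x\<in>\<sigma>. \<forall>y\<in>\<sigma>. x \<noteq> y \<longrightarrow> d x y \<le> 2 * t)"
      using assms(2,3) by auto (metis mult_nonneg_nonneg zero_le_numeral)
    finally show ?thesis .
  qed
  then show ?thesis by (auto simp: VR_def clique_complex_def)
qed

lemma (in finite_complex) homology_inclusion_self:
  assumes "z \<in> carrier (homology 1 K)"
  shows "homology_inclusion 1 K z = z"
proof -
  let ?G = "chain_group K 1" and ?B = "boundaries K 1"
  interpret G: group ?G by (rule group_chain_group)
  have B: "subgroup ?B ?G"
    by (rule subgroup_chain_group[OF subspace_boundaries])
  obtain c where c: "c \<in> cycles K 1" "z = ?B #>\<^bsub>?G\<^esub> c"
    using assms by (auto simp: homology_def FactGroup_def RCOSETS_def r_coset_def)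
  then have cG: "c \<in> carrier ?G" by (simp add: cycles_def)
  have "?B #>\<^bsub>?G\<^esub> c' = z" if "c' \<in> z" for c'
    using G.repr_independence[OF _ cG B] that c(2) by metis
  moreover have "c \<in> z" using G.rcos_self[OF cG B] c(2) by simp
  ultimately show ?thesis unfolding homology_inclusion_def by blast
qed

lemma clique_complex_cong:
  assumes "\<And>x y. x \<in> V \<Longrightarrow> y \<in> V \<Longrightarrow> x \<noteq> y \<Longrightarrow> adj x y \<longleftrightarrow> adj' x y"
  shows "clique_complex V adj = clique_complex V adj'"
  unfolding clique_complex_def
  by (intro Collect_cong conj_cong ball_cong imp_cong refl) (rule assms; blast)

text \<open>Any symmetric assignment of the values 1/2 and 1 to pairs of distinct points satisfies
  the triangle inequality, so every graph is admissible.\<close>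

definition graph_metric :: "('a \<Rightarrow> 'a \<Rightarrow> bool) \<Rightarrow> 'a \<Rightarrow> 'a \<Rightarrow> real" where
  "graph_metric adj x y = (if x = y then 0 else if adj x y then 1 / 2 else 1)"

lemma Metric_space_graph_metric:
  "(\<And>x y. adj x y \<longleftrightarrow> adj y x) \<Longrightarrow> Metric_space V (graph_metric adj)"
  by unfold_locales (auto simp: graph_metric_def)

lemma diam_graph_metric:
  assumes "finite V" shows "diam (graph_metric adj) V \<le> 1"
proof -
  have "graph_metric adj x y \<le> 1" for x y by (simp add: graph_metric_def)
  then show ?thesis
    using assms unfolding diam_def by (auto intro!: cSUP_least)
qed

lemma VR_barcode_graph_metric:
  assumes V: "finite V" "V \<noteq> {}"
    and card: "card (carrier (homology 1 (clique_complex V adj))) = 2 ^ k"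
    and C: "VR_barcode 1 V (graph_metric adj) C"
  shows "C = replicate_mset k (1 / 4, ereal (1 / 2))"
proof -
  let ?d = "graph_metric adj" and ?K = "clique_complex V adj"
  have VR: "VR V ?d t = clique_complex V (\<lambda>x y. ?d x y \<le> 2 * t)" if "0 \<le> t" for t
    by (rule VR_eq_clique_complex[OF V(1) _ that]) (simp add: graph_metric_def)
  \<comment> \<open>Distances are compared with \<open>2 * t\<close>: edges of length 1/2 enter at
    1/4, all other pairs at 1/2.\<close>
  have mid: "VR V ?d t = ?K" if "1 / 4 \<le> t" "t < 1 / 2" for t
    using that by (subst VR) (auto simp: graph_metric_def intro!: clique_complex_cong)
  interpret K: finite_complex V ?K by (rule finite_complex_clique_complex[OF V(1)])
  show ?thesis
  proof (rule barcode_of_constant[OF C[unfolded VR_barcode_def]])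
    fix t :: real assume t: "0 \<le> t" "t < 1 / 4 \<or> 1 / 2 \<le> t"
    obtain v where v: "v \<in> V" using V by blast
    show "card (carrier (homology 1 (VR V ?d t))) = 1"
    proof (cases "t < 1 / 4")
      case True
      then show ?thesis
        unfolding VR[OF t(1)] by (intro card_homology_discrete[OF V(1)]) (simp add: graph_metric_def)
    next
      case False
      then show ?thesis
        using t unfolding VR[OF t(1)]
        by (intro card_homology_complete[OF V(1) v]) (simp add: graph_metric_def)
    qed
  next
    fix s t :: real and x
    assume st: "1 / 4 \<le> s" "s \<le> t" "t < 1 / 2" and x: "x \<in> carrier (homology 1 ?K)"
    have "1 / 4 \<le> t" using st by simp
    then show "homology_inclusion 1 (VR V ?d t) x = x"
      using st K.homology_inclusion_self[OF x] mid[of t] by simp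
  qed (use mid card in auto)
qed

text \<open>With \<open>\<delta> < (b - a) / 4\<close>, a matched bar has length at least
  \<open>b - a - 2 * \<delta>\<close>, which exceeds \<open>(b - a) / 2\<close>, and an unmatched
  one has length at most \<open>2 * \<delta>\<close>, which is smaller. For the same reason no bar
  of length \<open>b - a\<close> stays unmatched.\<close>

lemma bottleneck_long_bars:
  assumes dist: "bottleneck_distance B (replicate_mset k (a, ereal b)) \<le> ereal \<epsilon>"
    and \<epsilon>: "\<epsilon> < (b - a) / 4"
  shows "size {#p \<in># B. ereal (fst p + (b - a) / 2) < snd p#} = k"
proof -
  let ?C = "replicate_mset k (a, ereal b)" and ?long = "\<lambda>p. ereal (fst p + (b - a) / 2) < snd p"
  \<comment> \<open>Strictness turns the bound on the infimum into an actual matching.\<close>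
  have "bottleneck_distance B ?C < ereal ((b - a) / 4)"
    using dist \<epsilon> by (metis less_ereal.simps(1) order_le_less_trans)
  then obtain \<delta> where \<delta>: "0 \<le> \<delta>" "\<delta> < (b - a) / 4" "bottleneck_matching \<delta> B ?C"
    unfolding bottleneck_distance_def Inf_less_iff by auto
  then obtain P U W where P: "B = image_mset fst P + U" "?C = image_mset snd P + W"
    and m0: "\<forall>((b, d), (b', d'))\<in>#P. \<bar>b - b'\<bar> \<le> \<delta> \<and> d \<le> d' + ereal \<delta> \<and> d' \<le> d + ereal \<delta>"
    and u0: "\<forall>(b, d)\<in>#U + W. d \<le> ereal (b + 2 * \<delta>)"
    using \<delta>(3) unfolding bottleneck_matching_def by (elim exE conjE) (rule that)
  have m: "\<bar>fst (fst p) - fst (snd p)\<bar> \<le> \<delta> \<and> snd (snd p) \<le> snd (fst p) + ereal \<delta>" if "p \<in># P" for p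
    using m0 that by (cases p) fastforce
  have u: "snd p \<le> ereal (fst p + 2 * \<delta>)" if "p \<in># U + W" for p
    using u0 that by (cases p) fastforce
  have C: "p = (a, ereal b)" if "p \<in># ?C" for p using that by (simp split: if_splits)
  have "W = {#}"
  proof (rule ccontr)
    assume "W \<noteq> {#}"
    then obtain w where w: "w \<in># W" by blast
    then have "w = (a, ereal b)" using C P(2) by (metis union_iff)
    then show False using u[of w] w \<delta> by simp
  qed
  then have "size P = k" using arg_cong[OF P(2), of size] by simp
  have "?long (fst p)" if "p \<in># P" for p
  proof -
    have "snd p = (a, ereal b)" using that C P(2) by (metis image_eqI set_image_mset union_iff)
    then have "\<bar>fst (fst p) - a\<bar> \<le> \<delta>" "ereal b \<le> snd (fst p) + ereal \<delta>" using m[OF that] by auto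
    then show ?thesis using \<delta> by (cases "snd (fst p)") (auto simp: field_simps)
  qed
  then have "filter_mset ?long (image_mset fst P) = image_mset fst P"
    by (auto simp: filter_mset_eq_conv)
  moreover have "filter_mset ?long U = {#}"
  proof -
    have "\<not> ?long p" if "p \<in># U" for p
    proof -
      have "snd p \<le> ereal (fst p + 2 * \<delta>)" using u[of p] that by simp
      also have "\<dots> \<le> ereal (fst p + (b - a) / 2)" using \<delta> by simp
      finally show ?thesis by simp
    qed
    then show ?thesis by simp
  qed
  ultimately show ?thesis using P(1) \<open>size P = k\<close> by simp
qed

section \<open>The graph of a matrix\<close>

text \<open>\<open>X\<close> is the orthogonal complement of the column space, restricted to the
  nonempty rows. A maximal independent set \<open>S\<close> of columns has as many elements as the
  rank, distinct combinations of it are distinct, and \<open>card_perp\<close> counts the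
  complement.\<close>

lemma card_orthogonal_columns:
  fixes M :: "bit mat"
  assumes M: "M \<in> carrier_mat nr nc" and es: "enumerates_nonzeros es M"
  defines "I \<equiv> fst ` set es"
  defines "X \<equiv> {x \<in> functions_on I. \<forall>j. (\<Sum>i | (i, j) \<in> set es. x i) = 0}"
  shows "2 ^ vec_space.rank nr M * card X = 2 ^ card I"
proof -
  interpret V: vec_space "TYPE(bit)" nr .
  let ?C = "set (cols M)"
  have C: "?C \<subseteq> carrier_vec nr" using M cols_dim by blast
  have set_es: "(i, j) \<in> set es \<longleftrightarrow> i < nr \<and> j < nc \<and> M $$ (i, j) \<noteq> 0" for i j
    using es M by (auto simp: enumerates_nonzeros_def)
  have I: "I \<subseteq> {..<nr}" "finite I" using set_es by (auto simp: I_def)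
  \<comment> \<open>Columns vanish outside the nonempty rows, so restricting them from
    \<open>{..<nr}\<close> to \<open>I\<close> loses nothing.\<close>
  have colI: "vec_index c i = 0" if "c \<in> ?C" "i < nr" "i \<notin> I" for c i
  proof -
    obtain j where j: "j < nc" "c = col M j" using \<open>c \<in> ?C\<close> M by (auto simp: cols_def)
    have "(i, j) \<notin> set es" using \<open>i \<notin> I\<close> by (force simp: I_def)
    then show ?thesis using set_es j that M by auto
  qed
  have "\<exists>S. finite S \<and> maximal S (\<lambda>T. T \<subseteq> ?C \<and> V.lin_indpt T) \<and> {} \<subseteq> S"
    by (rule maximal_exists_superset[of ?C]) (auto simp: V.lin_dep_def)
  then obtain S where S: "finite S" "maximal S (\<lambda>T. T \<subseteq> ?C \<and> V.lin_indpt T)" by blast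
  then have SC: "S \<subseteq> ?C" "V.lin_indpt S" and max: "\<And>T. S \<subseteq> T \<Longrightarrow> T \<subseteq> ?C \<Longrightarrow> V.lin_indpt T \<Longrightarrow> T = S"
    unfolding maximal_def by auto
  have Scarr: "S \<subseteq> carrier_vec nr" using SC(1) C by blast
  have rank: "V.rank M = card S" by (rule V.rank_card_indpt[OF M S(2)])
  have span: "c \<in> V.span S" if c: "c \<in> ?C" for c
  proof (cases "c \<in> S")
    case True
    then show ?thesis using V.span_mem[of S c] Scarr by simp
  next
    case False
    then have "V.lin_dep (S \<union> {c})" using max[of "S \<union> {c}"] SC(1) c by blast
    then show ?thesis
      using V.lin_dep_iff_in_span[of S c] Scarr SC(2) C c False by auto
  qed
  \<comment> \<open>Combinations of the chosen columns as functions of the row index instead of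
    vectors, to fit \<open>f2_subspace\<close>.\<close>
  define comb where "comb = (\<lambda>(a :: bit Matrix.vec \<Rightarrow> bit) i. if i < nr then \<Sum>c\<in>S. a c * vec_index c i else 0)"
  let ?W = "comb ` functions_on S"
  have comb_lincomb: "vec_index (V.lincomb a S) i = comb a i" if "i < nr" for a i
    using V.lincomb_index[OF that Scarr] that by (simp add: comb_def)
  have comb_add: "comb (\<lambda>c. a c + b c) = (\<lambda>i. comb a i + comb b i)" for a b
    by (auto simp: comb_def distrib_right sum.distrib)
  have inj: "inj_on comb (functions_on S)"
  proof (rule inj_onI)
    fix a b assume ab: "a \<in> functions_on S" "b \<in> functions_on S" "comb a = comb b"
    let ?ab = "\<lambda>c. a c + b c"
    have "comb ?ab i = 0" for i using ab(3) by (simp add: comb_add)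
    then have "V.lincomb ?ab S = 0\<^sub>v nr"
      using V.lincomb_dim[OF S(1) Scarr] by (intro eq_vecI) (simp_all add: comb_lincomb)
    then have "?ab \<in> S \<rightarrow> {0}"
      using V.not_lindepD[OF SC(2) S(1) subset_refl, of ?ab] by (simp add: module_vec_simps)
    then have "a c = b c" if "c \<in> S" for c
      using that by (auto simp: bit_add_eq_0_iff)
    then show "a = b" using functions_onD[OF ab(1)] functions_onD[OF ab(2)] by (metis ext)
  qed
  have W: "f2_subspace I ?W"
    unfolding f2_subspace_def
  proof (intro conjI ballI)
    show "?W \<subseteq> functions_on I"
    proof
      fix w assume "w \<in> ?W"
      then obtain a where a: "w = comb a" by blast
      have "w i = 0" if "i \<notin> I" for i
        using colI[OF _ _ that] SC(1) unfolding a comb_def by (auto intro!: sum.neutral)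
      then show "w \<in> functions_on I" unfolding functions_on_def by blast
    qed
    have "comb (\<lambda>_. 0) = (\<lambda>_. 0)" by (auto simp: comb_def)
    then show "(\<lambda>_. 0) \<in> ?W"
      by (intro image_eqI[where x = "\<lambda>_. 0"]) (auto simp: functions_on_def)
    fix v w assume "v \<in> ?W" "w \<in> ?W"
    then obtain a b where ab: "a \<in> functions_on S" "b \<in> functions_on S" "v = comb a" "w = comb b"
      by blast
    then have "(\<lambda>c. a c + b c) \<in> functions_on S"
      using f2_subspace_functions_on[of S] by (simp add: f2_subspace_def)
    then show "(\<lambda>x. v x + w x) \<in> ?W"
      unfolding ab(3,4) comb_add[symmetric] by (rule imageI)
  qed
  have dot_comb: "dot I (comb a) x = (\<Sum>c\<in>S. a c * (\<Sum>i\<in>I. vec_index c i * x i))" for a x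
  proof -
    have "dot I (comb a) x = (\<Sum>i\<in>I. \<Sum>c\<in>S. a c * (vec_index c i * x i))"
      unfolding dot_def using I(1)
      by (intro sum.cong[OF refl]) (auto simp: comb_def sum_distrib_right mult.assoc)
    also have "\<dots> = (\<Sum>c\<in>S. \<Sum>i\<in>I. a c * (vec_index c i * x i))" by (rule sum.swap)
    finally show ?thesis by (simp add: sum_distrib_left)
  qed
  have perp: "perp I ?W = X"
  proof -
    have col_sum: "(\<Sum>i\<in>I. vec_index (col M j) i * x i) = (\<Sum>i | (i, j) \<in> set es. x i)" if "j < nc" for j x
    proof -
      have "(\<Sum>i\<in>I. vec_index (col M j) i * x i) = (\<Sum>i\<in>I. if (i, j) \<in> set es then x i else 0)"
        using I(1) that M by (intro sum.cong[OF refl]) (auto simp: set_es)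
      also have "\<dots> = (\<Sum>i | i \<in> I \<and> (i, j) \<in> set es. x i)"
        using I(2) by (simp add: sum.inter_filter)
      also have "{i. i \<in> I \<and> (i, j) \<in> set es} = {i. (i, j) \<in> set es}"
        by (force simp: I_def)
      finally show ?thesis .
    qed
    have "(\<forall>w\<in>?W. dot I w x = 0) \<longleftrightarrow> (\<forall>j. (\<Sum>i | (i, j) \<in> set es. x i) = 0)" for x
    proof
      assume *: "\<forall>w\<in>?W. dot I w x = 0"
      show "\<forall>j. (\<Sum>i | (i, j) \<in> set es. x i) = 0"
      proof
        fix j
        show "(\<Sum>i | (i, j) \<in> set es. x i) = 0"
        proof (cases "j < nc")
          case True
          then have c: "col M j \<in> ?C" using M by (auto simp: cols_def)
          then obtain a where a: "V.lincomb a S = col M j"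
            using V.finite_in_span[OF S(1), of "col M j"] Scarr span by auto
          let ?a = "\<lambda>c. if c \<in> S then a c else 0"
          have "comb ?a = comb a" by (auto simp: comb_def intro!: sum.cong)
          moreover have "?a \<in> functions_on S" by (simp add: functions_on_def)
          ultimately have "dot I (comb a) x = 0" using * by (metis imageI)
          moreover have "dot I (comb a) x = (\<Sum>i\<in>I. vec_index (col M j) i * x i)"
            unfolding dot_def using I(1) comb_lincomb[of _ a] a by (intro sum.cong) auto
          ultimately show ?thesis using col_sum[OF True] by simp
        next
          case False
          then have "{i. (i, j) \<in> set es} = {}" by (auto simp: set_es)
          then show ?thesis by simp
        qed
      qed
    next
      assume *: "\<forall>j. (\<Sum>i | (i, j) \<in> set es. x i) = 0"
      have "(\<Sum>i\<in>I. vec_index c i * x i) = 0" if "c \<in> S" for c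
      proof -
        obtain j where "j < nc" "c = col M j" using \<open>c \<in> S\<close> SC(1) M by (auto simp: cols_def)
        then show ?thesis using * col_sum by simp
      qed
      then show "\<forall>w\<in>?W. dot I w x = 0" by (simp add: dot_comb)
    qed
    then show ?thesis unfolding perp_def X_def by blast
  qed
  have "card ?W = 2 ^ card S"
    using card_image[OF inj] card_functions_on[OF S(1)] by simp
  then show ?thesis
    using card_perp[OF W I(2)] unfolding perp rank by simp
qed

section \<open>The graph of a list of entries\<close>

locale entry_list =
  fixes es :: "(nat \<times> nat) list"
  assumes distinct: "distinct es"
begin

abbreviation "m \<equiv> length es"
abbreviation "rw k \<equiv> fst (es ! k)"
abbreviation "cl k \<equiv> snd (es ! k)"

text \<open>The vertices are the poles 0, 1, 2, the base 3, the vertex 4, the vertices \<open>5 + 2 * k\<close> and \<open>6 + 2 * k\<close>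
  for the \<open>k\<close>-th entry, and \<open>rowv m i\<close> for each nonempty row \<open>i\<close> (0 stands for a row not yet seen).
  Up to coboundaries, a cocycle assigns a bit to each vertex adjacent to exactly two poles, and to each vertex
  adjacent to all three poles a bit for each pair of poles, with sum zero. An edge between two such vertices
  identifies the bits at their common pair of poles. The row vertices carry the variables, at the poles 1 and 2.
  The vertex \<open>6 + 2 * k\<close> carries the sum of the variables over the entries of its column up to \<open>k\<close>, at the
  poles 0 and \<open>1 + par\<close>. This sum is enforced by \<open>5 + 2 * k\<close>, which is adjacent to all poles, to the row vertex
  and to the vertex \<open>cur\<close> with the previous sum of the column; as the new sum uses another pair of poles than
  the previous one, \<open>par\<close> alternates. Finally, \<open>fe\<close> makes the sum of each column vanish, since all
  bits at the base are zero.\<close>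

primrec cur :: "nat \<Rightarrow> nat \<Rightarrow> nat" where
  "cur 0 j = 4"
| "cur (Suc k) j = (if cl k = j then 6 + 2 * k else cur k j)"

primrec par :: "nat \<Rightarrow> nat \<Rightarrow> nat" where
  "par 0 j = 0"
| "par (Suc k) j = (if cl k = j then 1 - par k j else par k j)"

definition nrows :: "nat \<Rightarrow> nat" where
  "nrows k = card (rw ` {..<k})"

primrec rowv :: "nat \<Rightarrow> nat \<Rightarrow> nat" where
  "rowv 0 i = 0"
| "rowv (Suc k) i = (if rw k = i \<and> rowv k i = 0 then 5 + 2 * m + nrows k else rowv k i)"

definition pe :: "nat \<Rightarrow> (nat \<times> nat) set" where
  "pe k = {(3, 0), (3, 1), (3, 2), (4, 0), (4, 1)} \<union>
     (\<Union>i<k. {(5 + 2 * i, 0), (5 + 2 * i, 1), (5 + 2 * i, 2), (6 + 2 * i, 0), (6 + 2 * i, 1 + par (Suc i) (cl i))}) \<union>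
     (\<Union>r<nrows k. {(5 + 2 * m + r, 1), (5 + 2 * m + r, 2)})"

definition ne :: "nat \<Rightarrow> (nat \<times> nat) set" where
  "ne k = {(3, 4)} \<union>
     (\<Union>i<k. {(5 + 2 * i, rowv (Suc i) (rw i)), (5 + 2 * i, cur i (cl i)), (5 + 2 * i, 6 + 2 * i)})"

text \<open>Kept apart from \<open>ne\<close> because the last vertex of a column is known only
  after all entries have been read; the program adds these edges in a second pass.\<close>

definition fe :: "nat \<Rightarrow> (nat \<times> nat) set" where
  "fe k = (\<lambda>i. (3, cur m (cl i))) ` {..<k}"

definition nv :: nat where "nv = 5 + 2 * m + nrows m"

lemma par_le: "par k j \<le> 1"
  by (induction k) auto

lemma cur_cases:
  "(cur k j = 4 \<and> par k j = 0) \<or> (\<exists>i<k. cur k j = 6 + 2 * i \<and> cl i = j \<and> par k j = par (Suc i) j)"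
proof (induction k)
  case (Suc k)
  show ?case
  proof (cases "cl k = j")
    case True
    then show ?thesis by (intro disjI2 exI[of _ k]) simp
  next
    case False
    then have eq: "cur (Suc k) j = cur k j" "par (Suc k) j = par k j" by simp_all
    show ?thesis unfolding eq using Suc.IH less_SucI by blast
  qed
qed simp

lemma rowv_eq_0_iff: "rowv k i = 0 \<longleftrightarrow> i \<notin> rw ` {..<k}"
  by (induction k) (auto simp: lessThan_Suc)

lemma nrows_Suc: "nrows (Suc k) = (if rowv k (rw k) = 0 then Suc (nrows k) else nrows k)"
  by (auto simp: nrows_def rowv_eq_0_iff lessThan_Suc insert_absorb)

text \<open>Rows are numbered without gaps in the order of their first occurrence, so that the
  vertices are exactly the numbers below \<open>nv\<close>, as required of the points of the metric
  space.\<close>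

lemma rowv_bij: "bij_betw (rowv k) (rw ` {..<k}) {5 + 2 * m..<5 + 2 * m + nrows k}"
proof (induction k)
  case 0
  then show ?case by (simp add: nrows_def bij_betw_def)
next
  case (Suc k)
  let ?I = "rw ` {..<k}"
  have I: "rw ` {..<Suc k} = insert (rw k) ?I" by (simp add: lessThan_Suc)
  show ?case
  proof (cases "rw k \<in> ?I")
    case True
    then have "rowv k (rw k) \<noteq> 0" using rowv_eq_0_iff by blast
    then have "rowv (Suc k) = rowv k" "nrows (Suc k) = nrows k" by (auto simp: nrows_Suc)
    then show ?thesis using Suc True I by (simp add: insert_absorb)
  next
    case False
    then have 0: "rowv k (rw k) = 0" using rowv_eq_0_iff by blast
    then have n: "nrows (Suc k) = Suc (nrows k)" by (simp add: nrows_Suc)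
    have "bij_betw (rowv (Suc k)) ?I {5 + 2 * m..<5 + 2 * m + nrows k}"
      using Suc False by (subst bij_betw_cong[where g = "rowv k"]) auto
    moreover have "rowv (Suc k) (rw k) = 5 + 2 * m + nrows k" using 0 by simp
    moreover have "{5 + 2 * m..<5 + 2 * m + nrows (Suc k)} =
        insert (5 + 2 * m + nrows k) {5 + 2 * m..<5 + 2 * m + nrows k}"
      unfolding n by auto
    ultimately show ?thesis
      unfolding I using False notIn_Un_bij_betw[of "rw k" ?I "rowv (Suc k)"
        "{5 + 2 * m..<5 + 2 * m + nrows k}"]
      by (simp del: rowv.simps)
  qed
qed

lemma rowv_mono: "i \<in> rw ` {..<k} \<Longrightarrow> k \<le> k' \<Longrightarrow> rowv k' i = rowv k i"
proof (induction k')
  case (Suc k')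
  show ?case
  proof (cases "k = Suc k'")
    case False
    then have "rowv k' i = rowv k i" using Suc by simp
    then show ?thesis using Suc.prems(1) rowv_eq_0_iff[of k i] by simp
  qed simp
qed simp

lemma rowv_final: "k < m \<Longrightarrow> rowv (Suc k) (rw k) = rowv m (rw k)"
  by (rule rowv_mono[symmetric]) auto

lemma rowv_range: "k < m \<Longrightarrow> rowv m (rw k) \<in> {5 + 2 * m..<nv}"
  using bij_betwE[OF rowv_bij[of m]] by (auto simp: nv_def)

definition poles :: "nat set" where "poles = {0, 1, 2}"

text \<open>The vertices from which all edges between non-poles start; each of them is adjacent to
  all three poles.\<close>

definition tops :: "nat set" where "tops = insert 3 ((\<lambda>k. 5 + 2 * k) ` {..<m})"

text \<open>The pole used for normalization. It differs for row vertices because these are not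
  adjacent to pole 0.\<close>

definition mainpole :: "nat \<Rightarrow> nat" where "mainpole y = (if 5 + 2 * m \<le> y then 1 else 0)"

lemma pe_iff:
  "(y, l) \<in> pe m \<longleftrightarrow> y = 3 \<and> l \<le> 2 \<or> y = 4 \<and> l \<le> 1 \<or> (\<exists>k<m. y = 5 + 2 * k) \<and> l \<le> 2 \<or>
     (\<exists>k<m. y = 6 + 2 * k \<and> (l = 0 \<or> l = 1 + par (Suc k) (cl k))) \<or>
     5 + 2 * m \<le> y \<and> y < nv \<and> (l = 1 \<or> l = 2)"
proof -
  have "(\<exists>r<nrows m. y = 5 + 2 * m + r) \<longleftrightarrow> 5 + 2 * m \<le> y \<and> y < nv"
    by (auto simp: nv_def intro!: exI[of _ "y - (5 + 2 * m)"])
  moreover have "l \<le> 2 \<longleftrightarrow> l = 0 \<or> l = 1 \<or> l = 2" "l \<le> 1 \<longleftrightarrow> l = 0 \<or> l = 1" by auto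
  moreover have "(y, l) \<in> {(3, 0), (3, 1), (3, 2), (4, 0), (4, 1)} \<longleftrightarrow>
      y = 3 \<and> (l = 0 \<or> l = 1 \<or> l = 2) \<or> y = 4 \<and> (l = 0 \<or> l = 1)"
    by auto
  moreover have "(y, l) \<in> (\<Union>i<m. {(5 + 2 * i, 0), (5 + 2 * i, 1), (5 + 2 * i, 2), (6 + 2 * i, 0),
        (6 + 2 * i, 1 + par (Suc i) (cl i))}) \<longleftrightarrow>
      (\<exists>k<m. y = 5 + 2 * k) \<and> (l = 0 \<or> l = 1 \<or> l = 2) \<or>
      (\<exists>k<m. y = 6 + 2 * k \<and> (l = 0 \<or> l = 1 + par (Suc k) (cl k)))"
    unfolding UN_iff Bex_def insert_iff empty_iff prod.inject lessThan_iff by blast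
  moreover have "(y, l) \<in> (\<Union>r<nrows m. {(5 + 2 * m + r, 1), (5 + 2 * m + r, 2)}) \<longleftrightarrow>
      (\<exists>r<nrows m. y = 5 + 2 * m + r) \<and> (l = 1 \<or> l = 2)"
    unfolding UN_iff Bex_def insert_iff empty_iff prod.inject lessThan_iff by blast
  ultimately show ?thesis unfolding pe_def Un_iff by argo
qed

lemma vertex_cases:
  assumes "y < nv" "y \<notin> poles"
  obtains "y = 3" | "y = 4" | k where "k < m" "y = 5 + 2 * k" | k where "k < m" "y = 6 + 2 * k" |
    "5 + 2 * m \<le> y"
proof -
  consider "y = 3" | "y = 4" | "5 \<le> y" "y < 5 + 2 * m" | "5 + 2 * m \<le> y"
    using assms by (force simp: poles_def)
  then show ?thesis
  proof cases
    case 3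
    then have "y = 5 + 2 * ((y - 5) div 2) \<or> y = 6 + 2 * ((y - 5) div 2)" "(y - 5) div 2 < m"
      by presburger+
    then show ?thesis using that(3,4) by blast
  qed (use that in blast)+
qed

lemma cur_pole: "k \<le> m \<Longrightarrow> (cur k j, l) \<in> pe m \<longleftrightarrow> l = 0 \<or> l = 1 + par k j"
proof -
  assume k: "k \<le> m"
  from cur_cases[of k j] show ?thesis
  proof (elim disjE exE conjE)
    assume "cur k j = 4" "par k j = 0"
    then show ?thesis by (auto simp: pe_iff)
  next
    fix i assume i: "i < k" "cur k j = 6 + 2 * i" "cl i = j" "par k j = par (Suc i) j"
    have "(6 + 2 * i, l) \<in> pe m \<longleftrightarrow> l = 0 \<or> l = 1 + par (Suc i) (cl i)"
      using \<open>i < k\<close> k by (simp add: pe_iff del: par.simps) presburger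
    then show ?thesis using i by simp
  qed
qed

lemma row_pole:
  assumes "k < m"
  shows "(rowv m (rw k), l) \<in> pe m \<longleftrightarrow> l = 1 \<or> l = 2"
proof -
  define b where "b = rowv m (rw k)"
  have "5 + 2 * m \<le> b" "b < nv" using rowv_range[OF assms] by (auto simp: b_def)
  then show ?thesis unfolding b_def [symmetric] pe_iff by auto
qed

lemma ne_cases:
  assumes "(t, d) \<in> ne m \<union> fe m"
  obtains "t = 3" "d = 4" | k where "k < m" "t = 5 + 2 * k" "d = rowv m (rw k)" |
    k where "k < m" "t = 5 + 2 * k" "d = cur k (cl k)" | k where "k < m" "t = 5 + 2 * k" "d = 6 + 2 * k" |
    k where "k < m" "t = 3" "d = cur m (cl k)"
  using assms unfolding ne_def fe_def
  by (auto simp: rowv_final simp del: rowv.simps)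

lemma cur_range: "k \<le> m \<Longrightarrow> cur k j < 5 + 2 * m \<and> 4 \<le> cur k j \<and> even (cur k j)"
  using cur_cases[of k j] by auto

sublocale pole_graph "{..<nv}" poles tops "pe m" "ne m \<union> fe m" 3 mainpole
proof
  show "finite {..<nv}" by simp
  show "poles \<subseteq> {..<nv}" "tops \<subseteq> {..<nv} - poles" "3 \<in> {..<nv} - poles"
    by (auto simp: poles_def tops_def nv_def)
  show "pe m \<subseteq> ({..<nv} - poles) \<times> poles"
  proof
    fix p assume p: "p \<in> pe m"
    obtain y l where yl: "p = (y, l)" by force
    have "1 + par (Suc k) (cl k) \<le> 2" for k using par_le[of "Suc k" "cl k"] by linarith
    then have "y < nv \<and> 3 \<le> y \<and> l \<le> 2"
      using p unfolding yl pe_iff nv_def by (auto simp del: par.simps)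
    then show "p \<in> ({..<nv} - poles) \<times> poles" unfolding yl poles_def by auto
  qed
  show "ne m \<union> fe m \<subseteq> tops \<times> ({..<nv} - poles - tops)"
  proof
    fix p assume p: "p \<in> ne m \<union> fe m"
    obtain t d where td: "p = (t, d)" by force
    \<comment> \<open>Tops are odd and below \<open>5 + 2 * m\<close>, so parity or size tells them
      apart from the other ends of the edges.\<close>
    have d: "d \<in> {..<nv} - poles - tops" if "d < nv" "4 \<le> d" "even d \<or> 5 + 2 * m \<le> d"
      using that by (auto simp: poles_def tops_def)
    show "p \<in> tops \<times> ({..<nv} - poles - tops)"
      using p unfolding td
    proof (cases rule: ne_cases)
      case 1
      then show "(t, d) \<in> tops \<times> ({..<nv} - poles - tops)" using d by (auto simp: tops_def nv_def)
    next
      case (2 k)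
      then show "(t, d) \<in> tops \<times> ({..<nv} - poles - tops)"
        using d rowv_range[of k] by (auto simp: tops_def)
    next
      case (3 k)
      then show "(t, d) \<in> tops \<times> ({..<nv} - poles - tops)"
        using d cur_range[of k "cl k"] by (auto simp: tops_def nv_def)
    next
      case (4 k)
      then show "(t, d) \<in> tops \<times> ({..<nv} - poles - tops)" using d by (auto simp: tops_def nv_def)
    next
      case (5 k)
      then show "(t, d) \<in> tops \<times> ({..<nv} - poles - tops)"
        using d cur_range[of m "cl k"] by (auto simp: tops_def nv_def)
    qed
  qed
  show "(y, mainpole y) \<in> pe m" if "y \<in> {..<nv} - poles" for y
  proof -
    have y: "y < nv" "y \<notin> poles" using that by auto
    from y show ?thesis
      by (cases rule: vertex_cases) (use y in \<open>auto simp: pe_iff mainpole_def\<close>)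
  qed
  show "(3, l) \<in> pe m" if "l \<in> poles" for l
    using that by (auto simp: pe_iff poles_def)
  show "\<exists>l. (t, l) \<in> pe m \<and> (d, l) \<in> pe m" if "(t, d) \<in> ne m \<union> fe m" for t d
    using that
  proof (cases rule: ne_cases)
    \<comment> \<open>A row vertex shares the poles 1 and 2 with its top; the ends of all other
      edges have pole 0 in common.\<close>
    case (2 k)
    then show ?thesis using rowv_range[of k] by (intro exI[of _ 1]) (auto simp: pe_iff)
  next
    case (3 k)
    then have "(t, 0) \<in> pe m" by (simp add: pe_iff)
    moreover have "(d, 0) \<in> pe m" using cur_pole[of k] 3 by simp
    ultimately show ?thesis by blast
  next
    case (5 k)
    then have "(t, 0) \<in> pe m" by (simp add: pe_iff)
    moreover have "(d, 0) \<in> pe m" using cur_pole[of m] 5 by simp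
    ultimately show ?thesis by blast
  qed (auto simp: pe_iff intro!: exI[of _ 0])
qed

section \<open>Cocycles and solutions of the transposed system\<close>

primrec psum :: "(nat \<Rightarrow> bit) \<Rightarrow> nat \<Rightarrow> nat \<Rightarrow> bit" where
  "psum x 0 j = 0"
| "psum x (Suc k) j = (if cl k = j then psum x k j + x (rw k) else psum x k j)"

lemma psum_final: "psum x m j = (\<Sum>i | (i, j) \<in> set es. x i)"
proof -
  have "psum x k j = (\<Sum>i<k. if cl i = j then x (rw i) else 0)" for k
    by (induction k) auto
  then have "psum x m j = (\<Sum>k<m. (\<lambda>e. if snd e = j then x (fst e) else 0) (es ! k))" by simp
  also have "\<dots> = (\<Sum>e\<in>set es. if snd e = j then x (fst e) else 0)"
    by (rule sum.reindex_bij_betw[OF bij_betw_nth[OF distinct]]) auto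
  also have "\<dots> = (\<Sum>e | e \<in> set es \<and> snd e = j. x (fst e))"
    by (simp add: sum.inter_filter)
  also have "\<dots> = (\<Sum>i | (i, j) \<in> set es. x i)"
    by (rule sum.reindex_bij_witness[where i = "\<lambda>i. (i, j)" and j = fst]) auto
  finally show ?thesis .
qed

text \<open>Variables belong to nonempty rows only, since the size of the graph must not depend on
  the dimensions of the matrix.\<close>

definition sols :: "(nat \<Rightarrow> bit) set" where
  "sols = {x \<in> functions_on (fst ` set es). \<forall>j. (\<Sum>i | (i, j) \<in> set es. x i) = 0}"

lemma rows_eq: "rw ` {..<m} = fst ` set es"
  by (force simp: set_conv_nth)

text \<open>\<open>(y - 5) div 2\<close> is the entry to which \<open>y\<close> belongs. Its odd
  vertex carries the new column sum at one of the poles 1 and 2 and the previous sum at the other;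
  its even vertex carries the new sum only. A row vertex carries its variable at pole 2. The zeros
  at pole 0, and at pole 1 for row vertices, are the normalization.\<close>

definition of_sol :: "(nat \<Rightarrow> bit) \<Rightarrow> nat \<times> nat \<Rightarrow> bit" where
  "of_sol x = (\<lambda>(y, l).
     if y < 5 \<or> l = 0 \<or> 2 < l then 0
     else if y < 5 + 2 * m then
       let k = (y - 5) div 2 in
       if l = 1 + par (Suc k) (cl k) then psum x (Suc k) (cl k)
       else if odd y then psum x k (cl k) else 0
     else if y < nv \<and> l = 2 then x (inv_into (fst ` set es) (rowv m) y) else 0)"

definition to_sol :: "(nat \<times> nat \<Rightarrow> bit) \<Rightarrow> nat \<Rightarrow> bit" where
  "to_sol f i = (if i \<in> fst ` set es then f (rowv m i, 2) else 0)"

lemma par_flip: "par (Suc k) (cl k) = 1 - par k (cl k)"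
  by simp

lemma of_sol_low: "y < 5 \<Longrightarrow> of_sol x (y, l) = 0"
  and of_sol_pole0: "of_sol x (y, 0) = 0"
  by (simp_all add: of_sol_def)

lemma of_sol_top:
  assumes "k < m"
  shows "of_sol x (5 + 2 * k, 1 + par (Suc k) (cl k)) = psum x (Suc k) (cl k)"
    and "of_sol x (5 + 2 * k, 1 + par k (cl k)) = psum x k (cl k)"
    and "of_sol x (6 + 2 * k, 1 + par (Suc k) (cl k)) = psum x (Suc k) (cl k)"
proof -
  have "(6 + 2 * k - 5) div 2 = k" by simp
  moreover have "par k (cl k) = 0 \<or> par k (cl k) = 1" using par_le[of k "cl k"] by linarith
  ultimately show "of_sol x (5 + 2 * k, 1 + par (Suc k) (cl k)) = psum x (Suc k) (cl k)"
    "of_sol x (5 + 2 * k, 1 + par k (cl k)) = psum x k (cl k)"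
    "of_sol x (6 + 2 * k, 1 + par (Suc k) (cl k)) = psum x (Suc k) (cl k)"
    using assms unfolding of_sol_def par_flip by (auto simp: Let_def simp del: psum.simps par.simps)
qed

lemma of_sol_row:
  assumes "k < m"
  shows "of_sol x (rowv m (rw k), 1) = 0" "of_sol x (rowv m (rw k), 2) = x (rw k)"
proof -
  have "inj_on (rowv m) (fst ` set es)" "rw k \<in> fst ` set es"
    using rowv_bij[of m] assms unfolding bij_betw_def rows_eq by auto
  then have "inv_into (fst ` set es) (rowv m) (rowv m (rw k)) = rw k"
    by (rule inv_into_f_f)
  then show "of_sol x (rowv m (rw k), 1) = 0" "of_sol x (rowv m (rw k), 2) = x (rw k)"
    using rowv_range[OF assms] by (simp_all add: of_sol_def)
qed

lemma of_sol_cur: "k \<le> m \<Longrightarrow> of_sol x (cur k j, 1 + par k j) = psum x k j"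
proof (induction k)
  case 0
  then show ?case by (simp add: of_sol_low)
next
  case (Suc k)
  then show ?case using of_sol_top(3)[of k x] by auto
qed

text \<open>The alternation of \<open>par\<close> puts the new and the previous sum on different
  poles; together they cover the pair of poles shared with the row vertex.\<close>

lemma two_poles: "{1 + par (Suc k) (cl k), 1 + par k (cl k)} = {1, 2}"
  using par_le[of k "cl k"] by (auto simp: le_Suc_eq)

text \<open>One case for each kind of edge between non-poles. That \<open>x\<close> solves the
  system enters at the closing edges.\<close>

lemma of_sol_in:
  assumes x: "x \<in> sols"
  shows "of_sol x \<in> Lam"
  unfolding Lam_def mem_Collect_eq
proof (intro conjI allI ballI impI)
  show "of_sol x (3, l) = 0" for l by (simp add: of_sol_low)
  show "of_sol x (y, mainpole y) = 0" if "y \<in> {..<nv} - poles" for y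
    by (auto simp: mainpole_def of_sol_def)
  show "of_sol x \<in> functions_on (pe m)"
    unfolding functions_on_def mem_Collect_eq
  proof (intro allI impI)
    fix p assume p: "of_sol x p \<noteq> 0"
    obtain y l where yl: "p = (y, l)" by force
    have y: "5 \<le> y" "y < nv" "l = 1 \<or> l = 2"
      using p unfolding yl of_sol_def by (auto split: if_splits simp: nv_def)
    then have "y < nv" "y \<notin> poles" by (auto simp: poles_def)
    then show "p \<in> pe m"
    proof (cases rule: vertex_cases)
      case (4 k)
      have "(6 + 2 * k - 5) div 2 = k" by simp
      then have "l = 1 + par (Suc k) (cl k)"
        using p 4 y unfolding yl of_sol_def by (auto split: if_splits simp: Let_def simp del: par.simps)
      then show ?thesis using 4 unfolding yl pe_iff by blast
    qed (use y in \<open>auto simp: yl pe_iff\<close>)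
  qed
  fix t d l l'
  assume *: "(t, d) \<in> ne m \<union> fe m \<and> (t, l) \<in> pe m \<and> (d, l) \<in> pe m \<and> (t, l') \<in> pe m \<and> (d, l') \<in> pe m"
  then have "(t, d) \<in> ne m \<union> fe m" by blast
  then show "of_sol x (t, l) + of_sol x (d, l) = of_sol x (t, l') + of_sol x (d, l')"
  proof (cases rule: ne_cases)
    case 1
    then show ?thesis by (simp add: of_sol_low)
  next
    case (2 k)
    have "l \<in> {1, 2}" "l' \<in> {1, 2}"
      using * row_pole[OF 2(1)] unfolding 2(3) by blast+
    \<comment> \<open>New and previous sum differ by the variable of the row, and so do the two
      values at the row vertex.\<close>
    moreover have "of_sol x (t, 1) + of_sol x (t, 2) = x (rw k)"
    proof -
      have "of_sol x (t, 1 + par (Suc k) (cl k)) + of_sol x (t, 1 + par k (cl k)) = x (rw k)"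
        unfolding 2 of_sol_top(1,2)[OF 2(1)] by (simp add: ac_simps)
      then show ?thesis
        using two_poles[of k] by (auto simp: doubleton_eq_iff add.commute simp del: par.simps)
    qed
    then have "of_sol x (t, 1) + of_sol x (d, 1) = of_sol x (t, 2) + of_sol x (d, 2)"
      unfolding 2(3) of_sol_row[OF 2(1)] by (metis add.commute add.right_neutral bit_add_left_cancel)
    ultimately show ?thesis by auto
  next
    case (3 k)
    \<comment> \<open>Both ends carry the same sum at the shared pole other than 0, and zero at pole
      0.\<close>
    have "of_sol x (t, l) + of_sol x (d, l) = 0" if "(d, l) \<in> pe m" for l
      using that cur_pole[of k "cl k" l] 3 of_sol_top(2)[OF 3(1), of x] of_sol_cur[of k x "cl k"]
      by (auto simp: of_sol_pole0)
    then show ?thesis using * by simp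
  next
    case (4 k)
    have "of_sol x (t, l) + of_sol x (d, l) = 0" if "(d, l) \<in> pe m" for l
    proof -
      have "l = 0 \<or> l = 1 + par (Suc k) (cl k)"
        using cur_pole[of "Suc k" "cl k" l] that 4 by simp
      then show ?thesis
        using 4 of_sol_top(1,3)[OF 4(1), of x] by (auto simp: of_sol_pole0 simp del: par.simps psum.simps)
    qed
    then show ?thesis using * by simp
  next
    case (5 k)
    have "of_sol x (t, l) + of_sol x (d, l) = 0" if "(d, l) \<in> pe m" for l
    proof -
      \<comment> \<open>The last partial sum is the full column sum.\<close>
      have "psum x m (cl k) = 0" using x by (simp add: psum_final sols_def)
      then show ?thesis
        using that 5 cur_pole[of m "cl k" l] of_sol_cur[of m x "cl k"]
        by (auto simp: of_sol_pole0 of_sol_low)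
    qed
    then show ?thesis using * by simp
  qed
qed

context
  fixes f assumes f: "f \<in> Lam"
begin

lemma Lam_0: "y < 5 + 2 * m \<Longrightarrow> f (y, 0) = 0"
proof -
  assume y: "y < 5 + 2 * m"
  show ?thesis
  proof (cases "y \<in> poles")
    case True
    then have "(y, 0) \<notin> pe m" by (auto simp: poles_def pe_iff)
    then show ?thesis using f functions_onD[of f "pe m" "(y, 0)"] by (simp add: Lam_def)
  next
    case False
    then have "y \<in> {..<nv} - poles" using y by (simp add: nv_def)
    then have "f (y, mainpole y) = 0" using f unfolding Lam_def by blast
    then show ?thesis using y by (simp add: mainpole_def)
  qed
qed

lemma Lam_eq:
  assumes "(t, d) \<in> ne m \<union> fe m" "(t, l) \<in> pe m" "(d, l) \<in> pe m" "(t, l') \<in> pe m" "(d, l') \<in> pe m"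
  shows "f (t, l) + f (d, l) = f (t, l') + f (d, l')"
  using f assms unfolding Lam_def by blast

text \<open>An edge whose ends share pole 0 copies the bit at any other shared pole, since both ends
  are normalized to zero at pole 0.\<close>

lemma Lam_tie:
  assumes "(t, d) \<in> ne m \<union> fe m" "t < 5 + 2 * m" "d < 5 + 2 * m"
    "(t, 0) \<in> pe m" "(d, 0) \<in> pe m" "(t, l) \<in> pe m" "(d, l) \<in> pe m"
  shows "f (t, l) = f (d, l)"
proof -
  have "f (t, 0) + f (d, 0) = f (t, l) + f (d, l)"
    using assms by (intro Lam_eq)
  then show ?thesis using Lam_0 assms by (simp add: bit_add_eq_0_iff)
qed

text \<open>The edges at \<open>5 + 2 * k\<close> enforce the recursion of \<open>psum\<close>: the
  vertex takes over the previous sum, passes on the new one, and through the row vertex makes the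
  two differ by the variable.\<close>

lemma Lam_top:
  assumes k: "k < m"
  shows "f (5 + 2 * k, 1 + par k (cl k)) = f (cur k (cl k), 1 + par k (cl k))"
    and "f (5 + 2 * k, 1 + par (Suc k) (cl k)) = f (6 + 2 * k, 1 + par (Suc k) (cl k))"
    and "f (5 + 2 * k, 1 + par (Suc k) (cl k)) = f (5 + 2 * k, 1 + par k (cl k)) + to_sol f (rw k)"
proof -
  have le: "par i j \<le> 1" for i j by (rule par_le)
  have u: "(5 + 2 * k, l) \<in> pe m" if "l \<le> 2" for l using that k by (auto simp: pe_iff)
  have le2: "1 + par i j \<le> 2" for i j using le[of i j] by linarith
  show "f (5 + 2 * k, 1 + par k (cl k)) = f (cur k (cl k), 1 + par k (cl k))"
  proof (rule Lam_tie)
    show "(5 + 2 * k, cur k (cl k)) \<in> ne m \<union> fe m" using k by (auto simp: ne_def)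
    show "cur k (cl k) < 5 + 2 * m" using cur_range[of k "cl k"] k by simp
    show "(cur k (cl k), 0) \<in> pe m" "(cur k (cl k), 1 + par k (cl k)) \<in> pe m"
      using cur_pole[of k] k by auto
  qed (use u le2 k in auto)
  show "f (5 + 2 * k, 1 + par (Suc k) (cl k)) = f (6 + 2 * k, 1 + par (Suc k) (cl k))"
  proof (rule Lam_tie)
    show "(5 + 2 * k, 6 + 2 * k) \<in> ne m \<union> fe m" using k by (auto simp: ne_def)
    show "(6 + 2 * k, 0) \<in> pe m" "(6 + 2 * k, 1 + par (Suc k) (cl k)) \<in> pe m"
      using k unfolding pe_iff by blast+
    show "(5 + 2 * k, 1 + par (Suc k) (cl k)) \<in> pe m" using u le2 by blast
  qed (use u k in auto)
  let ?b = "rowv m (rw k)"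
  have b: "(?b, 1) \<in> pe m" "(?b, 2) \<in> pe m" "?b \<in> {..<nv} - poles" "mainpole ?b = 1"
    using rowv_range[OF k] by (auto simp: pe_iff poles_def mainpole_def)
  have "(5 + 2 * k, ?b) \<in> ne m \<union> fe m"
    using k unfolding ne_def rowv_final[OF k, symmetric] by blast
  then have "f (5 + 2 * k, 1) + f (?b, 1) = f (5 + 2 * k, 2) + f (?b, 2)"
    using b u[of 1] u[of 2] by (intro Lam_eq) simp_all
  moreover have "f (?b, mainpole ?b) = 0" using f b(3) unfolding Lam_def by blast
  then have "f (?b, 1) = 0" by (simp only: b(4))
  moreover have "f (?b, 2) = to_sol f (rw k)" using k by (simp add: to_sol_def)
  ultimately have *: "f (5 + 2 * k, 1) = f (5 + 2 * k, 2) + to_sol f (rw k)" by simp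
  then have "f (5 + 2 * k, 2) = f (5 + 2 * k, 1) + to_sol f (rw k)"
    by (simp add: add.assoc)
  then show "f (5 + 2 * k, 1 + par (Suc k) (cl k)) = f (5 + 2 * k, 1 + par k (cl k)) + to_sol f (rw k)"
    using two_poles[of k] * by (auto simp: doubleton_eq_iff simp del: par.simps)
qed

text \<open>The start value of every column sum. Vertex 4 stands in for the base 3, which is itself
  a top and so cannot be joined to the tops of the entries.\<close>

lemma Lam_4: "f (4, 1) = 0"
proof -
  have "f (3, 1) = f (4, 1)"
    by (rule Lam_tie) (auto simp: ne_def pe_iff)
  then show ?thesis using f by (simp add: Lam_def)
qed

lemma Lam_cur: "k \<le> m \<Longrightarrow> f (cur k j, 1 + par k j) = psum (to_sol f) k j"
proof (induction k)
  case 0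
  then show ?case using Lam_4 by simp
next
  case (Suc k)
  then show ?case using Lam_top[of k] by auto
qed

text \<open>A column with an entry is closed by an edge of \<open>fe\<close>, which ties its last
  sum to a zero at the base; a column without entries has an empty sum.\<close>

lemma to_sol_in: "to_sol f \<in> sols"
proof -
  have "psum (to_sol f) m j = 0" for j
  proof (cases "\<exists>k<m. cl k = j")
    case True
    then obtain k where k: "k < m" "cl k = j" by blast
    have "f (3, 1 + par m j) = f (cur m j, 1 + par m j)"
    proof (rule Lam_tie)
      show "(3, cur m j) \<in> ne m \<union> fe m" using k by (auto simp: fe_def)
      show "cur m j < 5 + 2 * m" using cur_range[of m j] by simp
      show "(3, 1 + par m j) \<in> pe m" using par_le[of m j] by (simp add: pe_iff)
    qed (auto simp: cur_pole pe_iff[of 3])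
    then show ?thesis using f Lam_cur[of m j] by (simp add: Lam_def)
  next
    case False
    then have "(i, j) \<notin> set es" for i by (force simp: in_set_conv_nth)
    then show ?thesis by (simp add: psum_final)
  qed
  then show ?thesis by (auto simp: sols_def functions_on_def to_sol_def psum_final)
qed

lemma of_to_sol: "of_sol (to_sol f) = f"
proof
  fix p :: "nat \<times> nat"
  obtain y l where p: "p = (y, l)" by force
  have out: "of_sol (to_sol f) p = f p" if "p \<notin> pe m"
  proof -
    have "f \<in> functions_on (pe m)" "of_sol (to_sol f) \<in> functions_on (pe m)"
      using f of_sol_in[OF to_sol_in] unfolding Lam_def by blast+
    then show ?thesis
      using functions_onD[OF _ that, of f] functions_onD[OF _ that, of "of_sol (to_sol f)"] by simp
  qed
  show "of_sol (to_sol f) p = f p"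
  proof (cases "p \<in> pe m")
    case True
    then have yl: "y \<in> {..<nv} - poles" "l \<in> poles" using PE unfolding p by blast+
    then have "y < nv" "y \<notin> poles" by auto
    then show ?thesis
    proof (cases rule: vertex_cases)
      case 1
      then show ?thesis using f by (simp add: p of_sol_low Lam_def)
    next
      case 2
      then have "l = 0 \<or> l = 1" using True unfolding p by (auto simp: pe_iff)
      then show ?thesis using 2 Lam_4 Lam_0[of 4] by (auto simp: p of_sol_low)
    next
      case (3 k)
      have "l = 0 \<or> l = 1 + par (Suc k) (cl k) \<or> l = 1 + par k (cl k)"
        using yl(2) two_poles[of k] unfolding poles_def by blast
      moreover have "f (5 + 2 * k, 1 + par k (cl k)) = psum (to_sol f) k (cl k)"
        using Lam_top(1)[OF 3(1)] Lam_cur[of k "cl k"] 3 by simp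
      moreover have "f (5 + 2 * k, 1 + par (Suc k) (cl k)) = psum (to_sol f) (Suc k) (cl k)"
        using Lam_top(2)[OF 3(1)] Lam_cur[of "Suc k" "cl k"] 3 by simp
      ultimately show ?thesis
        using 3 of_sol_top(1,2)[OF 3(1)] Lam_0[of y]
        by (auto simp: p of_sol_pole0 simp del: par.simps psum.simps)
    next
      case (4 k)
      have "l = 0 \<or> l = 1 + par (Suc k) (cl k)"
        using cur_pole[of "Suc k" "cl k" l] True 4 by (simp add: p)
      moreover have "f (6 + 2 * k, 1 + par (Suc k) (cl k)) = psum (to_sol f) (Suc k) (cl k)"
        using Lam_cur[of "Suc k" "cl k"] 4 by simp
      ultimately show ?thesis
        using 4 of_sol_top(3)[OF 4(1)] Lam_0[of y]
        by (auto simp: p of_sol_pole0 simp del: par.simps psum.simps)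
    next
      case 5
      then have "y \<in> rowv m ` (rw ` {..<m})"
        using \<open>y < nv\<close> bij_betw_imp_surj_on[OF rowv_bij[of m]] by (simp add: nv_def)
      then obtain k where k: "k < m" "y = rowv m (rw k)" by blast
      have "f (y, mainpole y) = 0" using f yl by (simp add: Lam_def)
      then have "f (y, 1) = 0" using 5 by (simp add: mainpole_def)
      moreover have "f (y, 2) = to_sol f (rw k)" using k by (simp add: to_sol_def)
      moreover have "l = 1 \<or> l = 2" using True 5 unfolding p by (auto simp: pe_iff)
      ultimately show ?thesis using of_sol_row[OF k(1)] k(2) by (auto simp: p)
    qed
  qed (rule out)
qed

end

lemma to_of_sol: "x \<in> sols \<Longrightarrow> to_sol (of_sol x) = x"
proof
  fix i assume x: "x \<in> sols"
  show "to_sol (of_sol x) i = x i"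
  proof (cases "i \<in> fst ` set es")
    case True
    then obtain k where "k < m" "i = rw k" unfolding rows_eq [symmetric] by blast
    then show ?thesis using of_sol_row(2)[of k x] by (simp add: to_sol_def)
  next
    case False
    then show ?thesis using x functions_onD[OF _ False, of x] by (simp add: to_sol_def sols_def)
  qed
qed

theorem card_homology: "card (carrier (homology 1 K)) = card sols"
proof -
  have "bij_betw to_sol Lam sols"
    by (rule bij_betw_byWitness[where f' = of_sol])
      (use of_to_sol to_of_sol to_sol_in of_sol_in in blast)+
  then show ?thesis
    using card_homology_clique_complex bij_betw_same_card by simp
qed

end

section \<open>Executing real RAM programs\<close>

text \<open>Weakest preconditions for loop-free programs. Loops yield \<open>False\<close>, as they
  are treated by \<open>runs_while\<close> with an invariant.\<close>

fun wp :: "(nat \<Rightarrow> nat \<Rightarrow> real) \<Rightarrow> prog \<Rightarrow> (state \<Rightarrow> bool) \<Rightarrow> state \<Rightarrow> bool" where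
  "wp orc Skip Q s = Q s"
| "wp orc (Const x q) Q (r, a) = Q (r(x := of_rat q), a)"
| "wp orc (Arith x f y z) Q (r, a) = Q (r(x := apply_op f (r y) (r z)), a)"
| "wp orc (Load x b y) Q (r, a) = (\<exists>i. r y = real i \<and> Q (r(x := a b i), a))"
| "wp orc (Store b y x) Q (r, a) = (\<exists>i. r y = real i \<and> Q (r, a(b := (a b)(i := r x))))"
| "wp orc (Query x y z) Q (r, a) = (\<exists>i j. r y = real i \<and> r z = real j \<and> Q (r(x := orc i j), a))"
| "wp orc (Seq p p') Q s = wp orc p (wp orc p' Q) s"
| "wp orc (IfLess x y p p') Q (r, a) = (if r x < r y then wp orc p Q (r, a) else wp orc p' Q (r, a))"
| "wp orc (WhileLess x y p) Q s = False"

text \<open>Bounds the time of loop-free programs only; the time spent in loops is accounted for by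
  \<open>runs_while\<close>.\<close>

fun cost :: "prog \<Rightarrow> nat" where
  "cost (Seq p p') = cost p + cost p'"
| "cost (IfLess x y p p') = Suc (max (cost p) (cost p'))"
| "cost p = 1"

definition runs :: "(nat \<Rightarrow> nat \<Rightarrow> real) \<Rightarrow> prog \<Rightarrow> nat \<Rightarrow> (state \<Rightarrow> bool) \<Rightarrow> state \<Rightarrow> bool" where
  "runs orc p c Q s \<longleftrightarrow> (\<exists>t s'. exec orc p s t s' \<and> t \<le> c \<and> Q s')"

lemma runsI: "exec orc p s t s' \<Longrightarrow> t \<le> c \<Longrightarrow> Q s' \<Longrightarrow> runs orc p c Q s"
  unfolding runs_def by blast

lemma runs_mono:
  "runs orc p c Q s \<Longrightarrow> c \<le> c' \<Longrightarrow> (\<And>s'. Q s' \<Longrightarrow> Q' s') \<Longrightarrow> runs orc p c' Q' s"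
  unfolding runs_def by (meson order_trans)

lemma runs_Seq:
  "runs orc p c Q s \<Longrightarrow> (\<And>s'. Q s' \<Longrightarrow> runs orc p' c' Q' s') \<Longrightarrow> runs orc (Seq p p') (c + c') Q' s"
  unfolding runs_def by (meson add_mono exec.Seq)

lemma wp_runs: "wp orc p Q s \<Longrightarrow> runs orc p (cost p) Q s"
proof (induction p arbitrary: Q s)
  case (Seq p p')
  then have "runs orc p (cost p) (wp orc p' Q) s" by simp
  then show ?case using runs_Seq[of orc p "cost p" "wp orc p' Q" s p' "cost p'" Q] Seq.IH(2) by simp
next
  case (IfLess x y p p')
  obtain r a where s: "s = (r, a)" by force
  show ?case
  proof (cases "r x < r y")
    case True
    then have "runs orc p (cost p) Q s" using IfLess by (simp add: s)
    then obtain t s' where "exec orc p s t s'" "t \<le> cost p" "Q s'" unfolding runs_def by blast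
    moreover then have "exec orc (IfLess x y p p') s (Suc t) s'" using True by (simp add: s exec.IfTrue)
    ultimately show ?thesis by (auto intro: runsI)
  next
    case False
    then have "runs orc p' (cost p') Q s" using IfLess by (simp add: s)
    then obtain t s' where "exec orc p' s t s'" "t \<le> cost p'" "Q s'" unfolding runs_def by blast
    moreover then have "exec orc (IfLess x y p p') s (Suc t) s'" using False by (simp add: s exec.IfFalse)
    ultimately show ?thesis by (auto intro: runsI)
  qed
qed (cases s; auto simp: runs_def intro: exec.intros)+

text \<open>\<open>P i\<close> is the invariant after \<open>i\<close> iterations. Every iteration
  pays one step for the test besides the body, and the failing test at the end pays the last
  step.\<close>

lemma runs_while:
  assumes step: "\<And>i s. i < n \<Longrightarrow> P i s \<Longrightarrow> fst s x < fst s y \<and> runs orc p c (P (Suc i)) s"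
    and stop: "\<And>s. P n s \<Longrightarrow> \<not> fst s x < fst s y"
    and start: "P 0 s"
  shows "runs orc (WhileLess x y p) (n * Suc c + 1) (P n) s"
proof -
  have "runs orc (WhileLess x y p) (k * Suc c + 1) (P n) s" if "k \<le> n" "P (n - k) s" for k s
    using that
  proof (induction k arbitrary: s)
    case 0
    obtain r a where s: "s = (r, a)" by force
    then have "exec orc (WhileLess x y p) s 1 s"
      using stop[of s] 0 exec.WhileFalse[of r x y orc p a] by simp
    then show ?case using 0 by (auto intro: runsI)
  next
    case (Suc k)
    obtain r a where s: "s = (r, a)" by force
    have k: "n - Suc k < n" "Suc (n - Suc k) = n - k" using Suc.prems by auto
    have less: "r x < r y" and "runs orc p c (P (n - k)) s"
      using step[OF k(1) Suc.prems(2)] by (simp_all add: s k(2))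
    then obtain t s' where 1: "exec orc p s t s'" "t \<le> c" "P (n - k) s'"
      unfolding runs_def by blast
    obtain t' s'' where 2: "exec orc (WhileLess x y p) s' t' s''" "t' \<le> k * Suc c + 1" "P n s''"
      using Suc.IH[OF _ 1(3)] Suc.prems unfolding runs_def by auto
    have "exec orc (WhileLess x y p) s (Suc (t + t')) s''"
      using exec.WhileTrue[OF less _ 2(1)] 1(1) by (simp add: s)
    moreover have "Suc (t + t') \<le> Suc k * Suc c + 1" using 1 2 by simp
    ultimately show ?case unfolding runs_def using 2(3) by blast
  qed
  then show ?thesis using start by (metis diff_self_eq_0 order_refl)
qed

section \<open>Simulating a program under a different oracle\<close>

primrec cells_below :: "nat \<Rightarrow> prog \<Rightarrow> bool" where
  "cells_below K Skip \<longleftrightarrow> True"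
| "cells_below K (Const x q) \<longleftrightarrow> x < K"
| "cells_below K (Arith x f y z) \<longleftrightarrow> x < K \<and> y < K \<and> z < K"
| "cells_below K (Load x b y) \<longleftrightarrow> x < K \<and> b < K \<and> y < K"
| "cells_below K (Store b y x) \<longleftrightarrow> x < K \<and> b < K \<and> y < K"
| "cells_below K (Query x y z) \<longleftrightarrow> x < K \<and> y < K \<and> z < K"
| "cells_below K (Seq p p') \<longleftrightarrow> cells_below K p \<and> cells_below K p'"
| "cells_below K (IfLess x y p p') \<longleftrightarrow> x < K \<and> y < K \<and> cells_below K p \<and> cells_below K p'"
| "cells_below K (WhileLess x y p) \<longleftrightarrow> x < K \<and> y < K \<and> cells_below K p"

lemma cells_below_mono: "cells_below K p \<Longrightarrow> K \<le> K' \<Longrightarrow> cells_below K' p"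
  by (induction p) auto

lemma cells_below_exists: "\<exists>K. cells_below K p"
proof (induction p)
  case (Const x q)
  show ?case by (auto intro: lessI)
next
  case (Arith x f y z)
  show ?case by (rule exI[of _ "Suc (x + y + z)"]) simp
next
  case (Load x b y)
  show ?case by (rule exI[of _ "Suc (x + y + b)"]) simp
next
  case (Store b y x)
  show ?case by (rule exI[of _ "Suc (x + y + b)"]) simp
next
  case (Query x y z)
  show ?case by (rule exI[of _ "Suc (x + y + z)"]) simp
next
  case (Seq p p')
  then obtain K K' where "cells_below K p" "cells_below K' p'" by blast
  then show ?case by (auto intro!: exI[of _ "max K K'"] elim: cells_below_mono)
next
  case (IfLess x y p p')
  then obtain K K' where "cells_below K p" "cells_below K' p'" by blast
  then show ?case by (auto intro!: exI[of _ "Suc (x + y + K + K')"] elim: cells_below_mono)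
next
  case (WhileLess x y p)
  then obtain K where "cells_below K p" by blast
  then show ?case by (auto intro!: exI[of _ "Suc (x + y + K)"] elim: cells_below_mono)
qed auto

primrec replace_query :: "(nat \<Rightarrow> nat \<Rightarrow> nat \<Rightarrow> prog) \<Rightarrow> prog \<Rightarrow> prog" where
  "replace_query f Skip = Skip"
| "replace_query f (Const x q) = Const x q"
| "replace_query f (Arith x g y z) = Arith x g y z"
| "replace_query f (Load x b y) = Load x b y"
| "replace_query f (Store b y x) = Store b y x"
| "replace_query f (Query x y z) = f x y z"
| "replace_query f (Seq p p') = Seq (replace_query f p) (replace_query f p')"
| "replace_query f (IfLess x y p p') = IfLess x y (replace_query f p) (replace_query f p')"
| "replace_query f (WhileLess x y p) = WhileLess x y (replace_query f p)"

definition agree :: "nat \<Rightarrow> state \<Rightarrow> state \<Rightarrow> bool" where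
  "agree K s S \<longleftrightarrow> (\<forall>x<K. fst s x = fst S x) \<and> (\<forall>b<K. snd s b = snd S b)"

text \<open>Lockstep simulation: the original program touches only cells below \<open>K\<close>, so
  \<open>Inv\<close>, which describes the reserved memory, survives its writes. Each of its steps
  costs at most \<open>c\<close>, queries included.\<close>

lemma replace_query_runs:
  assumes "exec orc p s t s'" and "cells_below K p" and "agree K s S" and "Inv S"
    and inv_reg: "\<And>r a x v. x < K \<Longrightarrow> Inv (r, a) \<Longrightarrow> Inv (r(x := v), a)"
    and inv_arr: "\<And>r a b w. b < K \<Longrightarrow> Inv (r, a) \<Longrightarrow> Inv (r, a(b := w))"
    and query: "\<And>x y z i j r a. x < K \<Longrightarrow> y < K \<Longrightarrow> z < K \<Longrightarrow> Inv (r, a) \<Longrightarrow> r y = real i \<Longrightarrow> r z = real j \<Longrightarrow>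
      runs orc' (f x y z) c (\<lambda>S'. Inv S' \<and> agree K (r(x := orc i j), a) S') (r, a)"
    and c: "1 \<le> c"
  shows "runs orc' (replace_query f p) (c * t) (\<lambda>S'. agree K s' S' \<and> Inv S') S"
  using assms(1-4)
proof (induction arbitrary: S)
  case (Skip s)
  then show ?case using c exec.Skip[of orc' S] by (auto intro: runsI)
next
  case (Const x q r a)
  obtain R A where S: "S = (R, A)" by force
  have "exec orc' (Const x q) S 1 (R(x := of_rat q), A)" unfolding S by (rule exec.Const)
  moreover have "agree K (r(x := of_rat q), a) (R(x := of_rat q), A)" "Inv (R(x := of_rat q), A)"
    using Const inv_reg by (auto simp: agree_def S)
  ultimately show ?case using c by (auto intro: runsI)
next
  case (Arith x g y z r a)
  obtain R A where S: "S = (R, A)" by force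
  let ?v = "apply_op g (R y) (R z)"
  have "exec orc' (Arith x g y z) S 1 (R(x := ?v), A)" unfolding S by (rule exec.Arith)
  moreover have "agree K (r(x := apply_op g (r y) (r z)), a) (R(x := ?v), A)" "Inv (R(x := ?v), A)"
    using Arith inv_reg by (auto simp: agree_def S)
  ultimately show ?case using c by (auto intro: runsI)
next
  case (Load r y i x b a)
  obtain R A where S: "S = (R, A)" by force
  have "R y = real i" using Load by (simp add: agree_def S)
  then have "exec orc' (Load x b y) S 1 (R(x := A b i), A)" unfolding S by (rule exec.Load)
  moreover have "agree K (r(x := a b i), a) (R(x := A b i), A)" "Inv (R(x := A b i), A)"
    using Load inv_reg by (auto simp: agree_def S)
  ultimately show ?case using c by (auto intro: runsI)
next
  case (Store r y i b x a)
  obtain R A where S: "S = (R, A)" by force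
  let ?A = "A(b := (A b)(i := R x))"
  have "R y = real i" using Store by (simp add: agree_def S)
  then have "exec orc' (Store b y x) S 1 (R, ?A)" unfolding S by (rule exec.Store)
  moreover have "agree K (r, a(b := (a b)(i := r x))) (R, ?A)" "Inv (R, ?A)"
    using Store inv_arr by (auto simp: agree_def S)
  ultimately show ?case using c by (auto intro: runsI)
next
  case (Query r y i z j x a)
  obtain R A where S: "S = (R, A)" by force
  have "R y = real i" "R z = real j" "x < K" "y < K" "z < K" "Inv (R, A)"
    using Query by (auto simp: agree_def S)
  then have run: "runs orc' (f x y z) c (\<lambda>S'. Inv S' \<and> agree K (R(x := orc i j), A) S') (R, A)"
    using query by blast
  have "agree K (r(x := orc i j), a) S'" if "agree K (R(x := orc i j), A) S'" for S'
    using that Query by (auto simp: agree_def S)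
  then show ?case unfolding S replace_query.simps by (intro runs_mono[OF run]) auto
next
  case (Seq p s t s' p' t' s'')
  have "runs orc' (replace_query f p) (c * t) (\<lambda>S'. agree K s' S' \<and> Inv S') S"
    using Seq by simp
  then have "runs orc' (Seq (replace_query f p) (replace_query f p')) (c * t + c * t')
      (\<lambda>S'. agree K s'' S' \<and> Inv S') S"
    by (rule runs_Seq) (use Seq in simp)
  then show ?case by (simp add: distrib_left)
next
  case (IfTrue r x y p a t s' p')
  obtain R A where S: "S = (R, A)" by force
  have "R x < R y" using IfTrue by (simp add: agree_def S)
  moreover have "runs orc' (replace_query f p) (c * t) (\<lambda>S'. agree K s' S' \<and> Inv S') S"
    using IfTrue by simp
  then obtain t' S' where "exec orc' (replace_query f p) S t' S'" "t' \<le> c * t" "agree K s' S'" "Inv S'"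
    unfolding runs_def by blast
  ultimately have "exec orc' (IfLess x y (replace_query f p) (replace_query f p')) S (Suc t') S'"
    by (simp add: S exec.IfTrue)
  moreover have "Suc t' \<le> c * Suc t" using \<open>t' \<le> c * t\<close> c by simp
  ultimately show ?case using \<open>agree K s' S'\<close> \<open>Inv S'\<close> unfolding runs_def replace_query.simps by blast
next
  case (IfFalse r x y p' a t s' p)
  obtain R A where S: "S = (R, A)" by force
  have "\<not> R x < R y" using IfFalse by (simp add: agree_def S)
  moreover have "runs orc' (replace_query f p') (c * t) (\<lambda>S'. agree K s' S' \<and> Inv S') S"
    using IfFalse by simp
  then obtain t' S' where "exec orc' (replace_query f p') S t' S'" "t' \<le> c * t" "agree K s' S'" "Inv S'"
    unfolding runs_def by blast
  ultimately have "exec orc' (IfLess x y (replace_query f p) (replace_query f p')) S (Suc t') S'"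
    by (simp add: S exec.IfFalse)
  moreover have "Suc t' \<le> c * Suc t" using \<open>t' \<le> c * t\<close> c by simp
  ultimately show ?case using \<open>agree K s' S'\<close> \<open>Inv S'\<close> unfolding runs_def replace_query.simps by blast
next
  case (WhileFalse r x y p a)
  obtain R A where S: "S = (R, A)" by force
  have "\<not> R x < R y" using WhileFalse by (simp add: agree_def S)
  then have "exec orc' (WhileLess x y (replace_query f p)) S 1 S"
    unfolding S by (rule exec.WhileFalse)
  then show ?case using WhileFalse c by (auto intro: runsI)
next
  case (WhileTrue r x y p a t s' t' s'')
  obtain R A where S: "S = (R, A)" by force
  have less: "R x < R y" using WhileTrue by (simp add: agree_def S)
  have "runs orc' (replace_query f p) (c * t) (\<lambda>S'. agree K s' S' \<and> Inv S') S"
    using WhileTrue by simp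
  then obtain u S' where 1: "exec orc' (replace_query f p) S u S'" "u \<le> c * t" "agree K s' S'" "Inv S'"
    unfolding runs_def by blast
  from WhileTrue.IH(2)[OF WhileTrue.prems(1) 1(3,4)]
  obtain u' S'' where 2: "exec orc' (WhileLess x y (replace_query f p)) S' u' S''" "u' \<le> c * t'"
      "agree K s'' S''" "Inv S''"
    unfolding runs_def replace_query.simps by blast
  have "exec orc' (WhileLess x y (replace_query f p)) S (Suc (u + u')) S''"
    using exec.WhileTrue[OF less _ 2(1)] 1(1) by (simp add: S)
  moreover have "Suc (u + u') \<le> c * Suc (t + t')" using 1(2) 2(2) c by (simp add: distrib_left)
  ultimately show ?case using 2(3,4) unfolding runs_def replace_query.simps by blast
qed

section \<open>Bounding the size of the output\<close>

definition nonzero_cells :: "state \<Rightarrow> (nat \<times> nat) set" where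
  "nonzero_cells s = {(b, i). snd s b i \<noteq> 0}"

lemma exec_nonzero_cells:
  assumes "exec orc p s t s'" "finite (nonzero_cells s)"
  shows "finite (nonzero_cells s') \<and> card (nonzero_cells s') \<le> card (nonzero_cells s) + t"
  using assms
proof induction
  case (Store r y i b x a)
  have *: "nonzero_cells (r, a(b := (a b)(i := r x))) \<subseteq> insert (b, i) (nonzero_cells (r, a))"
    by (auto simp: nonzero_cells_def split: if_splits)
  then have "finite (nonzero_cells (r, a(b := (a b)(i := r x))))"
    using Store by (meson finite.insertI finite_subset)
  moreover have "card (nonzero_cells (r, a(b := (a b)(i := r x)))) \<le> card (insert (b, i) (nonzero_cells (r, a)))"
    using * Store by (intro card_mono) auto
  moreover have "\<dots> \<le> card (nonzero_cells (r, a)) + 1"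
    using Store by (simp add: card_insert_if)
  ultimately show ?case by simp
qed (auto simp: nonzero_cells_def)

text \<open>Unwritten cells are zero, and a pair of zeros is not a bar.\<close>

lemma output_size_le_time:
  assumes "exec orc p (input_state xs) t s" "outputs_barcode s B"
  shows "size B \<le> t"
proof -
  obtain k where k: "fst s 0 = real k" "B = mset (map (\<lambda>i. (snd s 0 i, ereal (snd s 1 i))) [0..<k])"
    "is_barcode B" using assms(2) unfolding outputs_barcode_def by blast
  have "nonzero_cells (input_state xs) = {}" by (simp add: nonzero_cells_def input_state_def)
  then have nz: "finite (nonzero_cells s)" "card (nonzero_cells s) \<le> t"
    using exec_nonzero_cells[OF assms(1)] by auto
  have "{..<k} \<subseteq> snd ` nonzero_cells s"
  proof
    fix i assume "i \<in> {..<k}"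
    then have "(snd s 0 i, ereal (snd s 1 i)) \<in># B" using k(2) by auto
    then have "snd s 0 i < snd s 1 i" using k(3) unfolding is_barcode_def by fastforce
    then have "(0, i) \<in> nonzero_cells s \<or> (1, i) \<in> nonzero_cells s" by (auto simp: nonzero_cells_def)
    then show "i \<in> snd ` nonzero_cells s" by force
  qed
  then have "k \<le> card (snd ` nonzero_cells s)" using nz(1) card_mono[of "snd ` nonzero_cells s" "{..<k}"] by simp
  also have "\<dots> \<le> t" using card_image_le[OF nz(1), of snd] nz(2) by simp
  finally show ?thesis using k(2) by simp
qed

section \<open>The reduction\<close>

definition seqs :: "prog list \<Rightarrow> prog" where
  "seqs ps = foldr Seq ps Skip"

lemma wp_seqs [simp]: "wp orc (seqs []) Q s = Q s" "wp orc (seqs (p # ps)) Q s = wp orc p (wp orc (seqs ps) Q) s"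
  by (simp_all add: seqs_def)

lemma runs_seqs_Nil: "Q s \<Longrightarrow> runs orc (seqs []) 1 Q s"
  using wp_runs[of orc Skip Q s] by (simp add: seqs_def)

lemma runs_seqs:
  "runs orc p c Q s \<Longrightarrow> (\<And>s'. Q s' \<Longrightarrow> runs orc (seqs ps) c' Q' s') \<Longrightarrow> runs orc (seqs (p # ps)) (c + c') Q' s"
  using runs_Seq[of orc p c Q s "seqs ps"] by (simp add: seqs_def)

text \<open>The registers and arrays from \<open>L\<close> on are reserved for the reduction; those below belong to the
  simulated algorithm. Arrays \<open>L + 4\<close>, \<open>L + 5\<close>, \<open>L + 6\<close> hold \<open>rowv\<close>, \<open>cur - 4\<close> and \<open>par\<close>; the
  offset makes the initial values zero. Array \<open>L + 3\<close> holds \<open>- 1 / 2\<close> at the addresses \<open>u * n + v\<close> of the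
  edges and loops, each edge in one direction only. Hence the distance of \<open>u\<close> and \<open>v\<close> is 1 plus the
  entries for \<open>(u, v)\<close> and \<open>(v, u)\<close>.\<close>

abbreviation (input) "rM L \<equiv> L + (10::nat)"
abbreviation (input) "rN L \<equiv> L + (11::nat)"
abbreviation (input) "rK L \<equiv> L + (12::nat)"
abbreviation (input) "rU L \<equiv> L + (13::nat)"
abbreviation (input) "rV L \<equiv> L + (14::nat)"
abbreviation (input) "rI L \<equiv> L + (15::nat)"
abbreviation (input) "rJ L \<equiv> L + (16::nat)"
abbreviation (input) "rB L \<equiv> L + (17::nat)"
abbreviation (input) "rC L \<equiv> L + (18::nat)"
abbreviation (input) "rP L \<equiv> L + (19::nat)"
abbreviation (input) "rNB L \<equiv> L + (20::nat)"
abbreviation (input) "rH L \<equiv> L + (21::nat)"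
abbreviation (input) "rT L \<equiv> L + (22::nat)"
abbreviation (input) "r0 L \<equiv> L + (23::nat)"
abbreviation (input) "r1 L \<equiv> L + (24::nat)"
abbreviation (input) "r2 L \<equiv> L + (25::nat)"
abbreviation (input) "r3 L \<equiv> L + (26::nat)"
abbreviation (input) "r4 L \<equiv> L + (27::nat)"
abbreviation (input) "rBase L \<equiv> L + (28::nat)"
abbreviation (input) "rCnt L \<equiv> L + (29::nat)"
abbreviation (input) "rX L \<equiv> L + (30::nat)"
abbreviation (input) "rY L \<equiv> L + (31::nat)"

section \<open>The programs of the reduction\<close>

definition set_edges :: "nat \<Rightarrow> (nat \<times> nat) list \<Rightarrow> prog" where
  "set_edges L xs = seqs (map (\<lambda>(x, y).
     seqs [Arith (rT L) Mul x (rN L), Arith (rT L) Add (rT L) y, Store (L + 3) (rT L) (rH L)]) xs)"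

definition edge_array :: "nat \<Rightarrow> (nat \<times> nat) set \<Rightarrow> nat \<Rightarrow> real" where
  "edge_array n E = (\<lambda>i. if \<exists>(u, v)\<in>E. i = u * n + v then - 1 / 2 else 0)"

lemma edge_array_insert: "edge_array n (insert (u, v) E) = (edge_array n E)(u * n + v := - 1 / 2)"
  by (auto simp: edge_array_def fun_eq_iff)

lemma edge_array_nth:
  assumes "E \<subseteq> {..<n} \<times> {..<n}" "u < n" "v < n"
  shows "edge_array n E (u * n + v) = (if (u, v) \<in> E then - 1 / 2 else 0)"
proof -
  have "u' = u \<and> v' = v" if "u * n + v = u' * n + v'" "v' < n" for u' v'
  proof -
    have "(u * n + v) div n = u" "(u * n + v) mod n = v" using assms by simp_all
    moreover have "(u' * n + v') div n = u'" "(u' * n + v') mod n = v'" using that(2) by simp_all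
    ultimately show ?thesis using that(1) by metis
  qed
  then show ?thesis using assms unfolding edge_array_def by fastforce
qed

text \<open>\<open>val\<close> tells which vertex a register holds. The address register
  \<open>rT\<close> is overwritten for each edge and so may not be an operand.\<close>

lemma wp_set_edges:
  assumes val: "\<forall>(x, y)\<in>set xs. r x = real (val x) \<and> r y = real (val y) \<and> x \<noteq> rT L \<and> y \<noteq> rT L"
    and N: "r (rN L) = real n" and H: "r (rH L) = - 1 / 2" and A: "a (L + 3) = edge_array n E"
    and Q: "\<And>t. Q (r(rT L := t), a(L + 3 := edge_array n (E \<union> (\<lambda>(x, y). (val x, val y)) ` set xs)))"
  shows "wp orc (set_edges L xs) Q (r, a)"
  using assms
proof (induction xs arbitrary: r a E)
  case Nil
  have "Q (r(rT L := r (rT L)), a(L + 3 := a (L + 3)))"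
    using Nil(5)[of "r (rT L)"] unfolding Nil(4) by (simp only: list.set image_empty Un_empty_right)
  then show ?case by (simp only: set_edges_def list.map wp_seqs fun_upd_triv)
next
  case (Cons p xs)
  obtain x y where p: "p = (x, y)" by force
  have xy: "r x = real (val x)" "r y = real (val y)" "x \<noteq> rT L" "y \<noteq> rT L"
    using Cons.prems(1) by (simp_all add: p)
  let ?i = "val x * n + val y"
  let ?r = "r(rT L := real ?i)" and ?a = "a(L + 3 := edge_array n (insert (val x, val y) E))"
  have "wp orc (set_edges L xs) Q (?r, ?a)"
  proof (rule Cons.IH)
    show "\<forall>(x, y)\<in>set xs. ?r x = real (val x) \<and> ?r y = real (val y) \<and> x \<noteq> rT L \<and> y \<noteq> rT L"
      using Cons.prems(1) by auto
  next
    show "?r (rN L) = real n" "?r (rH L) = - 1 / 2" using Cons.prems by simp_all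
    show "?a (L + 3) = edge_array n (insert (val x, val y) E)" by simp
    show "Q (?r(rT L := t), ?a(L + 3 := edge_array n
        (insert (val x, val y) E \<union> (\<lambda>(x, y). (val x, val y)) ` set xs)))" for t
      using Cons.prems(5)[of t]
      by (simp only: p list.set image_insert prod.case Un_insert_left Un_insert_right fun_upd_upd)
  qed
  moreover have "real (val x) * real n + real (val y) = real ?i" by simp
  ultimately show ?case
    using xy Cons.prems(2-4)
    by (simp add: set_edges_def p edge_array_insert del: of_nat_add of_nat_mult)
qed

text \<open>\<open>rN\<close> receives the stride \<open>5 + 3 * m\<close>, an upper bound for the
  number of vertices that is available before the nonempty rows are counted. The stored pairs are
  the edges and loops present without any entry.\<close>

definition init_prog :: "nat \<Rightarrow> prog" where
  "init_prog L = seqs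
    [Const (r0 L) 0, Const (r1 L) 1, Const (r2 L) 2, Const (r3 L) 3, Const (r4 L) 4, Const (rH L) (- 1 / 2),
     Arith (rM L) Add 0 (r0 L), Const (rT L) 5, Arith (rBase L) Add (rM L) (rM L),
     Arith (rBase L) Add (rBase L) (rT L), Arith (rN L) Add (rBase L) (rM L),
     Arith (rNB L) Add (rBase L) (r0 L), Const (rU L) 5, Const (rV L) 6, Const (rK L) 0,
     set_edges L [(r3 L, r0 L), (r3 L, r1 L), (r3 L, r2 L), (r4 L, r0 L), (r4 L, r1 L), (r3 L, r4 L),
       (r0 L, r0 L), (r1 L, r1 L), (r2 L, r2 L), (r3 L, r3 L), (r4 L, r4 L)]]"

text \<open>The initial value 0 in array \<open>L + 4\<close> marks a row as new; it then receives
  the next free number from \<open>rNB\<close>.\<close>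

definition row_prog :: "nat \<Rightarrow> prog" where
  "row_prog L = seqs
    [Query (rI L) (rK L) (r0 L), Query (rJ L) (rK L) (r1 L), Load (rB L) (L + 4) (rI L),
     IfLess (r0 L) (rB L) Skip
       (seqs [Arith (rB L) Add (rNB L) (r0 L), Store (L + 4) (rI L) (rB L), Arith (rNB L) Add (rNB L) (r1 L),
          set_edges L [(rB L, r1 L), (rB L, r2 L), (rB L, rB L)]])]"

text \<open>The vertex of the previous sum is fetched and joined before the vertex in
  \<open>rV\<close> replaces it. \<open>rP\<close> first becomes the flipped parity and then the
  pole belonging to it.\<close>

definition entry_prog :: "nat \<Rightarrow> prog" where
  "entry_prog L = seqs
    [Load (rC L) (L + 5) (rJ L), Arith (rC L) Add (rC L) (r4 L), Load (rP L) (L + 6) (rJ L),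
     Arith (rP L) Sub (r1 L) (rP L), Store (L + 6) (rJ L) (rP L), Arith (rP L) Add (r1 L) (rP L),
     set_edges L [(rU L, r0 L), (rU L, r1 L), (rU L, r2 L), (rU L, rB L), (rU L, rC L), (rU L, rV L),
       (rU L, rU L), (rV L, rV L), (rV L, r0 L), (rV L, rP L)],
     Arith (rC L) Sub (rV L) (r4 L), Store (L + 5) (rJ L) (rC L), Arith (rU L) Add (rU L) (r2 L),
     Arith (rV L) Add (rV L) (r2 L), Arith (rK L) Add (rK L) (r1 L)]"

definition close_prog :: "nat \<Rightarrow> prog" where
  "close_prog L = seqs
    [Query (rJ L) (rK L) (r1 L), Load (rC L) (L + 5) (rJ L), Arith (rC L) Add (rC L) (r4 L),
     set_edges L [(r3 L, rC L)], Arith (rK L) Add (rK L) (r1 L)]"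

text \<open>A loop is found by both lookups, which gives distance 0. Arguments from
  \<open>nv\<close> on give 0, as in \<open>distance_oracle\<close>. The target \<open>x\<close> may
  coincide with \<open>y\<close> or \<open>z\<close>, so it is written last.\<close>

definition query_prog :: "nat \<Rightarrow> nat \<Rightarrow> nat \<Rightarrow> nat \<Rightarrow> prog" where
  "query_prog L x y z =
    IfLess y (rNB L) (IfLess z (rNB L)
      (seqs [Arith (rT L) Mul y (rN L), Arith (rT L) Add (rT L) z, Load (rT L) (L + 3) (rT L),
        Arith (rX L) Mul z (rN L), Arith (rX L) Add (rX L) y, Load (rX L) (L + 3) (rX L),
        Arith (rT L) Add (rT L) (rX L), Arith x Add (r1 L) (rT L)])
      (Const x 0)) (Const x 0)"

definition count_prog :: "nat \<Rightarrow> prog" where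
  "count_prog L = seqs
    [Load (rX L) 0 (rK L), Load (rY L) 1 (rK L), Arith (rX L) Add (rX L) (rT L),
     IfLess (rX L) (rY L) (Arith (rCnt L) Add (rCnt L) (r1 L)) Skip, Arith (rK L) Add (rK L) (r1 L)]"

text \<open>The simulated algorithm must start from its own input state: register 0 is set to the
  number of points, and the dimensions left in registers 1 and 2 are cleared. At the end,
  \<open>rNB - rBase\<close> is the number of nonempty rows.\<close>

definition rank_prog :: "nat \<Rightarrow> prog \<Rightarrow> prog" where
  "rank_prog L A = seqs
    [init_prog L,
     WhileLess (rK L) (rM L) (Seq (row_prog L) (entry_prog L)),
     Const (rK L) 0,
     WhileLess (rK L) (rM L) (close_prog L),
     seqs [Arith 0 Add (rNB L) (r0 L), Const 1 0, Const 2 0],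
     replace_query (query_prog L) A,
     seqs [Const (rK L) 0, Const (rCnt L) 0, Const (rT L) (1 / 8)],
     WhileLess (rK L) 0 (count_prog L),
     seqs [Arith 0 Sub (rNB L) (rBase L), Arith 0 Sub 0 (rCnt L)]]"

definition setup_cost :: "nat \<Rightarrow> nat" where
  "setup_cost L = cost (init_prog L) + cost (row_prog L) + cost (entry_prog L) + cost (close_prog L) + 30"

section \<open>Correctness of the programs\<close>

context entry_list
begin

definition loops :: "nat \<Rightarrow> (nat \<times> nat) set" where
  "loops k = Id_on ({..<5 + 2 * k} \<union> {5 + 2 * m..<5 + 2 * m + nrows k})"

abbreviation "stride \<equiv> 5 + 3 * m"

text \<open>The last clause prepares the input state of the simulated algorithm; registers 0, 1 and
  2 are exempt because they still hold the input of the reduction.\<close>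

definition const_regs :: "nat \<Rightarrow> (nat \<Rightarrow> real) \<Rightarrow> bool" where
  "const_regs L r \<longleftrightarrow> r (rM L) = real m \<and> r (rN L) = real stride \<and> r (rBase L) = real (5 + 2 * m) \<and>
     r (rH L) = - 1 / 2 \<and> r (r0 L) = 0 \<and> r (r1 L) = 1 \<and> r (r2 L) = 2 \<and> r (r3 L) = 3 \<and> r (r4 L) = 4 \<and>
     (\<forall>x<L. 3 \<le> x \<longrightarrow> r x = 0)"

definition array_state :: "nat \<Rightarrow> nat \<Rightarrow> (nat \<times> nat) set \<Rightarrow> (nat \<Rightarrow> nat \<Rightarrow> real) \<Rightarrow> bool" where
  "array_state L k E a \<longleftrightarrow> a (L + 3) = edge_array stride E \<and> a (L + 4) = (\<lambda>i. real (rowv k i)) \<and>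
     a (L + 5) = (\<lambda>j. real (cur k j - 4)) \<and> a (L + 6) = (\<lambda>j. real (par k j)) \<and> (\<forall>b<L. a b = (\<lambda>_. 0))"

definition entries_done :: "nat \<Rightarrow> nat \<Rightarrow> state \<Rightarrow> bool" where
  "entries_done L k s \<longleftrightarrow> const_regs L (fst s) \<and> fst s (rK L) = real k \<and> fst s (rU L) = real (5 + 2 * k) \<and>
     fst s (rV L) = real (6 + 2 * k) \<and> fst s (rNB L) = real (5 + 2 * m + nrows k) \<and>
     array_state L k (pe k \<union> ne k \<union> loops k) (snd s)"

text \<open>The state in the middle of an iteration: the rows are those after entry
  \<open>k\<close>, the column sums still those before it.\<close>

definition row_done :: "nat \<Rightarrow> nat \<Rightarrow> state \<Rightarrow> bool" where
  "row_done L k s \<longleftrightarrow> const_regs L (fst s) \<and> fst s (rK L) = real k \<and> fst s (rU L) = real (5 + 2 * k) \<and>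
     fst s (rV L) = real (6 + 2 * k) \<and> fst s (rNB L) = real (5 + 2 * m + nrows (Suc k)) \<and>
     fst s (rJ L) = real (cl k) \<and> fst s (rB L) = real (rowv (Suc k) (rw k)) \<and>
     snd s (L + 3) = edge_array stride (pe k \<union> ne k \<union> loops k \<union>
       (if rowv k (rw k) = 0 then let b = rowv (Suc k) (rw k) in {(b, 1), (b, 2), (b, b)} else {})) \<and>
     snd s (L + 4) = (\<lambda>i. real (rowv (Suc k) i)) \<and>
     snd s (L + 5) = (\<lambda>j. real (cur k j - 4)) \<and> snd s (L + 6) = (\<lambda>j. real (par k j)) \<and>
     (\<forall>b<L. snd s b = (\<lambda>_. 0))"

lemma loops_0: "loops 0 = {(0, 0), (1, 1), (2, 2), (3, 3), (4, 4)}"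
proof -
  have "{..<5::nat} = {0, 1, 2, 3, 4}" by auto
  then show ?thesis by (auto simp: loops_def nrows_def)
qed

lemma wp_init:
  assumes L: "3 \<le> L"
  shows "wp orc (init_prog L) (entries_done L 0) (input_state [m, nr, nc])"
proof -
  have half: "real_of_rat (- (1 / 2)) = - 1 / 2" by (simp add: of_rat_minus of_rat_divide)
  define val where "val = (\<lambda>x. if x = r1 L then 1 else if x = r2 L then 2 else if x = r3 L then 3
    else if x = r4 L then 4 else (0::nat))"
  have E: "pe 0 \<union> ne 0 \<union> loops 0 = {} \<union> (\<lambda>(x, y). (val x, val y)) `
    set [(r3 L, r0 L), (r3 L, r1 L), (r3 L, r2 L), (r4 L, r0 L), (r4 L, r1 L), (r3 L, r4 L),
       (r0 L, r0 L), (r1 L, r1 L), (r2 L, r2 L), (r3 L, r3 L), (r4 L, r4 L)]"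
    by (auto simp: pe_def ne_def loops_0 nrows_def val_def)
  show ?thesis
    unfolding init_prog_def input_state_def
    apply (simp add: half)
    apply (rule wp_set_edges[where val = val and n = stride and E = "{}"])
        apply (simp add: val_def)
       apply simp
      apply simp
     apply (simp add: edge_array_def fun_eq_iff)
    unfolding E[symmetric] using L
    apply (auto simp: entries_done_def const_regs_def array_state_def nrows_def fun_eq_iff nth_Cons split: nat.splits)
    done
qed

lemma wp_row:
  assumes s: "entries_done L k s" and k: "k < m"
  shows "wp (entry_oracle es) (row_prog L) (row_done L k) s"
proof -
  obtain r a where ra: "s = (r, a)" by force
  note e = s[unfolded ra entries_done_def const_regs_def array_state_def fst_conv snd_conv]
  have orc: "entry_oracle es k 0 = real (rw k)" "entry_oracle es k 1 = real (cl k)"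
    using k by (simp_all add: entry_oracle_def)
  show ?thesis
  proof (cases "rowv k (rw k) = 0")
    case True
    define b where "b = 5 + 2 * m + nrows k"
    have b: "rowv (Suc k) (rw k) = b" "nrows (Suc k) = Suc (nrows k)"
      using True by (simp_all add: nrows_Suc b_def)
    have rowv: "(\<lambda>i. real (rowv k i))(rw k := real b) = (\<lambda>i. real (rowv (Suc k) i))"
      using True by (auto simp: b_def)
    show ?thesis
      unfolding ra row_prog_def
      using e[folded b_def] True
      apply (simp add: orc rowv del: rowv.simps)
      apply (rule wp_set_edges[where val = "\<lambda>x. if x = rB L then b else if x = r1 L then 1 else 2"
            and n = stride and E = "pe k \<union> ne k \<union> loops k"])
          apply (simp del: rowv.simps)
         apply simp
        apply simp
       apply simp
      apply (simp add: row_done_def const_regs_def b Let_def del: rowv.simps)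
      apply (simp add: b_def)
      done
  next
    case False
    then have b: "rowv (Suc k) (rw k) = rowv k (rw k)" "nrows (Suc k) = nrows k" "rowv (Suc k) = rowv k"
      by (auto simp: nrows_Suc)
    show ?thesis
      unfolding ra row_prog_def
      using e False
      by (simp add: orc row_done_def const_regs_def b del: rowv.simps)
  qed
qed

lemma pe_Suc:
  "pe (Suc k) = pe k \<union> {(5 + 2 * k, 0), (5 + 2 * k, 1), (5 + 2 * k, 2), (6 + 2 * k, 0), (6 + 2 * k, 1 + par (Suc k) (cl k))} \<union>
     (if rowv k (rw k) = 0 then {(5 + 2 * m + nrows k, 1), (5 + 2 * m + nrows k, 2)} else {})"
  unfolding pe_def nrows_Suc
  by (cases "rowv k (rw k) = 0") (simp_all only: refl if_True if_False lessThan_Suc UN_insert Un_ac Un_empty_left Un_empty_right)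

lemma ne_Suc:
  "ne (Suc k) = ne k \<union> {(5 + 2 * k, rowv (Suc k) (rw k)), (5 + 2 * k, cur k (cl k)), (5 + 2 * k, 6 + 2 * k)}"
  unfolding ne_def by (simp only: lessThan_Suc UN_insert Un_ac)

lemma loops_Suc:
  "loops (Suc k) = loops k \<union> {(5 + 2 * k, 5 + 2 * k), (6 + 2 * k, 6 + 2 * k)} \<union>
     (if rowv k (rw k) = 0 then {(5 + 2 * m + nrows k, 5 + 2 * m + nrows k)} else {})"
proof -
  have "{..<5 + 2 * Suc k} = {..<5 + 2 * k} \<union> {5 + 2 * k, 6 + 2 * k}" by auto
  moreover have "{a..<Suc (a + n)} = insert (a + n) {a..<a + n}" for a n :: nat by auto
  ultimately show ?thesis unfolding loops_def nrows_Suc by (auto simp del: One_nat_def)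
qed

lemma wp_entry:
  assumes s: "row_done L k s"
  shows "wp orc (entry_prog L) (entries_done L (Suc k)) s"
proof -
  obtain r a where ra: "s = (r, a)" by force
  define b where "b = rowv (Suc k) (rw k)"
  define q where "q = par (Suc k) (cl k)"
  define c where "c = cur k (cl k)"
  define E where "E = pe k \<union> ne k \<union> loops k \<union> (if rowv k (rw k) = 0 then {(b, 1), (b, 2), (b, b)} else {})"
  note e = s[unfolded ra row_done_def const_regs_def fst_conv snd_conv Let_def, folded b_def, folded E_def]
  \<comment> \<open>The program subtracts reals, \<open>par\<close> and the stored
    \<open>cur\<close> natural numbers; the results agree because \<open>par\<close> is at most 1
    and \<open>cur\<close> at least 4.\<close>
  have q: "1 - real (par k (cl k)) = real q" "2 - real (par k (cl k)) = 1 + real q"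
    using par_le[of k "cl k"] by (simp_all add: q_def of_nat_diff)
  have c: "real (cur k (cl k) - 4) + 4 = real c"
    using cur_cases[of k "cl k"] by (auto simp: c_def of_nat_diff)
  have par: "(\<lambda>j. real (par k j))(cl k := real q) = (\<lambda>j. real (par (Suc k) j))"
    by (auto simp: q_def)
  have cur: "(\<lambda>j. real (cur k j - 4))(cl k := 2 + 2 * real k) = (\<lambda>j. real (cur (Suc k) j - 4))"
    by auto
  define val where "val = (\<lambda>x. if x = rU L then 5 + 2 * k else if x = rV L then 6 + 2 * k else if x = rB L then b
    else if x = rC L then c else if x = rP L then 1 + q else if x = r1 L then 1 else if x = r2 L then 2 else (0::nat))"
  have new: "b = 5 + 2 * m + nrows k" if "rowv k (rw k) = 0" using that by (simp add: b_def)
  have E': "pe (Suc k) \<union> ne (Suc k) \<union> loops (Suc k) = E \<union> (\<lambda>(x, y). (val x, val y)) `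
    set [(rU L, r0 L), (rU L, r1 L), (rU L, r2 L), (rU L, rB L), (rU L, rC L), (rU L, rV L),
       (rU L, rU L), (rV L, rV L), (rV L, r0 L), (rV L, rP L)]"
  proof -
    have "(\<lambda>(x, y). (val x, val y)) ` set [(rU L, r0 L), (rU L, r1 L), (rU L, r2 L), (rU L, rB L), (rU L, rC L),
        (rU L, rV L), (rU L, rU L), (rV L, rV L), (rV L, r0 L), (rV L, rP L)] =
      {(5 + 2 * k, 0), (5 + 2 * k, 1), (5 + 2 * k, 2), (5 + 2 * k, b), (5 + 2 * k, c), (5 + 2 * k, 6 + 2 * k),
        (5 + 2 * k, 5 + 2 * k), (6 + 2 * k, 6 + 2 * k), (6 + 2 * k, 0), (6 + 2 * k, 1 + q)}"
      by (simp add: val_def)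
    then show ?thesis
      unfolding pe_Suc ne_Suc loops_Suc E_def q_def [symmetric] b_def [symmetric] c_def [symmetric]
      using new by auto
  qed
  show ?thesis
    unfolding ra entry_prog_def
    using e
    apply (simp add: q c del: par.simps cur.simps rowv.simps)
    apply (rule wp_set_edges[where val = val and n = stride and E = E])
        apply (simp add: val_def del: par.simps cur.simps rowv.simps)
       apply simp
      apply simp
     apply simp
    unfolding E'[symmetric]
    apply (simp add: q c par cur entries_done_def const_regs_def array_state_def del: par.simps cur.simps rowv.simps)
    done
qed

definition closed :: "nat \<Rightarrow> nat \<Rightarrow> state \<Rightarrow> bool" where
  "closed L k s \<longleftrightarrow> const_regs L (fst s) \<and> fst s (rK L) = real k \<and> fst s (rNB L) = real nv \<and>
     array_state L m (pe m \<union> ne m \<union> loops m \<union> fe k) (snd s)"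

lemma wp_close:
  assumes s: "closed L k s" and k: "k < m"
  shows "wp (entry_oracle es) (close_prog L) (closed L (Suc k)) s"
proof -
  obtain r a where ra: "s = (r, a)" by force
  note e = s[unfolded ra closed_def const_regs_def array_state_def fst_conv snd_conv]
  have orc: "entry_oracle es k 1 = real (cl k)"
    using k by (simp add: entry_oracle_def)
  define c where "c = cur m (cl k)"
  have c: "real (cur m (cl k) - 4) + 4 = real c"
    using cur_cases[of m "cl k"] by (auto simp: c_def of_nat_diff)
  have fe: "fe (Suc k) = insert (3, c) (fe k)" by (auto simp: fe_def lessThan_Suc c_def)
  show ?thesis
    unfolding ra close_prog_def
    using e
    apply (simp add: orc c)
    apply (rule wp_set_edges[where val = "\<lambda>x. if x = rC L then c else 3" and n = stride
          and E = "pe m \<union> ne m \<union> loops m \<union> fe k"])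
        apply simp
       apply simp
      apply simp
     apply simp
    apply (simp add: closed_def const_regs_def array_state_def fe)
    done
qed

lemma nv_le_stride: "nv \<le> stride"
proof -
  have "nrows m \<le> m" using card_image_le[of "{..<m}" rw] by (simp add: nrows_def)
  then show ?thesis by (simp add: nv_def)
qed

text \<open>Stored edges lead from non-poles to poles or from tops to the rest, never both ways.
  Hence an edge is found by exactly one of the two lookups, and a loop by both.\<close>

lemma edge_array_metric:
  assumes "i < nv" "j < nv"
  defines "D \<equiv> edge_array stride (pe m \<union> ne m \<union> loops m \<union> fe m)"
  shows "1 + (D (i * stride + j) + D (j * stride + i)) = graph_metric adj i j"
proof -
  let ?E = "pe m \<union> ne m \<union> loops m \<union> fe m"
  have lt: "x < nv \<and> y < nv" if "(x, y) \<in> ?E" for x y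
    using that PE_D[of x y] NE_D[of x y] by (auto simp: loops_def nv_def)
  then have sub: "?E \<subseteq> {..<stride} \<times> {..<stride}"
    using nv_le_stride by fastforce
  have D: "D (x * stride + y) = (if (x, y) \<in> ?E then - 1 / 2 else 0)" if "x < nv" "y < nv" for x y
    unfolding D_def using that nv_le_stride by (intro edge_array_nth[OF sub]) auto
  define G where "G = pe m \<union> (ne m \<union> fe m)"
  have E: "(x, y) \<in> ?E \<longleftrightarrow> (x, y) \<in> G" if "x \<noteq> y" for x y
    using that by (auto simp: loops_def G_def)
  have G: "(y, x) \<notin> G" if "(x, y) \<in> G" for x y
    using that PE_D[of x y] NE_D[of x y] PE_D[of y x] NE_D[of y x] unfolding G_def by blast
  show ?thesis
  proof (cases "i = j")
    case True
    then have "(i, j) \<in> ?E" "(j, i) \<in> ?E" using assms by (auto simp: loops_def nv_def)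
    then show ?thesis unfolding D[OF assms(1,2)] D[OF assms(2,1)] using True by (simp add: graph_metric_def)
  next
    case False
    then show ?thesis
      unfolding D[OF assms(1,2)] D[OF assms(2,1)] E[OF False] E[OF False[symmetric]]
        graph_metric_def adj_def G_def [symmetric]
      using G[of i j] by simp
  qed
qed

text \<open>What the answers to queries and the final subtraction need. It lies in cells from
  \<open>L\<close> on, out of reach of the simulated algorithm.\<close>

definition graph_inv :: "nat \<Rightarrow> state \<Rightarrow> bool" where
  "graph_inv L s \<longleftrightarrow> fst s (rNB L) = real nv \<and> fst s (rN L) = real stride \<and> fst s (r1 L) = 1 \<and>
     fst s (rBase L) = real (5 + 2 * m) \<and>
     snd s (L + 3) = edge_array stride (pe m \<union> ne m \<union> loops m \<union> fe m)"

lemma cost_query_prog: "cost (query_prog L x y z) \<le> 11"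
  by (simp add: query_prog_def seqs_def)

lemma runs_query_prog:
  assumes xyz: "x < L" "y < L" "z < L" and inv: "graph_inv L (r, a)" and ij: "r y = real i" "r z = real j"
  shows "runs orc (query_prog L x y z) 11
    (\<lambda>S. graph_inv L S \<and> agree L (r(x := distance_oracle nv (graph_metric adj) i j), a) S) (r, a)"
proof (rule runs_mono[OF wp_runs cost_query_prog])
  let ?Q = "\<lambda>S. graph_inv L S \<and> agree L (r(x := distance_oracle nv (graph_metric adj) i j), a) S"
  have addr: "real i * (5 + 3 * real m) + real j = real (i * stride + j)"
    "real j * (5 + 3 * real m) + real i = real (j * stride + i)" by simp_all
  note e = inv[unfolded graph_inv_def fst_conv snd_conv]
  have ne: "y \<noteq> L + n" "z \<noteq> L + n" "x \<noteq> L + n" "L + n \<noteq> x" "L + n \<noteq> y" "L + n \<noteq> z" for n using xyz by auto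
  show "wp orc (query_prog L x y z) ?Q (r, a)"
  proof (cases "i < nv \<and> j < nv")
    case True
    then show ?thesis
      unfolding query_prog_def using e ij ne
      apply (simp add: addr edge_array_metric del: of_nat_add of_nat_mult)
      apply (auto simp: graph_inv_def agree_def distance_oracle_def ne)
      apply (rule exI[of _ "i * stride + j"], rule conjI, simp)
      apply (rule exI[of _ "j * stride + i"], rule conjI, simp)
      apply (rule impI, rule edge_array_metric[symmetric], assumption+)
      done
  next
    case False
    then show ?thesis
      unfolding query_prog_def using e ij ne
      by (auto simp: graph_inv_def agree_def distance_oracle_def ne)
  qed
qed

definition counted :: "nat \<Rightarrow> nat \<Rightarrow> (nat \<Rightarrow> nat \<Rightarrow> real) \<Rightarrow> nat \<Rightarrow> state \<Rightarrow> bool" where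
  "counted L k a i s \<longleftrightarrow> fst s 0 = real k \<and> fst s (rK L) = real i \<and> fst s (rT L) = 1 / 8 \<and> fst s (r1 L) = 1 \<and>
     fst s (rNB L) = real nv \<and> fst s (rBase L) = real (5 + 2 * m) \<and>
     fst s (rCnt L) = real (card {j. j < i \<and> a 0 j + 1 / 8 < a 1 j}) \<and> snd s = a"

lemma wp_count:
  assumes s: "counted L k a i s" and L: "3 \<le> L"
  shows "wp orc (count_prog L) (counted L k a (Suc i)) s"
proof -
  obtain r a' where ra: "s = (r, a')" by force
  note e = s[unfolded ra counted_def fst_conv snd_conv]
  let ?S = "\<lambda>i. {j. j < i \<and> a 0 j + 1 / 8 < a 1 j}"
  have S: "?S (Suc i) = (if a 0 i + 1 / 8 < a 1 i then insert i (?S i) else ?S i)"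
    by (auto simp: less_Suc_eq)
  have "card (?S (Suc i)) = (if a 0 i + 1 / 8 < a 1 i then card (?S i) + 1 else card (?S i))"
    unfolding S by simp
  then have card: "real (card (?S (Suc i))) =
      (if a 0 i + 1 / 8 < a 1 i then real (card (?S i)) + 1 else real (card (?S i)))"
    by simp
  show ?thesis
    unfolding ra count_prog_def using e L
    by (simp add: counted_def card)
qed

text \<open>The powers of two can be divided because \<open>card sols\<close> is positive, which
  bounds the rank by the number of nonempty rows.\<close>

lemma card_sols:
  assumes "M \<in> carrier_mat nr nc" "enumerates_nonzeros es M"
  obtains k where "card sols = 2 ^ k" "vec_space.rank nr M + k = nrows m"
proof -
  let ?r = "vec_space.rank nr M"
  have *: "2 ^ ?r * card sols = 2 ^ nrows m"
    using card_orthogonal_columns[OF assms] unfolding sols_def nrows_def rows_eq .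
  then have "card sols \<noteq> 0" by (intro notI) simp
  then have "2 ^ ?r * 1 \<le> 2 ^ ?r * card sols" by (intro mult_le_mono2) simp
  then have "(2::nat) ^ ?r \<le> 2 ^ nrows m" using * by simp
  then have le: "?r \<le> nrows m" by simp
  then have "(2::nat) ^ nrows m = 2 ^ ?r * 2 ^ (nrows m - ?r)" by (simp flip: power_add)
  then have "card sols = 2 ^ (nrows m - ?r)" using * by simp
  then show ?thesis using that le by simp
qed

lemma rank_prog_runs:
  assumes L: "3 \<le> L" "cells_below L A" and \<epsilon>: "\<epsilon> < 1 / 16" and A: "approximates_VR_barcode \<epsilon> A T"
    and M: "M \<in> carrier_mat nr nc" "enumerates_nonzeros es M"
  obtains t where "real t \<le> T nv"
    "runs (entry_oracle es) (rank_prog L A) (setup_cost L * (m + 1) + (11 + Suc (cost (count_prog L))) * t)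
      (\<lambda>s. fst s 0 = real (vec_space.rank nr M)) (input_state [m, nr, nc])"
proof -
  obtain \<kappa> where \<kappa>: "card sols = 2 ^ \<kappa>" "vec_space.rank nr M + \<kappa> = nrows m"
    using card_sols[OF M] .
  let ?d = "graph_metric adj"
  have "Metric_space {..<nv} ?d" by (rule Metric_space_graph_metric[OF adj_sym])
  moreover have "diam ?d {..<nv} \<le> 1" by (rule diam_graph_metric) simp
  ultimately obtain t s B C where run: "exec (distance_oracle nv ?d) A (input_state [nv]) t s"
    and t: "real t \<le> T nv" and out: "outputs_barcode s B" and C: "VR_barcode 1 {..<nv} ?d C"
    and dist: "bottleneck_distance B C \<le> ereal \<epsilon>"
    using A unfolding approximates_VR_barcode_def by blast
  \<comment> \<open>The hypothesis on \<open>A\<close> supplies the barcode \<open>C\<close>; the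
    number of solutions determines it.\<close>
  have "C = replicate_mset \<kappa> (1 / 4, ereal (1 / 2))"
  proof (rule VR_barcode_graph_metric[OF _ _ _ C])
    show "{..<nv} \<noteq> {}" by (auto simp: nv_def lessThan_empty_iff)
    show "card (carrier (homology 1 K)) = 2 ^ \<kappa>" using card_homology \<kappa> by simp
  qed simp
  then have long: "size {#p \<in># B. ereal (fst p + (1 / 2 - 1 / 4) / 2) < snd p#} = \<kappa>"
    using dist \<epsilon> by (intro bottleneck_long_bars[where \<epsilon> = \<epsilon>]) simp_all
  obtain k where k: "fst s 0 = real k" "B = mset (map (\<lambda>i. (snd s 0 i, ereal (snd s 1 i))) [0..<k])"
    using out unfolding outputs_barcode_def by blast
  have "size {#p \<in># B. ereal (fst p + (1 / 2 - 1 / 4) / 2) < snd p#} =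
      length (filter (\<lambda>i. snd s 0 i + 1 / 8 < snd s 1 i) [0..<k])"
    unfolding k(2) mset_filter [symmetric] size_mset filter_map length_map by (simp add: o_def)
  also have "\<dots> = card {j. j < k \<and> snd s 0 j + 1 / 8 < snd s 1 j}"
    unfolding length_filter_conv_card by (rule arg_cong[where f = card]) auto
  finally have card: "card {j. j < k \<and> snd s 0 j + 1 / 8 < snd s 1 j} = \<kappa>" using long by simp
  \<comment> \<open>Counting the long bars takes time proportional to \<open>k\<close>, so
    \<open>k\<close> has to be bounded by the running time of the simulated algorithm.\<close>
  have kt: "k \<le> t" using output_size_le_time[OF run out] k(2) by simp

  let ?orc = "entry_oracle es" and ?res = "\<lambda>s. fst s 0 = real (vec_space.rank nr M)"
  let ?c = "cost (row_prog L) + cost (entry_prog L)"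
  have build: "runs ?orc (WhileLess (rK L) (rM L) (Seq (row_prog L) (entry_prog L))) (m * Suc ?c + 1) (entries_done L m) s"
    if "entries_done L 0 s" for s
  proof (rule runs_while[where P = "entries_done L", OF _ _ that])
    fix i s assume i: "i < m" "entries_done L i s"
    have "runs ?orc (row_prog L) (cost (row_prog L)) (row_done L i) s"
      by (rule wp_runs[OF wp_row[OF i(2,1)]])
    then have "runs ?orc (Seq (row_prog L) (entry_prog L)) ?c (entries_done L (Suc i)) s"
      by (rule runs_Seq) (rule wp_runs[OF wp_entry])
    then show "fst s (rK L) < fst s (rM L) \<and> runs ?orc (Seq (row_prog L) (entry_prog L)) ?c (entries_done L (Suc i)) s"
      using i by (simp add: entries_done_def const_regs_def)
  qed (simp add: entries_done_def const_regs_def)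
  have close: "runs ?orc (WhileLess (rK L) (rM L) (close_prog L)) (m * Suc (cost (close_prog L)) + 1) (closed L m) s"
    if "closed L 0 s" for s
  proof (rule runs_while[where P = "closed L", OF _ _ that])
    fix i s assume i: "i < m" "closed L i s"
    show "fst s (rK L) < fst s (rM L) \<and> runs ?orc (close_prog L) (cost (close_prog L)) (closed L (Suc i)) s"
      using i wp_runs[OF wp_close[OF i(2,1)]] by (simp add: closed_def const_regs_def)
  qed (simp add: closed_def const_regs_def)
  let ?start = "\<lambda>S. agree L (input_state [nv]) S \<and> graph_inv L S"
  have start: "wp ?orc (seqs [Arith 0 Add (rNB L) (r0 L), Const 1 0, Const 2 0]) ?start s" if "closed L m s" for s
  proof -
    obtain r a where ra: "s = (r, a)" by force
    show ?thesis
      using that L unfolding ra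
      by (auto simp: closed_def const_regs_def array_state_def agree_def input_state_def graph_inv_def)
  qed
  let ?sim = "\<lambda>S. agree L s S \<and> graph_inv L S"
  have sim: "runs ?orc (replace_query (query_prog L) A) (11 * t) ?sim S" if "?start S" for S
    by (rule replace_query_runs[OF run L(2), where Inv = "graph_inv L"])
      (use that runs_query_prog in \<open>auto simp: graph_inv_def\<close>)
  have init_count: "wp ?orc (seqs [Const (rK L) 0, Const (rCnt L) 0, Const (rT L) (1 / 8)])
      (\<lambda>S'. \<exists>a. a 0 = snd s 0 \<and> a 1 = snd s 1 \<and> counted L k a 0 S') S" if "?sim S" for S
  proof -
    obtain r a where ra: "S = (r, a)" by force
    show ?thesis
      using that L k(1) unfolding ra
      by (auto simp: agree_def graph_inv_def counted_def of_rat_divide intro!: exI[of _ a])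
  qed
  have count: "runs ?orc (WhileLess (rK L) 0 (count_prog L)) (k * Suc (cost (count_prog L)) + 1)
      (\<lambda>S'. \<exists>a. a 0 = snd s 0 \<and> a 1 = snd s 1 \<and> counted L k a k S') S"
    if ex: "\<exists>a. a 0 = snd s 0 \<and> a 1 = snd s 1 \<and> counted L k a 0 S" for S
  proof -
    from ex obtain a where a: "a 0 = snd s 0" "a 1 = snd s 1" "counted L k a 0 S"
      by (elim exE conjE) (rule that)
    have "runs ?orc (WhileLess (rK L) 0 (count_prog L)) (k * Suc (cost (count_prog L)) + 1) (counted L k a k) S"
    proof (rule runs_while[where P = "counted L k a", OF _ _ a(3)])
      fix i S assume i: "i < k" "counted L k a i S"
      show "fst S (rK L) < fst S 0 \<and> runs ?orc (count_prog L) (cost (count_prog L)) (counted L k a (Suc i)) S"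
        using i wp_runs[OF wp_count[OF i(2) L(1)]] by (simp add: counted_def)
    qed (simp add: counted_def)
    then show ?thesis
    proof (rule runs_mono)
      fix S' assume "counted L k a k S'"
      then show "\<exists>a. a 0 = snd s 0 \<and> a 1 = snd s 1 \<and> counted L k a k S'"
        using a(1,2) by (intro exI[of _ a] conjI)
    qed simp
  qed
  have finish: "wp ?orc (seqs [Arith 0 Sub (rNB L) (rBase L), Arith 0 Sub 0 (rCnt L)]) ?res S"
    if "\<exists>a. a 0 = snd s 0 \<and> a 1 = snd s 1 \<and> counted L k a k S" for S
  proof -
    obtain r a where ra: "S = (r, a)" by force
    have "real nv - real (5 + 2 * m) - real \<kappa> = real (vec_space.rank nr M)"
      using \<kappa>(2) by (simp add: nv_def flip: of_nat_add)
    then show ?thesis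
      using that L card unfolding ra by (auto simp: counted_def)
  qed
  have reset: "wp ?orc (Const (rK L) 0) (closed L 0) s" if "entries_done L m s" for s
    using that by (cases s)
      (auto simp: entries_done_def closed_def const_regs_def array_state_def fe_def nv_def)
  \<comment> \<open>The summands follow the items of \<open>rank_prog\<close>; a \<open>seqs\<close>
    block costs one step more than its instructions, for its final \<open>Skip\<close>.\<close>
  have prog: "runs ?orc (rank_prog L A) (cost (init_prog L) + ((m * Suc ?c + 1) + (1 +
    ((m * Suc (cost (close_prog L)) + 1) + (4 + (11 * t + (4 +
    ((k * Suc (cost (count_prog L)) + 1) + (3 + 1))))))))) ?res (input_state [m, nr, nc])"
    unfolding rank_prog_def
  proof (rule runs_seqs)
    show "runs ?orc (init_prog L) (cost (init_prog L)) (entries_done L 0) (input_state [m, nr, nc])"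
      by (rule wp_runs[OF wp_init[OF L(1)]])
  qed (rule runs_seqs[OF build] runs_seqs[OF close] runs_seqs[OF sim] runs_seqs[OF count]
      runs_seqs[OF runs_mono[OF wp_runs[OF reset]]] runs_seqs[OF runs_mono[OF wp_runs[OF start]]]
      runs_seqs[OF runs_mono[OF wp_runs[OF init_count]]] runs_seqs[OF runs_mono[OF wp_runs[OF finish]]]
      runs_seqs_Nil, (assumption | simp add: seqs_def; fail)+)+
  have "runs ?orc (rank_prog L A) (setup_cost L * (m + 1) + (11 + Suc (cost (count_prog L))) * t)
      ?res (input_state [m, nr, nc])"
  proof (rule runs_mono[OF prog])
    have "k * Suc (cost (count_prog L)) \<le> t * Suc (cost (count_prog L))" using kt by (rule mult_le_mono1)
    then show "cost (init_prog L) + ((m * Suc ?c + 1) + (1 +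
        ((m * Suc (cost (close_prog L)) + 1) + (4 + (11 * t + (4 +
        ((k * Suc (cost (count_prog L)) + 1) + (3 + 1)))))))) \<le>
      setup_cost L * (m + 1) + (11 + Suc (cost (count_prog L))) * t"
      by (simp add: setup_cost_def algebra_simps)
  qed
  then show ?thesis using that t by blast
qed

end

section \<open>Running time\<close>

text \<open>The finitely many values before the bound sets in are added to the constant; the summand
  1 covers small \<open>n\<close>, as \<open>real n powr q\<close> vanishes at 0.\<close>

lemma bigo_powr_bound:
  assumes "T \<in> O(\<lambda>n. real n powr q)"
  obtains C :: real where "0 \<le> C" "\<And>n. T n \<le> C * (1 + real n powr q)"
proof -
  from assms obtain c where c: "0 < c" "eventually (\<lambda>n. norm (T n) \<le> c * norm (real n powr q)) at_top"
    by (elim landau_o.bigE)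
  then obtain N where N: "\<And>n. N \<le> n \<Longrightarrow> \<bar>T n\<bar> \<le> c * (real n powr q)"
    by (auto simp: eventually_at_top_linorder)
  let ?C = "c + (\<Sum>n<N. \<bar>T n\<bar>)"
  have sum: "0 \<le> (\<Sum>n<N. \<bar>T n\<bar>)" by (simp add: sum_nonneg)
  have "T n \<le> ?C * (1 + real n powr q)" for n
  proof (cases "N \<le> n")
    case True
    have "T n \<le> c * (real n powr q)" using N[OF True] by simp
    also have "\<dots> \<le> ?C * (1 + real n powr q)" using c sum by (intro mult_mono) auto
    finally show ?thesis .
  next
    case False
    then have "T n \<le> (\<Sum>n<N. \<bar>T n\<bar>)"
      using member_le_sum[of n "{..<N}" "\<lambda>n. \<bar>T n\<bar>"] by simp
    also have "\<dots> \<le> ?C * 1" using c by simp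
    also have "\<dots> \<le> ?C * (1 + real n powr q)" using c sum by (intro mult_left_mono) auto
    finally show ?thesis .
  qed
  then show ?thesis using that[of ?C] c sum by simp
qed

text \<open>For \<open>m \<ge> 1\<close>, \<open>5 + 3 * m\<close> is at most \<open>8 * m\<close>,
  and \<open>1 \<le> q\<close> absorbs the linear cost of the setup.\<close>

lemma time_bound_bigo:
  fixes s w q :: real
  assumes "1 \<le> q" "0 \<le> s" "0 \<le> w"
  shows "(\<lambda>m. s * (real m + 1) + w * (1 + real (5 + 3 * m) powr q)) \<in> O(\<lambda>m. real m powr q)"
proof (rule bigoI)
  show "eventually (\<lambda>m. norm (s * (real m + 1) + w * (1 + real (5 + 3 * m) powr q)) \<le>
      (s * 2 + w * (1 + 8 powr q)) * norm (real m powr q)) at_top"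
  proof (rule eventually_at_top_linorderI)
    fix m :: nat assume m: "1 \<le> m"
    let ?p = "real m powr q"
    have "real m powr 1 \<le> ?p" using m assms by (intro powr_mono) auto
    then have p: "real m \<le> ?p" "1 \<le> ?p" using m by auto
    have "real (5 + 3 * m) powr q \<le> (8 * real m) powr q" using m assms by (intro powr_mono2) auto
    also have "\<dots> = 8 powr q * ?p" by (simp add: powr_mult)
    finally have "1 + real (5 + 3 * m) powr q \<le> (1 + 8 powr q) * ?p" using p by (simp add: distrib_right)
    then have "w * (1 + real (5 + 3 * m) powr q) \<le> w * ((1 + 8 powr q) * ?p)"
      using assms by (intro mult_left_mono) auto
    moreover have "s * (real m + 1) \<le> s * (2 * ?p)"
      using assms p by (intro mult_left_mono) auto
    ultimately have "s * (real m + 1) + w * (1 + real (5 + 3 * m) powr q) \<le> (s * 2 + w * (1 + 8 powr q)) * ?p"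
      by (simp add: distrib_right mult.assoc)
    moreover have "0 \<le> s * (real m + 1) + w * (1 + real (5 + 3 * m) powr q)"
      using assms by simp
    ultimately show "norm (s * (real m + 1) + w * (1 + real (5 + 3 * m) powr q)) \<le>
        (s * 2 + w * (1 + 8 powr q)) * norm ?p" by simp
  qed
qed

text \<open>\<open>T\<close> may fail to be monotone, so it is replaced by the monotone bound
  \<open>C * (1 + real n powr q)\<close> before \<open>nv\<close> is estimated by the
  stride.\<close>

lemma (in entry_list) rank_prog_time:
  assumes "3 \<le> L" "cells_below L A" "\<epsilon> < 1 / 16" "approximates_VR_barcode \<epsilon> A T"
    and "M \<in> carrier_mat nr nc" "enumerates_nonzeros es M"
    and q: "1 \<le> q" and C: "0 \<le> C" "\<And>n. T n \<le> C * (1 + real n powr q)"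
  shows "\<exists>t s. exec (entry_oracle es) (rank_prog L A) (input_state [m, nr, nc]) t s \<and>
    real t \<le> real (setup_cost L) * (real m + 1) +
      real (11 + Suc (cost (count_prog L))) * C * (1 + real stride powr q) \<and>
    fst s 0 = real (vec_space.rank nr M)"
proof -
  define w where "w = 11 + Suc (cost (count_prog L))"
  obtain t where t: "real t \<le> T nv"
    "runs (entry_oracle es) (rank_prog L A) (setup_cost L * (m + 1) + w * t)
      (\<lambda>s. fst s 0 = real (vec_space.rank nr M)) (input_state [m, nr, nc])"
    unfolding w_def by (rule rank_prog_runs[OF assms(1-6)])
  from t(2) obtain t' s where run: "exec (entry_oracle es) (rank_prog L A) (input_state [m, nr, nc]) t' s"
    "t' \<le> setup_cost L * (m + 1) + w * t" "fst s 0 = real (vec_space.rank nr M)"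
    unfolding runs_def by blast
  have "real nv powr q \<le> real stride powr q"
    using nv_le_stride q by (intro powr_mono2) auto
  then have "C * (1 + real nv powr q) \<le> C * (1 + real stride powr q)"
    using C(1) by (intro mult_left_mono) auto
  then have "T nv \<le> C * (1 + real stride powr q)" using C(2)[of nv] by linarith
  then have "real w * real t \<le> real w * (C * (1 + real stride powr q))"
    using t(1) by (intro mult_left_mono) auto
  moreover have "real t' \<le> real (setup_cost L * (m + 1) + w * t)" using run(2) by (rule of_nat_mono)
  ultimately have "real t' \<le> real (setup_cost L) * (real m + 1) + real w * C * (1 + real stride powr q)"
    by (simp add: mult.assoc)
  then show ?thesis using run(1,3) unfolding w_def by blast
qed

theorem corollary43:
  shows "\<exists>\<epsilon>\<^sub>0 > (0::real). \<forall>\<epsilon>. 0 < \<epsilon> \<and> \<epsilon> < \<epsilon>\<^sub>0 \<longrightarrow>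
    (\<forall>(A::prog) (q::real). 1 \<le> q \<and>
       (\<exists>T. T \<in> O(\<lambda>n. real n powr q) \<and> approximates_VR_barcode \<epsilon> A T) \<longrightarrow>
       (\<exists>(R::prog) T'. T' \<in> O(\<lambda>m. real m powr q) \<and> computes_rank R T'))"
proof (intro exI[of _ "1 / 16"] conjI allI impI)
  fix \<epsilon> q :: real and A
  assume \<epsilon>: "0 < \<epsilon> \<and> \<epsilon> < 1 / 16"
    and "1 \<le> q \<and> (\<exists>T. T \<in> O(\<lambda>n. real n powr q) \<and> approximates_VR_barcode \<epsilon> A T)"
  then obtain T where q: "1 \<le> q" and T: "T \<in> O(\<lambda>n. real n powr q)" "approximates_VR_barcode \<epsilon> A T"
    by blast
  obtain C where C: "0 \<le> C" "\<And>n. T n \<le> C * (1 + real n powr q)"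
    using bigo_powr_bound[OF T(1)] by blast
  obtain L0 where "cells_below L0 A" using cells_below_exists by blast
  \<comment> \<open>At least 3, because registers 0, 1 and 2 hold the input and arrays 0 and 1 the
    output of \<open>A\<close>, all of which must lie below the reserved cells.\<close>
  then have L: "3 \<le> max 3 L0" "cells_below (max 3 L0) A" by (auto elim: cells_below_mono)
  define L where "L = max 3 L0"
  define w where "w = 11 + Suc (cost (count_prog L))"
  let ?T' = "\<lambda>m. real (setup_cost L) * (real m + 1) + real w * C * (1 + real (5 + 3 * m) powr q)"
  have "computes_rank (rank_prog L A) ?T'"
    unfolding computes_rank_def
  proof (intro allI impI)
    fix nr nc M es assume M: "M \<in> carrier_mat nr nc \<and> enumerates_nonzeros es M"
    then have "entry_list es" by (simp add: entry_list_def enumerates_nonzeros_def)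
    from entry_list.rank_prog_time[OF this L[folded L_def] _ T(2) conjunct1[OF M] conjunct2[OF M] _ C]
    show "\<exists>t s. exec (entry_oracle es) (rank_prog L A) (input_state [length es, nr, nc]) t s \<and>
        real t \<le> ?T' (length es) \<and> fst s 0 = real (vec_space.rank nr M)"
      using \<epsilon> q unfolding w_def by simp
  qed
  moreover have "?T' \<in> O(\<lambda>m. real m powr q)"
    using time_bound_bigo[OF q, of "real (setup_cost L)" "real w * C"] C(1) by simp
  ultimately show "\<exists>R T'. T' \<in> O(\<lambda>m. real m powr q) \<and> computes_rank R T'" by blast
qed simp

end
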